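(* Let $n\ge3$, $a_0,\dots,a_{n-1}\in\mathbb{C}$, $a_n=1$, let $r_0,\dots,r_{n-1}\in\mathcal{AAP}(\mathbb{R})$ (resp. $\mathcal{AAP}_0(\mathbb{R})$), $r_n\equiv0$, and consider $$(E)\qquad y^{(n)}(t)+\sum_{i=0}^{n-1}(a_i+r_i(t))\,y^{(i)}(t)=0,\qquad t\in\mathbb{R}.$$ Let $\lambda$ be a fixed root of $P(a;x)=x^n+\sum_{i=0}^{n-1}a_ix^i$, let $\lambda_1,\dots,\lambda_{n-1}$ be the other roots, and assume that $\gamma_j=\lambda_j-\lambda$ ($j=1,\dots,n-1$) are pairwise different with $\alpha_j=\Re\gamma_j\ne0$. With the notation of the context, assume $$L_0<1\quad\text{and}\quad\Big\|\sum_{i=0}^{n-2}\big|G[P(r;\lambda)]^{(i)}\big|\Big\|_\infty\le\max\{[1-L_0-m(\delta)Q_0]\,\delta:\delta\in(0,\delta_\lambda)\}.$$ Then there exists a solution $y$ of $(E)$ satisfying $$\begin{aligned}y(t)=\ &e^{\lambda t}\exp\bigg((-1)^n\prod_{j=1}^{n-1}\gamma_j^{-1}\int_0^t\big[P(r(s);\lambda)+\mathcal{L}(s,z(s))+\mathcal{F}(s,Z(s))\big]ds\bigg)\\&\times\exp\bigg(-\sum_{j=1}^{n-1}\frac1{\Gamma_j\gamma_j}G_{\gamma_j}\big[P(r;\lambda)+\mathcal{L}(\cdot,z)+\mathcal{F}(\cdot,Z)\big](t)\bigg),\end{aligned}$$ where $Z=(z,z',\dots,z^{(n-2)})$, $z$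 is a solution of $$(R)\qquad\mathcal{D}z(t)+P(r(t);\lambda)+\mathcal{L}(t,z)+\mathcal{F}(t,z,\dots,z^{(n-2)})=0\quad\text{in }\mathbb{R},$$ and $z^{(i)}\in\mathcal{AAP}(\mathbb{R})$ (resp. $\mathcal{AAP}_0(\mathbb{R})$) for $i=0,\dots,n-2$. Moreover, if $r_i=\mu_i+\nu_i$, $i=0,\dots,n-1$, with $\mu_i\in\mathcal{AP}(\mathbb{R})$ and $\nu_i\in BC_0(\mathbb{R})$ (resp. $C_{00}(\mathbb{R})$), then $z=\theta+\psi$, where $\theta\in\mathcal{AP}^{n-2}(\mathbb{R})$ and $\psi\in BC_0^{n-2}(\mathbb{R})$ (resp. $C_{00}^{n-2}(\mathbb{R})$) satisfy $$(T)\qquad\theta=-G\big[P(\mu;\lambda)+\mathcal{L}_\mu(\cdot,\theta)+\mathcal{F}_\mu(\cdot,\Theta)\big]$$ and $$(S)\qquad\psi=-G\big[P(\nu;\lambda)+\mathcal{L}_\nu(\cdot,\theta)+\tilde{\mathcal{F}}_\nu(\cdot,\Theta)+\mathcal{L}(\cdot,\psi)+\tilde{\mathcal{L}}_\theta(\cdot,\Psi)+\tilde{\mathcal{F}}_\theta(\cdot,\Psi)\big],$$ with $\Theta=(\theta,\theta',\dots,\theta^{(n-2)})$ and $\Psi=(\psi,\psi',\dots,\psi^{(n-2)})$. Conversely, if $\theta\in\mathcal{AP}(\mathbb{R})$ and $\psi\in BC_0(\mathbb{R})$ (resp. $C_{00}(\mathbb{R})$) satisfy $(T)$ and $(S)$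 respectively, then $z=\theta+\psi$ is a solution of $(R)$ in $\mathcal{AAP}(\mathbb{R})$ (resp. $\mathcal{AAP}_0(\mathbb{R})$).
   Context: All functions map $\mathbb{R}$ to $\mathbb{C}$. $\mathcal{AP}(\mathbb{R})$: continuous $r$ such that every real sequence $\{b_k\}$ has a subsequence $\{\tilde b_m\}$ for which $\lim_mr(t+\tilde b_m)$ exists uniformly in $t\in\mathbb{R}$. $BC(\mathbb{R})$: bounded continuous functions; $BC_0(\mathbb{R})$: those $f\in BC(\mathbb{R})$ with $f(t)\to0$ as $t\to+\infty$; $C_{00}(\mathbb{R})$: those $f\in BC_0(\mathbb{R})$ with also $f(t)\to0$ as $t\to-\infty$. $\mathcal{AAP}(\mathbb{R})=\mathcal{AP}(\mathbb{R})\oplus BC_0(\mathbb{R})$, $\mathcal{AAP}_0(\mathbb{R})=\mathcal{AP}(\mathbb{R})\oplus C_{00}(\mathbb{R})$. For any of these spaces $E$, $E^{n-2}$ denotes the functions $f$ with $f^{(i)}\in E$ for $i=0,\dots,n-2$. $\|\cdot\|_\infty$ is the supremum norm on $\mathbb{R}$. Green operators: for $\omega\in\mathbb{C}$, $\Re\omega\ne0$, $g_\omega(t,s)=-\mathrm{sgn}(\Re\omega)e^{\omega(t-s)}$ if $\mathrm{sgn}(\Re\omega)(t-s)<0$ and $0$ otherwise; $G_\omega[f](t)=\int_{-\infty}^\infty g_\omega(t,s)f(s)ds$, $I_\omega[f](t)=\int_{-\infty}^\infty|g_\omega(t,s)f(s)|ds$. $\Gamma_j=\prod_{k\ne j,\,1\le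 k\le n-1}(\gamma_j-\gamma_k)$, $\tilde\alpha_j=\sum_{i=0}^{n-2}|\gamma_j|^i$, $G[f]=\sum_{j=1}^{n-1}\frac1{\Gamma_j}G_{\gamma_j}[f]$. For $c=(c_0,\dots,c_n)$, $P(c;x)=\sum_{i=0}^nc_ix^i$; $a=(a_0,\dots,a_{n-1},1)$, $r=(r_0,\dots,r_{n-1},0)$, $\mu=(\mu_0,\dots,\mu_{n-1},0)$, $\nu=(\nu_0,\dots,\nu_{n-1},0)$ (so $\mu_n=\nu_n=r_n\equiv0$); $\frac{\partial^k}{\partial x^k}P(\cdot;\lambda)$ is the $k$-th derivative in $x$ at $x=\lambda$, and $\lambda^0=1$ also for $\lambda=0$. Complete Bell polynomials: $B_0=1$, $B_{i+1}(x_1,\dots,x_{i+1})=\sum_{j=0}^i\binom ijB_{i-j}(x_1,\dots,x_{i-j})x_{j+1}$; $f_i(x_1,\dots,x_i)=B_{i+1}(x_1,\dots,x_{i+1})-x_{i+1}$ (a polynomial in $x_1,\dots,x_i$ only). Set $\mathcal{D}z=\sum_{j=1}^n\frac1{j!}\frac{\partial^j}{\partial x^j}P(a;\lambda)z^{(j-1)}$, $\mathcal{L}(t,z)=\sum_{k=1}^{n-1}\frac1{k!}\frac{\partial^k}{\partial x^k}P(r(t);\lambda)z^{(k-1)}(t)$, and $\mathcal{L}_\mu,\mathcal{L}_\nu$ are defined as $\mathcal{L}$ with $r$ replaced by $\mu,\nu$; $$\mathcal{F}(t,z,\dots,z^{(n-2)})=\sum_{i=2}^n\sum_{j=0}^{n-i}\binom{i+j}j(a_{i+j}+r_{i+j}(t))\lambda^jf_{i-1}(z,\dots,z^{(i-2)}),$$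 $$\mathcal{F}_\mu(t,\Theta)=\sum_{i=2}^n\sum_{j=0}^{n-i}\binom{i+j}j(a_{i+j}+\mu_{i+j}(t))\lambda^j\big[B_i(\theta,\dots,\theta^{(i-1)})-\theta^{(i-1)}\big],$$ $$\tilde{\mathcal{F}}_\nu(t,\Theta)=\sum_{i=2}^n\sum_{j=0}^{n-i}\binom{i+j}j\nu_{i+j}(t)\lambda^j\big[B_i(\theta,\dots,\theta^{(i-1)})-\theta^{(i-1)}\big],$$ $$\tilde{\mathcal{L}}_\theta(t,\Psi)=\sum_{i=2}^n\sum_{j=0}^{n-i}\binom{i+j}j(a_{i+j}+r_{i+j}(t))\lambda^j\sum_{k=1}^{i-1}\binom ikB_{i-k}(\theta,\dots,\theta^{(i-k-1)})\psi^{(k-1)},$$ $$\tilde{\mathcal{F}}_\theta(t,\Psi)=\sum_{i=2}^n\sum_{j=0}^{n-i}\binom{i+j}j(a_{i+j}+r_{i+j}(t))\lambda^j\sum_{k=2}^i\binom ikB_{i-k}(\theta,\dots,\theta^{(i-k-1)})\big[B_k(\psi,\dots,\psi^{(k-1)})-\psi^{(k-1)}\big].$$ (The expression $B_i(x_1,\dots,x_i)-x_i$ does not involve $x_i$, so only derivatives up to order $n-2$ occur.) The function $m$: with $\|X\|=\sum_k|x_k|$ and $B(0;\delta)$ the ball of radius $\delta$ centred at $0$ in $\mathbb{R}^i$, $m_i(\delta)=\sup\{|f_i(X)-f_i(Y)|/\|X-Y\|:X\ne Y,\ X,Y\in B(0;\delta)\}$, $m(\delta)=\max_{i=2,\dots,n}m_i(\delta)$,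 $m(0)=0$ (continuous on $[0,\infty)$, positive for $\delta>0$, tending to $+\infty$ as $\delta\to+\infty$). $$L_0=\sum_{j=1}^{n-1}\sum_{k=1}^{n-1}\Big|\frac{\tilde\alpha_j}{\Gamma_jk!}\Big|\Big\|I_{\alpha_j}\Big[\frac{\partial^k}{\partial x^k}P(r(\cdot);\lambda)\Big]\Big\|_\infty,\quad Q_0=\sum_{j=1}^{n-1}\sum_{i=2}^n\sum_{k=0}^{i-2}\frac{\tilde\alpha_j}{|\Gamma_j|}\binom ik|\lambda|^k\Big(\frac{|a_i|}{|\alpha_j|}+\|I_{\alpha_j}[|r_i|]\|_\infty\Big).$$ When $L_0<1$, $\delta_\lambda>0$ is the number such that $0<m(\delta)<\frac{1-L_0}{Q_0}$ for $\delta\in(0,\delta_\lambda)$ and $m(\delta_\lambda)=\frac{1-L_0}{Q_0}$. *)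

theory Defs
  imports "HOL-Analysis.Analysis" "HOL-Computational_Algebra.Polynomial"
begin

section \<open>Derivatives and function spaces\<close>

definition nderiv :: "nat \<Rightarrow> (real \<Rightarrow> complex) \<Rightarrow> real \<Rightarrow> complex" where
  "nderiv i f = ((\<lambda>g t. vector_derivative g (at t)) ^^ i) f"

text \<open>The library's \<open>vector_derivative\<close> is total, so the existence of the derivatives is always
  required separately by the following predicate.\<close>

definition times_differentiable :: "nat \<Rightarrow> (real \<Rightarrow> complex) \<Rightarrow> bool" where
  "times_differentiable k f \<longleftrightarrow> (\<forall>i<k. \<forall>t. nderiv i f differentiable (at t))"

definition AP :: "(real \<Rightarrow> complex) set" where
  "AP = {f. continuous_on UNIV f \<and>
     (\<forall>b :: nat \<Rightarrow> real. \<exists>\<rho> :: nat \<Rightarrow> nat. strict_mono \<rho> \<and>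
        (\<exists>g. uniform_limit UNIV (\<lambda>m t. f (t + b (\<rho> m))) g sequentially))}"

definition BC :: "(real \<Rightarrow> complex) set" where
  "BC = {f. continuous_on UNIV f \<and> bounded (range f)}"

text \<open>Decay is required at \<open>+\<infinity>\<close> only.\<close>

definition BC0 :: "(real \<Rightarrow> complex) set" where
  "BC0 = {f \<in> BC. (f \<longlongrightarrow> 0) at_top}"

definition C00 :: "(real \<Rightarrow> complex) set" where
  "C00 = {f \<in> BC0. (f \<longlongrightarrow> 0) at_bot}"

definition AAP :: "(real \<Rightarrow> complex) set" where
  "AAP = {\<lambda>t. f t + g t | f g. f \<in> AP \<and> g \<in> BC0}"

definition AAP0 :: "(real \<Rightarrow> complex) set" where
  "AAP0 = {\<lambda>t. f t + g t | f g. f \<in> AP \<and> g \<in> C00}"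

text \<open>\<open>with_derivs k E\<close> is the space written \<open>E\<close> with exponent \<open>k\<close>.\<close>

definition with_derivs :: "nat \<Rightarrow> (real \<Rightarrow> complex) set \<Rightarrow> (real \<Rightarrow> complex) set" where
  "with_derivs k E = {f. times_differentiable k f \<and> (\<forall>i\<le>k. nderiv i f \<in> E)}"

text \<open>Only ever applied to bounded functions.\<close>

definition supnorm :: "(real \<Rightarrow> 'a::real_normed_vector) \<Rightarrow> real" where
  "supnorm f = (SUP t. norm (f t))"

section \<open>Green operators\<close>

definition green_kernel :: "complex \<Rightarrow> real \<Rightarrow> real \<Rightarrow> complex" where
  "green_kernel \<omega> t s =
     (if sgn (Re \<omega>) * (t - s) < 0
      then - of_real (sgn (Re \<omega>)) * exp (\<omega> * of_real (t - s)) else 0)"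

definition green1 :: "complex \<Rightarrow> (real \<Rightarrow> complex) \<Rightarrow> real \<Rightarrow> complex" where
  "green1 \<omega> f t = (LBINT s. green_kernel \<omega> t s * f s)"

definition green_abs :: "complex \<Rightarrow> (real \<Rightarrow> complex) \<Rightarrow> real \<Rightarrow> real" where
  "green_abs \<omega> f t = (LBINT s. cmod (green_kernel \<omega> t s * f s))"

definition Gam :: "nat \<Rightarrow> (nat \<Rightarrow> complex) \<Rightarrow> nat \<Rightarrow> complex" where
  "Gam n \<gamma> j = (\<Prod>k\<in>{1..n-1} - {j}. \<gamma> j - \<gamma> k)"

definition alpha_tilde :: "nat \<Rightarrow> (nat \<Rightarrow> complex) \<Rightarrow> nat \<Rightarrow> real" where
  "alpha_tilde n \<gamma> j = (\<Sum>i=0..n-2. cmod (\<gamma> j) ^ i)"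

definition green :: "nat \<Rightarrow> (nat \<Rightarrow> complex) \<Rightarrow> (real \<Rightarrow> complex) \<Rightarrow> real \<Rightarrow> complex" where
  "green n \<gamma> f t = (\<Sum>j=1..n-1. 1 / Gam n \<gamma> j * green1 (\<gamma> j) f t)"

text \<open>The Bochner integral of a non-integrable function is \<open>0\<close>; this predicate says that all
  integrals in \<open>green n \<gamma> f\<close> are genuine.\<close>

definition green_defined :: "nat \<Rightarrow> (nat \<Rightarrow> complex) \<Rightarrow> (real \<Rightarrow> complex) \<Rightarrow> bool" where
  "green_defined n \<gamma> f \<longleftrightarrow>
     (\<forall>j\<in>{1..n-1}. \<forall>t. integrable lborel (\<lambda>s. green_kernel (\<gamma> j) t s * f s))"

section \<open>Bell polynomials and the function \<open>m\<close>\<close>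

text \<open>Arguments are numbered from 1: \<open>x k\<close> stands for \<open>x\<^sub>k\<close>, and \<open>x 0\<close> is never used.\<close>

fun bell :: "nat \<Rightarrow> (nat \<Rightarrow> 'a::comm_ring_1) \<Rightarrow> 'a" where
  "bell 0 x = 1"
| "bell (Suc i) x = (\<Sum>j=0..i. of_nat (i choose j) * bell (i - j) x * x (j + 1))"

definition bell_f :: "nat \<Rightarrow> (nat \<Rightarrow> 'a::comm_ring_1) \<Rightarrow> 'a" where
  "bell_f i x = bell (i + 1) x - x (i + 1)"

text \<open>In \<open>bell_f\<close> the variable with index \<open>i + 1\<close> cancels:\<close>

lemma bell_f_eq:
  "bell_f i x = (\<Sum>j<i. of_nat (i choose j) * bell (i - j) x * x (j + 1))"
  by (simp add: bell_f_def atLeast0AtMost lessThan_Suc_atMost [symmetric])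

definition l1norm :: "nat \<Rightarrow> (nat \<Rightarrow> real) \<Rightarrow> real" where
  "l1norm i X = (\<Sum>k=1..i. \<bar>X k\<bar>)"

text \<open>Extensional functions on \<open>{1..i}\<close> serve as the points of the \<open>i\<close>-dimensional real space.\<close>

definition l1ball :: "nat \<Rightarrow> real \<Rightarrow> (nat \<Rightarrow> real) set" where
  "l1ball i \<delta> = {X \<in> {1..i} \<rightarrow>\<^sub>E UNIV. l1norm i X < \<delta>}"

definition mi :: "nat \<Rightarrow> real \<Rightarrow> real" where
  "mi i \<delta> = Sup {\<bar>bell_f i X - bell_f i Y\<bar> / l1norm i (\<lambda>k. X k - Y k) | X Y.
                   X \<noteq> Y \<and> X \<in> l1ball i \<delta> \<and> Y \<in> l1ball i \<delta>}"

definition m :: "nat \<Rightarrow> real \<Rightarrow> real" where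
  "m n \<delta> = (if \<delta> = 0 then 0 else Max ((\<lambda>i. mi i \<delta>) ` {2..n}))"

section \<open>The operators of the Riccati type equation\<close>

text \<open>\<open>poly (Pol n c) x\<close> is \<open>P(c;x)\<close>, so \<open>dP k n c lam\<close> is the \<open>k\<close>-th derivative of \<open>P(c;\<cdot>)\<close> at
  \<open>lam\<close>. Time-dependent coefficient vectors \<open>c :: nat \<Rightarrow> real \<Rightarrow> complex\<close> are passed as
  \<open>\<lambda>i. c i t\<close>.\<close>

definition Pol :: "nat \<Rightarrow> (nat \<Rightarrow> complex) \<Rightarrow> complex poly" where
  "Pol n c = (\<Sum>i=0..n. monom (c i) i)"

definition dP :: "nat \<Rightarrow> nat \<Rightarrow> (nat \<Rightarrow> complex) \<Rightarrow> complex \<Rightarrow> complex" where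
  "dP k n c x = poly ((pderiv ^^ k) (Pol n c)) x"

definition Pfun :: "nat \<Rightarrow> (nat \<Rightarrow> real \<Rightarrow> complex) \<Rightarrow> complex \<Rightarrow> real \<Rightarrow> complex" where
  "Pfun n c lam t = poly (Pol n (\<lambda>i. c i t)) lam"

text \<open>The tuple \<open>(z(t), z'(t), \<dots>)\<close>, numbered from 1 as in \<open>bell\<close>.\<close>

definition jet :: "(real \<Rightarrow> complex) \<Rightarrow> real \<Rightarrow> nat \<Rightarrow> complex" where
  "jet z t k = nderiv (k - 1) z t"

definition Dop :: "nat \<Rightarrow> (nat \<Rightarrow> complex) \<Rightarrow> complex \<Rightarrow> (real \<Rightarrow> complex) \<Rightarrow> real \<Rightarrow> complex" where
  "Dop n a lam z t = (\<Sum>j=1..n. 1 / fact j * dP j n a lam * nderiv (j - 1) z t)"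

text \<open>\<open>\<L>\<close>, \<open>\<L>\<^sub>\<mu>\<close>, \<open>\<L>\<^sub>\<nu>\<close> are \<open>Lop\<close> with \<open>c = r, \<mu>, \<nu>\<close>. Similarly \<open>\<F>\<close> and \<open>\<F>\<^sub>\<mu>\<close> are \<open>Fop\<close> with
  \<open>c = r, \<mu>\<close>, since \<open>bell_f (i - 1) x\<close> is \<open>bell i x - x i\<close> for \<open>i \<ge> 1\<close>.\<close>

definition Lop ::
  "nat \<Rightarrow> complex \<Rightarrow> (nat \<Rightarrow> real \<Rightarrow> complex) \<Rightarrow> (real \<Rightarrow> complex) \<Rightarrow> real \<Rightarrow> complex" where
  "Lop n lam c z t = (\<Sum>k=1..n-1. 1 / fact k * dP k n (\<lambda>i. c i t) lam * nderiv (k - 1) z t)"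

definition Fop ::
  "nat \<Rightarrow> (nat \<Rightarrow> complex) \<Rightarrow> complex \<Rightarrow> (nat \<Rightarrow> real \<Rightarrow> complex) \<Rightarrow> (real \<Rightarrow> complex) \<Rightarrow> real \<Rightarrow> complex"
  where
  "Fop n a lam c z t = (\<Sum>i=2..n. \<Sum>j=0..n-i.
     of_nat ((i + j) choose j) * (a (i + j) + c (i + j) t) * lam ^ j * bell_f (i - 1) (jet z t))"

definition Ftilde_nu ::
  "nat \<Rightarrow> complex \<Rightarrow> (nat \<Rightarrow> real \<Rightarrow> complex) \<Rightarrow> (real \<Rightarrow> complex) \<Rightarrow> real \<Rightarrow> complex" where
  "Ftilde_nu n lam \<nu> \<theta> t = (\<Sum>i=2..n. \<Sum>j=0..n-i.
     of_nat ((i + j) choose j) * \<nu> (i + j) t * lam ^ j * (bell i (jet \<theta> t) - jet \<theta> t i))"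

definition Ltilde_theta ::
  "nat \<Rightarrow> (nat \<Rightarrow> complex) \<Rightarrow> complex \<Rightarrow> (nat \<Rightarrow> real \<Rightarrow> complex) \<Rightarrow>
   (real \<Rightarrow> complex) \<Rightarrow> (real \<Rightarrow> complex) \<Rightarrow> real \<Rightarrow> complex" where
  "Ltilde_theta n a lam r \<theta> \<psi> t = (\<Sum>i=2..n. \<Sum>j=0..n-i.
     of_nat ((i + j) choose j) * (a (i + j) + r (i + j) t) * lam ^ j *
     (\<Sum>k=1..i-1. of_nat (i choose k) * bell (i - k) (jet \<theta> t) * nderiv (k - 1) \<psi> t))"

definition Ftilde_theta ::
  "nat \<Rightarrow> (nat \<Rightarrow> complex) \<Rightarrow> complex \<Rightarrow> (nat \<Rightarrow> real \<Rightarrow> complex) \<Rightarrow>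
   (real \<Rightarrow> complex) \<Rightarrow> (real \<Rightarrow> complex) \<Rightarrow> real \<Rightarrow> complex" where
  "Ftilde_theta n a lam r \<theta> \<psi> t = (\<Sum>i=2..n. \<Sum>j=0..n-i.
     of_nat ((i + j) choose j) * (a (i + j) + r (i + j) t) * lam ^ j *
     (\<Sum>k=2..i. of_nat (i choose k) * bell (i - k) (jet \<theta> t) *
        (bell k (jet \<psi> t) - jet \<psi> t k)))"

section \<open>The smallness constants\<close>

definition L0 :: "nat \<Rightarrow> (nat \<Rightarrow> real \<Rightarrow> complex) \<Rightarrow> complex \<Rightarrow> (nat \<Rightarrow> complex) \<Rightarrow> real" where
  "L0 n r lam \<gamma> = (\<Sum>j=1..n-1. \<Sum>k=1..n-1.
     cmod (of_real (alpha_tilde n \<gamma> j) / (Gam n \<gamma> j * fact k)) *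
     supnorm (green_abs (of_real (Re (\<gamma> j))) (\<lambda>s. dP k n (\<lambda>i. r i s) lam)))"

definition Q0 ::
  "nat \<Rightarrow> (nat \<Rightarrow> complex) \<Rightarrow> (nat \<Rightarrow> real \<Rightarrow> complex) \<Rightarrow> complex \<Rightarrow> (nat \<Rightarrow> complex) \<Rightarrow> real" where
  "Q0 n a r lam \<gamma> = (\<Sum>j=1..n-1. \<Sum>i=2..n. \<Sum>k=0..i-2.
     alpha_tilde n \<gamma> j / cmod (Gam n \<gamma> j) * of_nat (i choose k) * cmod lam ^ k *
     (cmod (a i) / \<bar>Re (\<gamma> j)\<bar> +
      supnorm (green_abs (of_real (Re (\<gamma> j))) (\<lambda>s. of_real (cmod (r i s))))))"

definition delta_lambda ::
  "nat \<Rightarrow> (nat \<Rightarrow> complex) \<Rightarrow> (nat \<Rightarrow> real \<Rightarrow> complex) \<Rightarrow> complex \<Rightarrow> (nat \<Rightarrow> complex) \<Rightarrow> real" where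
  "delta_lambda n a r lam \<gamma> = (THE d. 0 < d \<and>
     (\<forall>\<delta>\<in>{0<..<d}. 0 < m n \<delta> \<and> m n \<delta> < (1 - L0 n r lam \<gamma>) / Q0 n a r lam \<gamma>) \<and>
     m n d = (1 - L0 n r lam \<gamma>) / Q0 n a r lam \<gamma>)"

section \<open>Solutions\<close>

definition solves_E ::
  "nat \<Rightarrow> (nat \<Rightarrow> complex) \<Rightarrow> (nat \<Rightarrow> real \<Rightarrow> complex) \<Rightarrow> (real \<Rightarrow> complex) \<Rightarrow> bool" where
  "solves_E n a r y \<longleftrightarrow> times_differentiable n y \<and>
     (\<forall>t. nderiv n y t + (\<Sum>i=0..n-1. (a i + r i t) * nderiv i y t) = 0)"

definition solves_R ::
  "nat \<Rightarrow> (nat \<Rightarrow> complex) \<Rightarrow> (nat \<Rightarrow> real \<Rightarrow> complex) \<Rightarrow> complex \<Rightarrow> (real \<Rightarrow> complex) \<Rightarrow> bool" where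
  "solves_R n a r lam z \<longleftrightarrow> times_differentiable (n - 1) z \<and>
     (\<forall>t. Dop n a lam z t + Pfun n r lam t + Lop n lam r z t + Fop n a lam r z t = 0)"

text \<open>To satisfy one of the two integral equations includes that the derivatives and the integrals
  occurring in it exist.\<close>

definition solves_T ::
  "nat \<Rightarrow> (nat \<Rightarrow> complex) \<Rightarrow> (nat \<Rightarrow> real \<Rightarrow> complex) \<Rightarrow> complex \<Rightarrow> (nat \<Rightarrow> complex) \<Rightarrow>
   (real \<Rightarrow> complex) \<Rightarrow> bool" where
  "solves_T n a \<mu> lam \<gamma> \<theta> \<longleftrightarrow>
     (let h = (\<lambda>t. Pfun n \<mu> lam t + Lop n lam \<mu> \<theta> t + Fop n a lam \<mu> \<theta> t)
      in times_differentiable (n - 2) \<theta> \<and> green_defined n \<gamma> h \<and>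
         (\<forall>t. \<theta> t = - green n \<gamma> h t))"

definition solves_S ::
  "nat \<Rightarrow> (nat \<Rightarrow> complex) \<Rightarrow> (nat \<Rightarrow> real \<Rightarrow> complex) \<Rightarrow> (nat \<Rightarrow> real \<Rightarrow> complex) \<Rightarrow>
   complex \<Rightarrow> (nat \<Rightarrow> complex) \<Rightarrow> (real \<Rightarrow> complex) \<Rightarrow> (real \<Rightarrow> complex) \<Rightarrow> bool" where
  "solves_S n a r \<nu> lam \<gamma> \<theta> \<psi> \<longleftrightarrow>
     (let h = (\<lambda>t. Pfun n \<nu> lam t + Lop n lam \<nu> \<theta> t + Ftilde_nu n lam \<nu> \<theta> t
                 + Lop n lam r \<psi> t + Ltilde_theta n a lam r \<theta> \<psi> t + Ftilde_theta n a lam r \<theta> \<psi> t)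
      in times_differentiable (n - 2) \<theta> \<and> times_differentiable (n - 2) \<psi> \<and>
         green_defined n \<gamma> h \<and> (\<forall>t. \<psi> t = - green n \<gamma> h t))"

text \<open>The coefficient splitting \<open>r\<^sub>i = \<mu>\<^sub>i + \<nu>\<^sub>i\<close>, with the convention \<open>\<mu>\<^sub>n = \<nu>\<^sub>n = 0\<close>.\<close>

definition splitting ::
  "nat \<Rightarrow> (real \<Rightarrow> complex) set \<Rightarrow> (nat \<Rightarrow> real \<Rightarrow> complex) \<Rightarrow> (nat \<Rightarrow> real \<Rightarrow> complex) \<Rightarrow>
   (nat \<Rightarrow> real \<Rightarrow> complex) \<Rightarrow> bool" where
  "splitting n W r \<mu> \<nu> \<longleftrightarrow>
     (\<forall>i<n. \<mu> i \<in> AP \<and> \<nu> i \<in> W \<and> (\<forall>t. r i t = \<mu> i t + \<nu> i t)) \<and>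
     (\<forall>t. \<mu> n t = 0 \<and> \<nu> n t = 0)"

text \<open>The function displayed for \<open>y\<close> in terms of \<open>z\<close>.\<close>

definition y_formula ::
  "nat \<Rightarrow> (nat \<Rightarrow> complex) \<Rightarrow> (nat \<Rightarrow> real \<Rightarrow> complex) \<Rightarrow> complex \<Rightarrow> (nat \<Rightarrow> complex) \<Rightarrow>
   (real \<Rightarrow> complex) \<Rightarrow> real \<Rightarrow> complex" where
  "y_formula n a r lam \<gamma> z t =
     (let h = (\<lambda>s. Pfun n r lam s + Lop n lam r z s + Fop n a lam r z s)
      in exp (lam * of_real t) *
         exp ((-1) ^ n * (\<Prod>j=1..n-1. inverse (\<gamma> j)) * (LBINT s=0..ereal t. h s)) *
         exp (- (\<Sum>j=1..n-1. 1 / (Gam n \<gamma> j * \<gamma> j) * green1 (\<gamma> j) h t)))"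

end

theory Submission
  imports Defs "HOL-Library.Diagonal_Subsequence"
begin

text \<open>Substituting \<open>y = exp (\<integral> (\<lambda> + z))\<close> turns \<open>(E)\<close> into \<open>\<D> z + h = 0\<close>, where \<open>h\<close> is a
  polynomial in \<open>z, \<dots>, z\<^sup>(\<^sup>n\<^sup>-\<^sup>2\<^sup>)\<close>, and \<open>G\<close> inverts \<open>\<D>\<close>; so \<open>z = - G h\<close>, and the derivatives of \<open>z\<close>
  are explicit combinations of the \<open>G\<^sub>\<gamma> h\<close>. We iterate on \<open>h\<close> rather than on \<open>z\<close>: the smallness
  assumption makes the iteration a contraction in the derivatives of \<open>z\<close>, which forces uniform
  convergence of the \<open>h\<close>'s. The same iteration with the coefficients \<open>\<mu>\<close> produces the almost periodic
  parts of the iterates, and since \<open>\<parallel>f\<parallel> \<le> \<parallel>f + g\<parallel>\<close> for almost periodic \<open>f\<close> and vanishing \<open>g\<close>, these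
  converge as well, without any smallness assumption on \<open>\<mu>\<close>. The limits are \<open>\<theta>\<close> and \<open>\<psi>\<close>.\<close>

section \<open>Bell polynomials\<close>

text \<open>Iterating on \<open>h\<close> keeps all limits in the supremum norm: \<open>z\<close>
  and its derivatives up to order n - 2 are bounded operators applied to \<open>h\<close>, so the
  function spaces only have to be closed under uniform limits. Three obstacles shape the rest. The
  function \<open>m\<close> is built from real Bell polynomials on open balls, while the jets are
  complex and only known to stay in a closed ball; nonnegative coefficients settle the first point,
  continuity of \<open>m\<close> the second. The monomials of f_i have degrees from 2 to i + 1,
  which gives two-sided scaling bounds for \<open>m\<close>; from these and from the term 3 x_1 x_2
  of f_2 follow monotonicity, continuity and growth, hence the existence of \<delta>_\<lambda> and
  of the maximum in the hypothesis. In the converse the top derivatives of \<theta> and \<psi> are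
  not known to be continuous, so Green operators are differentiated up to order n - 2 under
  integrability alone, which works because of the weights 1 / \<Gamma>_j. The two versions of the
  theorem differ only in the filter along which functions vanish.\<close>

lemma bell_cong:
  assumes "\<And>k. k \<in> {1..i} \<Longrightarrow> x k = y k"
  shows "bell i x = bell i y"
  using assms
proof (induction i rule: less_induct)
  case (less i)
  show ?case
  proof (cases i)
    case (Suc k)
    have "bell (k - j) x = bell (k - j) y \<and> x (j + 1) = y (j + 1)" if "j \<le> k" for j
      using that less Suc by simp
    then show ?thesis unfolding Suc by (auto intro!: sum.cong)
  qed simp
qed

lemma bell_f_cong:
  assumes "\<And>k. k \<in> {1..i} \<Longrightarrow> x k = y k"
  shows "bell_f i x = bell_f i y"
  unfolding bell_f_eq using assms by (intro sum.cong refl arg_cong2[where f="(*)"] bell_cong) auto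

lemma sum_triangle_swap:
  fixes F :: "nat \<Rightarrow> nat \<Rightarrow> 'a::comm_monoid_add"
  shows "(\<Sum>j\<le>p. \<Sum>k\<le>p - j. F j k) = (\<Sum>k\<le>p. \<Sum>j\<le>p - k. F j k)"
  by (simp add: sum.Sigma)
    (rule sum.reindex_bij_witness[of _ "\<lambda>(a, b). (b, a)" "\<lambda>(a, b). (b, a)"]; auto)

lemma sum_triangle_diagonal:
  fixes F :: "nat \<Rightarrow> nat \<Rightarrow> 'a::comm_monoid_add"
  shows "(\<Sum>j\<le>p. \<Sum>k\<le>p - j. F j k) = (\<Sum>l\<le>p. \<Sum>j\<le>l. F j (l - j))"
  by (simp add: sum.Sigma)
    (rule sum.reindex_bij_witness[of _ "\<lambda>(l, j). (j, l - j)" "\<lambda>(j, k). (j + k, j)"]; auto)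

text \<open>Pascal's rule in Leibniz form: the right-hand side differentiates each product
  \<open>u (p - k) * v k\<close> once, with a raised index standing for a derivative. It closes both
  the addition formula and the derivative formula for \<open>bell\<close>.\<close>

lemma sum_choose_Suc:
  fixes u v :: "nat \<Rightarrow> 'a::comm_ring_1"
  shows "(\<Sum>k\<le>Suc p. of_nat (Suc p choose k) * u (Suc p - k) * v k) =
    (\<Sum>k\<le>p. of_nat (p choose k) * (u (Suc (p - k)) * v k + u (p - k) * v (Suc k)))"
proof -
  have "(\<Sum>k\<le>Suc p. of_nat (Suc p choose k) * u (Suc p - k) * v k) =
      u (Suc p) * v 0 + (\<Sum>k\<le>p. of_nat (p choose Suc k) * u (p - k) * v (Suc k))
        + (\<Sum>k\<le>p. of_nat (p choose k) * u (p - k) * v (Suc k))"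
    by (subst sum.atMost_Suc_shift) (simp add: algebra_simps sum.distrib)
  also have "u (Suc p) * v 0 + (\<Sum>k\<le>p. of_nat (p choose Suc k) * u (p - k) * v (Suc k))
      = (\<Sum>k\<le>Suc p. of_nat (p choose k) * u (Suc p - k) * v k)"
    by (subst sum.atMost_Suc_shift) simp
  also have "\<dots> = (\<Sum>k\<le>p. of_nat (p choose k) * u (Suc (p - k)) * v k)"
    by (simp add: Suc_diff_le binomial_eq_0)
  finally show ?thesis
    by (simp add: algebra_simps sum.distrib)
qed

text \<open>The exponential generating function of the B_i is the exponential of that of the x_j, so
  adding arguments multiplies generating functions. In the proof the recursion is split along
  \<open>x (j + 1) + y (j + 1)\<close>; each half collapses by the recursion again, and Pascal's
  rule joins the halves.\<close>

lemma bell_add: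
  fixes x y :: "nat \<Rightarrow> 'a::comm_ring_1"
  shows "bell i (\<lambda>k. x k + y k) = (\<Sum>k\<le>i. of_nat (i choose k) * bell (i - k) x * bell k y)"
proof (induction i rule: less_induct)
  case (less i)
  show ?case
  proof (cases i)
    case (Suc p)
    let ?c = "\<lambda>j k. of_nat ((p choose j) * ((p - j) choose k)) :: 'a"
    have ix: "(p choose j) * ((p - j) choose k) = (p choose k) * ((p - k) choose j)"
      "(p choose (j + k)) * ((j + k) choose j) = (p choose j) * ((p - j) choose k)"
      if "j + k \<le> p" for j k
      using choose_mult[of j "j + k" p] choose_mult[of k "j + k" p]
        binomial_symmetric[of j "j + k"] that by simp_all
    have 1: "bell i (\<lambda>k. x k + y k) = (\<Sum>j\<le>p. of_nat (p choose j) *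
        (\<Sum>k\<le>p - j. of_nat ((p - j) choose k) * bell (p - j - k) x * bell k y) * (x (j+1) + y (j+1)))"
      unfolding Suc using less Suc by (simp add: atLeast0AtMost)
    have 2: "\<dots> = (\<Sum>j\<le>p. \<Sum>k\<le>p - j. ?c j k * bell (p - j - k) x * bell k y * x (j+1)) +
        (\<Sum>j\<le>p. \<Sum>k\<le>p - j. ?c j k * bell (p - j - k) x * bell k y * y (j+1))"
      by (simp add: algebra_simps sum_distrib_left sum_distrib_right sum.distrib)
    \<comment> \<open>For fixed k the sum over j is the recursion for
      \<open>bell (Suc (p - k)) x\<close>.\<close>
    have 3: "(\<Sum>j\<le>p. \<Sum>k\<le>p - j. ?c j k * bell (p - j - k) x * bell k y * x (j+1)) =
        (\<Sum>k\<le>p. \<Sum>j\<le>p - k. ?c j k * bell (p - j - k) x * bell k y * x (j+1))"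
      by (rule sum_triangle_swap)
    have 4: "\<dots> = (\<Sum>k\<le>p. \<Sum>j\<le>p - k. ?c k j * bell (p - j - k) x * bell k y * x (j+1))"
      by (intro sum.cong refl) (subst ix(1); simp)
    have 5: "\<dots> = (\<Sum>k\<le>p. of_nat (p choose k) * (bell (Suc (p - k)) x * bell k y))"
      by (simp add: atLeast0AtMost sum_distrib_left sum_distrib_right mult_ac add_ac)
    \<comment> \<open>Here l = j + k is kept fixed instead, so that the sum over j becomes the
      recursion for \<open>bell (Suc l) y\<close>.\<close>
    have 6: "(\<Sum>j\<le>p. \<Sum>k\<le>p - j. ?c j k * bell (p - j - k) x * bell k y * y (j+1)) =
        (\<Sum>l\<le>p. \<Sum>j\<le>l. ?c j (l - j) * bell (p - j - (l - j)) x * bell (l - j) y * y (j+1))"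
      by (rule sum_triangle_diagonal)
    have 7: "\<dots> = (\<Sum>l\<le>p. \<Sum>j\<le>l. of_nat ((p choose l) * (l choose j)) * bell (p - l) x * bell (l - j) y * y (j+1))"
    proof (intro sum.cong refl)
      fix l j assume "l \<in> {..p}" "j \<in> {..l}"
      then show "?c j (l - j) * bell (p - j - (l - j)) x * bell (l - j) y * y (j+1) =
          of_nat ((p choose l) * (l choose j)) * bell (p - l) x * bell (l - j) y * y (j+1)"
        using ix(2)[of j "l - j"] by simp
    qed
    have 8: "\<dots> = (\<Sum>k\<le>p. of_nat (p choose k) * (bell (p - k) x * bell (Suc k) y))"
      by (simp add: atLeast0AtMost sum_distrib_left sum_distrib_right mult_ac)
    show ?thesis
      unfolding Suc using sum_choose_Suc[of p "\<lambda>k. bell k x" "\<lambda>k. bell k y"] 1 2 3 4 5 6 7 8 Suc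
      by (simp only: sum.distrib distrib_left)
  qed simp
qed

lemma bell_nonneg:
  fixes U :: "nat \<Rightarrow> real"
  assumes "\<And>k. 0 \<le> U k"
  shows "0 \<le> bell i U"
  using assms by (induction i U rule: bell.induct) (auto intro!: sum_nonneg)

text \<open>The coefficients of the Bell polynomials are nonnegative, so increments are dominated by
  those at the absolute values.\<close>

lemma bell_majorant:
  fixes x y :: "nat \<Rightarrow> 'a::real_normed_field" and U V :: "nat \<Rightarrow> real"
  assumes "\<And>k. norm (x k) \<le> U k" "\<And>k. norm (y k - x k) \<le> V k - U k"
  shows "norm (bell i x) \<le> bell i U \<and> norm (bell i y - bell i x) \<le> bell i V - bell i U"
proof (induction i rule: less_induct)
  case (less i)
  show ?case
  proof (cases i)
    case (Suc p)
    have U0: "0 \<le> U k" "U k \<le> V k" "norm (y k) \<le> V k" for k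
      using assms(1)[of k] assms(2)[of k] norm_triangle_sub[of "y k" "x k"] norm_ge_zero[of "x k"]
        norm_ge_zero[of "y k - x k"] by linarith+
    have IH: "norm (bell (p - j) x) \<le> bell (p - j) U"
      "norm (bell (p - j) y - bell (p - j) x) \<le> bell (p - j) V - bell (p - j) U" for j
      using less Suc by simp_all
    have "norm (bell i x) \<le> (\<Sum>j=0..p. norm (of_nat (p choose j) * bell (p - j) x * x (j + 1)))"
      unfolding Suc bell.simps by (rule norm_sum)
    also have "\<dots> \<le> bell i U"
      unfolding Suc bell.simps
      by (auto simp: norm_mult intro!: sum_mono mult_mono IH assms mult_nonneg_nonneg bell_nonneg U0)
    finally have 1: "norm (bell i x) \<le> bell i U" .
    have "norm (bell i y - bell i x) \<le> (\<Sum>j=0..p. norm (of_nat (p choose j) *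
        (bell (p - j) y * y (j + 1) - bell (p - j) x * x (j + 1))))"
      unfolding Suc bell.simps sum_subtractf[symmetric] mult.assoc right_diff_distrib[symmetric]
      by (rule norm_sum)
    also have "\<dots> \<le> (\<Sum>j=0..p. of_nat (p choose j) *
        (bell (p - j) V * V (j + 1) - bell (p - j) U * U (j + 1)))"
    proof (intro sum_mono)
      fix j
      have "bell (p - j) y * y (j + 1) - bell (p - j) x * x (j + 1) =
          (bell (p - j) y - bell (p - j) x) * y (j + 1) + bell (p - j) x * (y (j + 1) - x (j + 1))"
        by (simp add: algebra_simps)
      also have "norm \<dots> \<le> norm (bell (p - j) y - bell (p - j) x) * norm (y (j + 1)) +
          norm (bell (p - j) x) * norm (y (j + 1) - x (j + 1))"
        by (metis norm_mult norm_triangle_ineq)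
      also have "\<dots> \<le> (bell (p - j) V - bell (p - j) U) * V (j + 1) +
          bell (p - j) U * (V (j + 1) - U (j + 1))"
        using order_trans[OF norm_ge_zero IH(2)[of j]]
        by (intro add_mono mult_mono IH U0 assms bell_nonneg norm_ge_zero)
      finally show "norm (of_nat (p choose j) *
          (bell (p - j) y * y (j + 1) - bell (p - j) x * x (j + 1))) \<le>
          of_nat (p choose j) * (bell (p - j) V * V (j + 1) - bell (p - j) U * U (j + 1))"
        unfolding norm_mult norm_of_nat by (intro mult_left_mono) (simp_all add: algebra_simps)
    qed
    also have "\<dots> = bell i V - bell i U"
      unfolding Suc bell.simps sum_subtractf[symmetric] by (simp add: algebra_simps)
    finally show ?thesis using 1 by blast
  qed simp
qed

lemma bell_f_eq_bell_Suc: "bell_f i x = bell (Suc i) (\<lambda>k. if k \<in> {1..i} then x k else 0)"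
proof -
  have "bell_f i x = bell_f i (\<lambda>k. if k \<in> {1..i} then x k else 0)"
    by (rule bell_f_cong) simp
  then show ?thesis by (simp add: bell_f_def)
qed

lemma bell_f_majorant:
  fixes x y :: "nat \<Rightarrow> 'a::real_normed_field" and U V :: "nat \<Rightarrow> real"
  assumes "\<And>k. norm (x k) \<le> U k" "\<And>k. norm (y k - x k) \<le> V k - U k"
  shows "norm (bell_f i y - bell_f i x) \<le> bell_f i V - bell_f i U"
  unfolding bell_f_eq_bell_Suc by (rule bell_majorant[THEN conjunct2]) (use assms in auto)

lemma bell_mono:
  fixes U V :: "nat \<Rightarrow> real"
  assumes "\<And>k. 0 \<le> U k" "\<And>k. U k \<le> V k"
  shows "bell i U \<le> bell i V"
  using bell_majorant[of U U V V i] assms by simp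

lemma bell_zero: "bell i (\<lambda>_. 0) = (if i = 0 then 1 else 0)"
  by (cases i) simp_all

text \<open>From \<open>p * y - q * x = (p - q) * y + q * (y - x)\<close>, where every factor on the
  right is monotone. This is the product step for increments of \<open>bell\<close>.\<close>

lemma mult_diff_mono:
  fixes p q :: real
  assumes "p - q \<le> p' - q'" "q \<le> q'" "0 \<le> y" "x \<le> y"
  shows "p * y - q * x \<le> p' * y - q' * x"
proof -
  have "(p - q) * y + q * (y - x) \<le> (p' - q') * y + q' * (y - x)"
    using assms by (intro add_mono mult_right_mono) auto
  then show ?thesis by (simp add: algebra_simps)
qed

text \<open>For i > 0 the monomials of B_i have nonnegative coefficients and degrees between 1 and
  i, so scaling by s multiplies an increment by a factor between s and s^i; for i = 0 there is no
  increment.\<close>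

lemma bell_scale:
  fixes U V :: "nat \<Rightarrow> real"
  assumes "\<And>k. 0 \<le> U k" "\<And>k. U k \<le> V k" and s: "1 \<le> s"
  shows "s * (bell i V - bell i U) \<le> bell i (\<lambda>k. s * V k) - bell i (\<lambda>k. s * U k)
    \<and> bell i (\<lambda>k. s * V k) - bell i (\<lambda>k. s * U k) \<le> s ^ i * (bell i V - bell i U)"
  using assms(1,2)
proof (induction i arbitrary: U V rule: less_induct)
  case (less i)
  show ?case
  proof (cases i)
    case (Suc p)
    let ?U = "\<lambda>k. s * U k" and ?V = "\<lambda>k. s * V k"
    note U = less.prems(1) and V = less.prems(2)
    have V0: "0 \<le> V k" for k using U V order_trans by blast
    have d0: "0 \<le> bell k V - bell k U" for k using bell_mono[where U=U and V=V, OF U V, of k] by simp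
    have s1: "1 \<le> s ^ k" for k using s by (rule one_le_power)
    have pw: "s ^ (p - j) \<le> s ^ p" for j using s by (intro power_increasing) auto
    \<comment> \<open>The third instance compares \<open>U\<close> with the zero vector and so
      bounds a value of \<open>bell\<close> at the scaled point instead of an increment.\<close>
    have IH: "s * (bell (p - j) V - bell (p - j) U) \<le> bell (p - j) ?V - bell (p - j) ?U"
      "bell (p - j) ?V - bell (p - j) ?U \<le> s ^ (p - j) * (bell (p - j) V - bell (p - j) U)"
      "bell (p - j) ?U - bell (p - j) (\<lambda>_. 0) \<le> s ^ (p - j) * (bell (p - j) U - bell (p - j) (\<lambda>_. 0))" for j
      using less.IH[of "p - j" U V] less.IH[of "p - j" "\<lambda>_. 0" U] U V Suc by auto
    have lo: "bell (p - j) V * V (j + 1) - bell (p - j) U * U (j + 1) \<le>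
        bell (p - j) ?V * V (j + 1) - bell (p - j) ?U * U (j + 1)" for j
    proof (rule mult_diff_mono[OF _ _ V0 V])
      show "bell (p - j) V - bell (p - j) U \<le> bell (p - j) ?V - bell (p - j) ?U"
        using IH(1)[of j] mult_right_mono[OF s d0[of "p - j"]] by simp
      show "bell (p - j) U \<le> bell (p - j) ?U"
        using mult_right_mono[OF s U] by (intro bell_mono U) simp
    qed
    have up: "bell (p - j) ?V * V (j + 1) - bell (p - j) ?U * U (j + 1) \<le>
        s ^ p * bell (p - j) V * V (j + 1) - s ^ p * bell (p - j) U * U (j + 1)" for j
    proof (rule mult_diff_mono[OF _ _ V0 V])
      show "bell (p - j) ?V - bell (p - j) ?U \<le> s ^ p * bell (p - j) V - s ^ p * bell (p - j) U"
        using IH(2)[of j] mult_right_mono[OF pw[of j] d0[of "p - j"]] by (simp add: right_diff_distrib)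
      have "bell (p - j) (\<lambda>_. 0) \<le> s ^ (p - j) * bell (p - j) (\<lambda>_. 0)"
        using s1[of "p - j"] by (simp add: bell_zero)
      then show "bell (p - j) ?U \<le> s ^ p * bell (p - j) U"
        using IH(3)[of j] mult_right_mono[OF pw[of j] bell_nonneg[where U=U, OF U, of "p - j"]]
        by (simp add: right_diff_distrib)
    qed
    have eqs: "s * (bell i V - bell i U) = (\<Sum>j=0..p. s * of_nat (p choose j) *
        (bell (p - j) V * V (j + 1) - bell (p - j) U * U (j + 1)))"
      "bell i ?V - bell i ?U = (\<Sum>j=0..p. s * of_nat (p choose j) *
        (bell (p - j) ?V * V (j + 1) - bell (p - j) ?U * U (j + 1)))"
      "s ^ i * (bell i V - bell i U) = (\<Sum>j=0..p. s * of_nat (p choose j) *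
        (s ^ p * bell (p - j) V * V (j + 1) - s ^ p * bell (p - j) U * U (j + 1)))"
      unfolding Suc bell.simps sum_subtractf[symmetric] sum_distrib_left
      by (simp_all add: algebra_simps)
    show ?thesis
      unfolding eqs by (intro conjI sum_mono mult_left_mono lo up) (use s in auto)
  qed simp
qed

text \<open>Removing x_(i+1) from B_(i+1) removes its only linear monomial, so the degrees now run
  from 2 to i + 1. The exponent 2 is what later makes \<open>m\<close> strictly increasing.\<close>

lemma bell_f_scale:
  fixes U V :: "nat \<Rightarrow> real"
  assumes U: "\<And>k. 0 \<le> U k" and V: "\<And>k. U k \<le> V k" and s: "1 \<le> s"
  shows "s ^ 2 * (bell_f i V - bell_f i U) \<le> bell_f i (\<lambda>k. s * V k) - bell_f i (\<lambda>k. s * U k)"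
    and "bell_f i (\<lambda>k. s * V k) - bell_f i (\<lambda>k. s * U k) \<le> s ^ Suc i * (bell_f i V - bell_f i U)"
proof -
  let ?U = "\<lambda>k. s * U k" and ?V = "\<lambda>k. s * V k"
  have V0: "0 \<le> V k" for k using U V order_trans by blast
  show "s ^ 2 * (bell_f i V - bell_f i U) \<le> bell_f i ?V - bell_f i ?U"
    unfolding bell_f_eq sum_distrib_left sum_subtractf[symmetric]
  proof (intro sum_mono)
    fix j assume "j \<in> {..<i}"
    then have "s * bell (i - j) U \<le> bell (i - j) ?U"
      "s * bell (i - j) V - s * bell (i - j) U \<le> bell (i - j) ?V - bell (i - j) ?U"
      using bell_scale[of "\<lambda>_. 0" U s "i - j"] bell_scale[of U V s "i - j"] U V s
      by (auto simp: bell_zero right_diff_distrib)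
    then have "s * of_nat (i choose j) * (s * bell (i - j) V * V (j + 1) - s * bell (i - j) U * U (j + 1))
      \<le> s * of_nat (i choose j) * (bell (i - j) ?V * V (j + 1) - bell (i - j) ?U * U (j + 1))"
      using s by (intro mult_left_mono mult_diff_mono V0 V) auto
    then show "s\<^sup>2 * (of_nat (i choose j) * bell (i - j) V * V (j + 1) -
         of_nat (i choose j) * bell (i - j) U * U (j + 1))
      \<le> of_nat (i choose j) * bell (i - j) ?V * (s * V (j + 1)) -
        of_nat (i choose j) * bell (i - j) ?U * (s * U (j + 1))"
      by (simp add: algebra_simps power2_eq_square)
  qed
  have tr: "(\<lambda>k. if k \<in> {1..i} then s * w k else 0) = (\<lambda>k. s * (if k \<in> {1..i} then w k else 0))"
    for w :: "nat \<Rightarrow> real" by auto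
  show "bell_f i ?V - bell_f i ?U \<le> s ^ Suc i * (bell_f i V - bell_f i U)"
    unfolding bell_f_eq_bell_Suc tr
    by (rule bell_scale[THEN conjunct2]) (use U V s in auto)
qed

lemma bell_f_zero: "(\<And>k. x k = 0) \<Longrightarrow> bell_f i x = 0"
  by (simp add: bell_f_eq)

section \<open>The function \<open>m\<close>\<close>

text \<open>A one-sided condition on ordered nonnegative vectors is enough: by the majorant property
  it carries over, with the same constant, to arbitrary real or complex vectors. The bound on
  \<open>V\<close> is strict because the balls in \<open>mi\<close> are open.\<close>

definition bell_f_lip :: "nat \<Rightarrow> real \<Rightarrow> real \<Rightarrow> bool" where
  "bell_f_lip i \<delta> K \<longleftrightarrow> (\<forall>U V. (\<forall>k. 0 \<le> U k \<and> U k \<le> V k) \<longrightarrow> (\<Sum>k=1..i. V k) < \<delta> \<longrightarrow>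
     bell_f i V - bell_f i U \<le> K * (\<Sum>k=1..i. V k - U k))"

lemma bell_f_lipD:
  assumes "bell_f_lip i \<delta> K" "\<And>k. 0 \<le> U k" "\<And>k. U k \<le> V k" "(\<Sum>k=1..i. V k) < \<delta>"
  shows "bell_f i V - bell_f i U \<le> K * (\<Sum>k=1..i. V k - U k)"
  using assms unfolding bell_f_lip_def by blast

text \<open>Subdivide the segment from \<open>y\<close> to \<open>x\<close> so finely that the majorants of all
  pieces stay inside the ball.\<close>

lemma bell_f_lip_norm:
  fixes x y :: "nat \<Rightarrow> 'a::real_normed_field"
  assumes lip: "bell_f_lip i \<delta> K"
    and x: "(\<Sum>k=1..i. norm (x k)) < \<delta>" and y: "(\<Sum>k=1..i. norm (y k)) < \<delta>"
  shows "norm (bell_f i x - bell_f i y) \<le> K * (\<Sum>k=1..i. norm (x k - y k))"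
proof -
  define D where "D = (\<Sum>k=1..i. norm (x k - y k))"
  define R where "R = max (\<Sum>k=1..i. norm (x k)) (\<Sum>k=1..i. norm (y k))"
  have D0: "0 \<le> D" by (simp add: D_def sum_nonneg)
  have R: "R < \<delta>" using x y by (simp add: R_def)
  obtain N :: nat where N: "D / (\<delta> - R) < real N" using reals_Archimedean2 by blast
  then have N0: "0 < real N" using D0 R by (smt (verit) divide_nonneg_nonneg)
  have ND: "R + D / N < \<delta>" using N N0 R by (simp add: field_simps)
  define w where "w j k = y k + of_real (real j / real N) * (x k - y k)" for j k
  have step: "norm (bell_f i (w (Suc j)) - bell_f i (w j)) \<le> K * (D / N)" if "j < N" for j
  proof -
    let ?U = "\<lambda>k. norm (w j k)" and ?V = "\<lambda>k. norm (w j k) + norm (x k - y k) / N"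
    have "w j k = of_real (1 - real j / N) * y k + of_real (real j / N) * x k" for k
      by (simp add: w_def algebra_simps diff_divide_distrib)
    then have "norm (w j k) \<le> (1 - real j / N) * norm (y k) + real j / N * norm (x k)" for k
      using norm_triangle_ineq[of "of_real (1 - real j / N) * y k" "of_real (real j / N) * x k"] that
      by (simp add: norm_mult del: of_real_diff of_real_divide)
    then have "(\<Sum>k=1..i. norm (w j k)) \<le>
        (\<Sum>k=1..i. (1 - real j / N) * norm (y k) + real j / N * norm (x k))"
      by (intro sum_mono)
    also have "\<dots> = (1 - real j / N) * (\<Sum>k=1..i. norm (y k)) + real j / N * (\<Sum>k=1..i. norm (x k))"
      by (simp add: sum.distrib sum_distrib_left)
    also have "\<dots> \<le> (1 - real j / N) * R + real j / N * R"
      using that by (intro add_mono mult_left_mono) (auto simp: R_def)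
    also have "\<dots> = R" by (simp add: algebra_simps)
    finally have "(\<Sum>k=1..i. norm (w j k)) \<le> R" .
    then have V: "(\<Sum>k=1..i. ?V k) < \<delta>"
      using ND by (simp add: sum.distrib D_def sum_divide_distrib[symmetric])
    have d: "w (Suc j) k - w j k = of_real (1 / N) * (x k - y k)" for k
      by (simp add: w_def algebra_simps add_divide_distrib)
    have "norm (bell_f i (w (Suc j)) - bell_f i (w j)) \<le> bell_f i ?V - bell_f i ?U"
      by (rule bell_f_majorant) (simp_all add: d norm_mult norm_divide)
    also have "\<dots> \<le> K * (\<Sum>k=1..i. ?V k - ?U k)"
      by (rule bell_f_lipD[OF lip _ _ V]) simp_all
    also have "(\<Sum>k=1..i. ?V k - ?U k) = D / N"
      by (simp add: D_def sum_divide_distrib)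
    finally show ?thesis .
  qed
  have "w N = x" "w 0 = y" using N0 by (auto simp: w_def)
  then have "bell_f i x - bell_f i y = bell_f i (w N) - bell_f i (w 0)"
    by simp
  also have "\<dots> = (\<Sum>j<N. bell_f i (w (Suc j)) - bell_f i (w j))"
    by (rule sum_lessThan_telescope[symmetric])
  also have "norm \<dots> \<le> (\<Sum>j<N. K * (D / N))"
    by (intro order_trans[OF norm_sum] sum_mono step) auto
  also have "\<dots> = K * D" using N0 by simp
  finally show ?thesis unfolding D_def .
qed

text \<open>Convexity: on [0, 1] the power lies below its chord.\<close>

lemma power_one_plus_le:
  fixes x :: real
  assumes "0 \<le> x" "x \<le> 1"
  shows "(1 + x) ^ k - 1 \<le> x * (2 ^ k - 1)"
proof (induction k)
  case (Suc k)
  have "x * (1 + x) ^ k \<le> x * 2 ^ k" using assms by (intro mult_left_mono power_mono) auto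
  then show ?case using Suc by (simp add: algebra_simps)
qed simp

text \<open>Increments are largest at the corner \<open>(\<delta>, \<dots>, \<delta>)\<close>, where they are increments under scaling.\<close>

lemma bell_f_lip_ex:
  assumes \<delta>: "0 < \<delta>"
  shows "\<exists>K\<ge>0. bell_f_lip i \<delta> K"
proof -
  define W :: "nat \<Rightarrow> real" where "W k = \<delta>" for k
  \<comment> \<open>With s = 1 + e / \<delta> the increment from \<open>W\<close> to its multiple by
    s is at most (s^(i+1) - 1) times \<open>bell_f i W\<close>, and the chord bound turns this into
    \<open>K * e\<close>.\<close>
  define K where "K = (2 ^ Suc i - 1) * bell_f i W / \<delta>"
  have W0: "0 \<le> bell_f i W"
    unfolding bell_f_eq_bell_Suc W_def using \<delta> by (intro bell_nonneg) simp
  have "bell_f_lip i \<delta> K"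
    unfolding bell_f_lip_def
  proof (intro allI impI)
    fix U V :: "nat \<Rightarrow> real"
    assume UV: "\<forall>k. 0 \<le> U k \<and> U k \<le> V k" and V: "(\<Sum>k=1..i. V k) < \<delta>"
    define e where "e = (\<Sum>k=1..i. V k - U k)"
    define s where "s = 1 + e / \<delta>"
    have V0: "0 \<le> V k" for k using UV order_trans by blast
    have "e \<le> (\<Sum>k=1..i. V k)" unfolding e_def using UV by (intro sum_mono) auto
    then have e: "0 \<le> e" "0 \<le> e / \<delta>" "e / \<delta> \<le> 1" and s: "1 \<le> s"
      using V UV \<delta> by (auto simp: e_def s_def sum_nonneg)
    \<comment> \<open>Outside \<open>{1..i}\<close> nothing bounds \<open>U\<close> and
      \<open>V\<close>, so they are cut off before being compared with \<open>W\<close>.\<close>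
    let ?U = "\<lambda>k. if k \<in> {1..i} then U k else 0" and ?V = "\<lambda>k. if k \<in> {1..i} then V k else 0"
    have "V k - U k \<le> e \<and> U k \<le> \<delta>" if k: "k \<in> {1..i}" for k
    proof -
      have "V k \<le> (\<Sum>k=1..i. V k)" by (rule member_le_sum[OF k]) (use V0 in auto)
      moreover have "V k - U k \<le> e"
        unfolding e_def by (rule member_le_sum[OF k]) (use UV in auto)
      ultimately show ?thesis using V UV[rule_format, of k] by linarith
    qed
    then have "norm (bell_f i ?V - bell_f i ?U) \<le> bell_f i (\<lambda>k. s * W k) - bell_f i W"
      using UV e \<delta> by (intro bell_f_majorant) (auto simp: W_def s_def algebra_simps)
    then have "bell_f i ?V - bell_f i ?U \<le> bell_f i (\<lambda>k. s * W k) - bell_f i W"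
      unfolding real_norm_def by (rule abs_le_D1)
    moreover have "bell_f i ?V = bell_f i V" "bell_f i ?U = bell_f i U"
      by (rule bell_f_cong; simp)+
    moreover have "bell_f i (\<lambda>k. s * W k) \<le> s ^ Suc i * bell_f i W"
      using bell_f_scale(2)[of "\<lambda>_. 0" W s i] \<delta> s by (simp add: W_def bell_f_zero)
    moreover have "s ^ Suc i * bell_f i W - 1 * bell_f i W \<le> e / \<delta> * (2 ^ Suc i - 1) * bell_f i W"
      unfolding s_def left_diff_distrib[symmetric] by (intro mult_right_mono power_one_plus_le e W0)
    moreover have "e / \<delta> * (2 ^ Suc i - 1) * bell_f i W = K * e" by (simp add: K_def)
    ultimately show "bell_f i V - bell_f i U \<le> K * (\<Sum>k=1..i. V k - U k)"
      unfolding e_def[symmetric] by linarith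
  qed
  moreover have "0 \<le> K" using W0 \<delta> one_le_power[of "2::real" "Suc i"] by (simp add: K_def)
  ultimately show ?thesis by blast
qed

lemma bell_f_lip_mono:
  assumes "bell_f_lip i \<delta> K" "K \<le> K'"
  shows "bell_f_lip i \<delta> K'"
  unfolding bell_f_lip_def
proof (intro allI impI)
  fix U V :: "nat \<Rightarrow> real"
  assume UV: "\<forall>k. 0 \<le> U k \<and> U k \<le> V k" and V: "(\<Sum>k=1..i. V k) < \<delta>"
  have "bell_f i V - bell_f i U \<le> K * (\<Sum>k=1..i. V k - U k)"
    using UV V by (intro bell_f_lipD[OF assms(1)]) auto
  also have "\<dots> \<le> K' * (\<Sum>k=1..i. V k - U k)"
    using UV by (intro mult_right_mono assms(2) sum_nonneg) auto
  finally show "bell_f i V - bell_f i U \<le> K' * (\<Sum>k=1..i. V k - U k)" .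
qed

text \<open>Scaling multiplies distances by s and increments of f_i by a factor between s^2 and
  s^(i+1); dividing leaves the exponents 1 and i.\<close>

lemma bell_f_lip_scale:
  assumes s: "1 \<le> s"
  shows "bell_f_lip i \<delta> K \<Longrightarrow> bell_f_lip i (s * \<delta>) (s ^ i * K)"
    and "bell_f_lip i (s * \<delta>) K \<Longrightarrow> bell_f_lip i \<delta> (K / s)"
proof -
  assume lip: "bell_f_lip i \<delta> K"
  show "bell_f_lip i (s * \<delta>) (s ^ i * K)"
    unfolding bell_f_lip_def
  proof (intro allI impI)
    fix U V :: "nat \<Rightarrow> real"
    assume UV: "\<forall>k. 0 \<le> U k \<and> U k \<le> V k" and V: "(\<Sum>k=1..i. V k) < s * \<delta>"
    let ?U = "\<lambda>k. U k / s" and ?V = "\<lambda>k. V k / s"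
    have "(\<Sum>k=1..i. ?V k) < \<delta>"
      using V s by (simp add: sum_divide_distrib[symmetric] field_simps)
    then have "bell_f i ?V - bell_f i ?U \<le> K * (\<Sum>k=1..i. ?V k - ?U k)"
      using UV s by (intro bell_f_lipD[OF lip]) (auto simp: divide_right_mono)
    then have "s ^ Suc i * (bell_f i ?V - bell_f i ?U) \<le> s ^ Suc i * (K * (\<Sum>k=1..i. ?V k - ?U k))"
      using s by (intro mult_left_mono) auto
    moreover have "bell_f i (\<lambda>k. s * ?V k) - bell_f i (\<lambda>k. s * ?U k) \<le> s ^ Suc i * (bell_f i ?V - bell_f i ?U)"
      using UV s by (intro bell_f_scale) (auto simp: divide_right_mono)
    moreover have "(\<Sum>k=1..i. ?V k - ?U k) = (\<Sum>k=1..i. V k - U k) / s"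
      by (simp add: sum_divide_distrib diff_divide_distrib)
    ultimately have "bell_f i (\<lambda>k. s * ?V k) - bell_f i (\<lambda>k. s * ?U k)
        \<le> s ^ Suc i * (K * ((\<Sum>k=1..i. V k - U k) / s))" by simp
    then show "bell_f i V - bell_f i U \<le> s ^ i * K * (\<Sum>k=1..i. V k - U k)"
      using s by simp
  qed
next
  assume lip: "bell_f_lip i (s * \<delta>) K"
  show "bell_f_lip i \<delta> (K / s)"
    unfolding bell_f_lip_def
  proof (intro allI impI)
    fix U V :: "nat \<Rightarrow> real"
    assume UV: "\<forall>k. 0 \<le> U k \<and> U k \<le> V k" and V: "(\<Sum>k=1..i. V k) < \<delta>"
    have "bell_f i (\<lambda>k. s * V k) - bell_f i (\<lambda>k. s * U k) \<le> K * (\<Sum>k=1..i. s * V k - s * U k)"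
      using UV s V by (intro bell_f_lipD[OF lip]) (auto simp: sum_distrib_left[symmetric] mult_left_mono)
    also have "\<dots> = s * K * (\<Sum>k=1..i. V k - U k)"
      by (simp add: sum_distrib_left algebra_simps)
    finally have "s ^ 2 * (bell_f i V - bell_f i U) \<le> s * K * (\<Sum>k=1..i. V k - U k)"
      using bell_f_scale(1)[of U V s i] UV s by auto
    then have "s * (s * (bell_f i V - bell_f i U)) \<le> s * (K * (\<Sum>k=1..i. V k - U k))"
      by (simp add: power2_eq_square mult_ac)
    then have "s * (bell_f i V - bell_f i U) \<le> K * (\<Sum>k=1..i. V k - U k)"
      using s by (subst (asm) mult_le_cancel_left_pos) auto
    then show "bell_f i V - bell_f i U \<le> K / s * (\<Sum>k=1..i. V k - U k)"
      using s by (simp add: field_simps)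
  qed
qed

section \<open>Lower bounds for Lipschitz constants from f_1 and f_2\<close>

lemma bell_f_2: "bell_f 2 x = x 1 ^ 3 + 3 * x 1 * x 2"
  by (simp add: bell_f_eq lessThan_Suc numeral_2_eq_2 numeral_3_eq_3 algebra_simps)

lemma bell_f_1: "bell_f 1 x = x 1 ^ 2"
  by (simp add: bell_f_eq power2_eq_square)

text \<open>The monomial 3 x_1 x_2 of f_2: with x_2 = c fixed, moving x_1 away from 0 has slope at
  least 3 c.\<close>

lemma bell_f_lip_2:
  assumes lip: "bell_f_lip 2 \<delta> K" and c: "0 \<le> c" "c < \<delta>"
  shows "3 * c \<le> K"
proof -
  define e where "e = (\<delta> - c) / 2"
  have e: "0 < e" "e + c < \<delta>" using c by (auto simp: e_def field_simps)
  have "bell_f 2 (\<lambda>k. if k = 1 then e else if k = 2 then c else 0)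
      - bell_f 2 (\<lambda>k. if k = 2 then c else 0) \<le> K *
      (\<Sum>k=1..2::nat. (if k = 1 then e else if k = 2 then c else 0) - (if k = 2 then c else 0))"
    using e c by (intro bell_f_lipD[OF lip]) (auto simp: numeral_2_eq_2)
  then have "e ^ 3 + 3 * e * c \<le> K * e" unfolding bell_f_2 by (simp add: numeral_2_eq_2)
  moreover have "0 \<le> e ^ 3" using e by (intro zero_le_power) simp
  moreover have "e * (3 * c) = 3 * e * c" "e * K = K * e" by simp_all
  ultimately have "e * (3 * c) \<le> e * K" by linarith
  then show ?thesis using e by simp
qed

text \<open>The maximum defining \<open>m\<close> starts at i = 2, but \<open>Fop\<close> also
  contains f_1. Its slope \<open>V 1 + U 1\<close> is at most \<open>3 * V 1\<close>, which the
  monomial 3 x_1 x_2 of f_2 already forces below \<open>K\<close>.\<close>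

lemma bell_f_lip_1:
  assumes lip: "bell_f_lip 2 \<delta> K"
  shows "bell_f_lip 1 \<delta> K"
  unfolding bell_f_lip_def
proof (intro allI impI)
  fix U V :: "nat \<Rightarrow> real"
  assume UV: "\<forall>k. 0 \<le> U k \<and> U k \<le> V k" and V: "(\<Sum>k=1..1. V k) < \<delta>"
  have V1: "0 \<le> U 1" "U 1 \<le> V 1" "V 1 < \<delta>" using UV V by simp_all
  then have "3 * V 1 \<le> K" by (intro bell_f_lip_2[OF lip]) linarith+
  then have "(V 1 + U 1) * (V 1 - U 1) \<le> K * (V 1 - U 1)"
    using V1 by (intro mult_right_mono) linarith+
  then show "bell_f 1 V - bell_f 1 U \<le> K * (\<Sum>k=1..1. V k - U k)"
    by (simp add: bell_f_1[simplified] power2_eq_square algebra_simps)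
qed

section \<open>The supremum \<open>mi\<close> as the best Lipschitz constant\<close>

abbreviation mi_quotients :: "nat \<Rightarrow> real \<Rightarrow> real set" where
  "mi_quotients i \<delta> \<equiv> {\<bar>bell_f i X - bell_f i Y\<bar> / l1norm i (\<lambda>k. X k - Y k) | X Y.
                   X \<noteq> Y \<and> X \<in> l1ball i \<delta> \<and> Y \<in> l1ball i \<delta>}"

lemma bell_f_quotient_le:
  assumes "bell_f_lip i \<delta> K" "0 \<le> K" "X \<in> l1ball i \<delta>" "Y \<in> l1ball i \<delta>"
  shows "\<bar>bell_f i X - bell_f i Y\<bar> / l1norm i (\<lambda>k. X k - Y k) \<le> K"
proof (cases "l1norm i (\<lambda>k. X k - Y k) = 0")
  case False
  moreover have "0 \<le> l1norm i (\<lambda>k. X k - Y k)" by (simp add: l1norm_def sum_nonneg)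
  ultimately have "0 < l1norm i (\<lambda>k. X k - Y k)" by linarith
  moreover have "\<bar>bell_f i X - bell_f i Y\<bar> \<le> K * l1norm i (\<lambda>k. X k - Y k)"
    using bell_f_lip_norm[OF assms(1), of X Y] assms by (simp add: l1ball_def l1norm_def)
  ultimately show ?thesis by (simp add: divide_le_eq)
\<comment> \<open>In the remaining case the distance is 0, and division by 0 gives 0.\<close>
qed (use assms in simp)

lemma mi_set_bdd:
  assumes "0 < \<delta>"
  shows "bdd_above (mi_quotients i \<delta>)"
proof -
  obtain K where "bell_f_lip i \<delta> K" "0 \<le> K" using bell_f_lip_ex[OF assms, of i] by blast
  then show ?thesis using bell_f_quotient_le by (intro bdd_aboveI[of _ K]) blast
qed

text \<open>Together with \<open>mi_le\<close> this identifies \<open>mi\<close> as the least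
  nonnegative admissible constant, so from here on \<open>bell_f_lip\<close> replaces the supremum
  over extensional functions.\<close>

lemma bell_f_lip_mi:
  assumes "0 < \<delta>"
  shows "bell_f_lip i \<delta> (mi i \<delta>)"
  unfolding bell_f_lip_def
proof (intro allI impI)
  fix U V :: "nat \<Rightarrow> real"
  assume UV: "\<forall>k. 0 \<le> U k \<and> U k \<le> V k" and V: "(\<Sum>k=1..i. V k) < \<delta>"
  define X where "X = restrict V {1..i}"
  define Y where "Y = restrict U {1..i}"
  have V0: "0 \<le> V k" for k using UV order_trans by blast
  have "(\<Sum>k=1..i. U k) \<le> (\<Sum>k=1..i. V k)" using UV by (intro sum_mono) auto
  then have ball: "X \<in> l1ball i \<delta>" "Y \<in> l1ball i \<delta>"
    using UV V V0 by (auto simp: l1ball_def l1norm_def X_def Y_def)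
  have f: "bell_f i X = bell_f i V" "bell_f i Y = bell_f i U"
    by (rule bell_f_cong; simp add: X_def Y_def)+
  have l: "l1norm i (\<lambda>k. X k - Y k) = (\<Sum>k=1..i. V k - U k)"
    using UV by (auto simp: l1norm_def X_def Y_def)
  show "bell_f i V - bell_f i U \<le> mi i \<delta> * (\<Sum>k=1..i. V k - U k)"
  proof (cases "X = Y")
    case True
    then show ?thesis using f l by (simp add: l1norm_def)
  next
    case False
    then obtain k where k: "X k \<noteq> Y k" by auto
    then have "k \<in> {1..i}" by (auto simp: X_def Y_def restrict_def split: if_splits)
    then have "0 < V k - U k" "V k - U k \<le> (\<Sum>k=1..i. V k - U k)"
      using k UV by (auto simp: X_def Y_def less_le intro!: member_le_sum[of k _ "\<lambda>k. V k - U k"])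
    then have pos: "0 < (\<Sum>k=1..i. V k - U k)" by linarith
    have "\<bar>bell_f i X - bell_f i Y\<bar> / l1norm i (\<lambda>k. X k - Y k) \<le> mi i \<delta>"
      unfolding mi_def using False ball by (intro cSup_upper mi_set_bdd assms) blast
    then show ?thesis unfolding f l using pos by (simp add: divide_le_eq)
  qed
qed

lemma mi_le:
  assumes "0 < \<delta>" "1 \<le> i" "bell_f_lip i \<delta> K" "0 \<le> K"
  shows "mi i \<delta> \<le> K"
  unfolding mi_def
proof (rule cSup_least)
  \<comment> \<open>The least upper bound property of \<open>Sup\<close> requires a nonempty set of
    quotients; two distinct points of the ball, differing in the first coordinate, provide
    one.\<close>
  let ?X = "restrict (\<lambda>k. if k = 1 then \<delta> / 2 else 0) {1..i}"
  let ?Y = "restrict (\<lambda>k. 0 :: real) {1..i}"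
  have "?X 1 \<noteq> ?Y 1" using assms by simp
  then have "?X \<noteq> ?Y" by metis
  moreover have "?X \<in> l1ball i \<delta>" "?Y \<in> l1ball i \<delta>"
    using assms by (auto simp: l1ball_def l1norm_def if_distrib[of abs] cong: if_cong)
  ultimately show "mi_quotients i \<delta> \<noteq> {}"
    by blast
next
  fix q
  assume "q \<in> mi_quotients i \<delta>"
  then show "q \<le> K" using bell_f_quotient_le assms by blast
qed

section \<open>Scaling, monotonicity, continuity and growth of \<open>m\<close>\<close>

context
  fixes n :: nat
  assumes n2: "2 \<le> n"
begin

lemma mi_le_m: "0 < \<delta> \<Longrightarrow> i \<in> {2..n} \<Longrightarrow> mi i \<delta> \<le> m n \<delta>"
  unfolding m_def by (auto intro!: Max_ge)

lemma m_le:
  assumes "0 < \<delta>" "\<And>i. i \<in> {2..n} \<Longrightarrow> mi i \<delta> \<le> K"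
  shows "m n \<delta> \<le> K"
  using assms n2 unfolding m_def by (auto intro!: Max.boundedI)

lemma bell_f_lip_m:
  assumes "0 < \<delta>" "i \<in> {1..n}"
  shows "bell_f_lip i \<delta> (m n \<delta>)"
proof (cases "i = 1")
  case True
  have "bell_f_lip 2 \<delta> (m n \<delta>)"
    using bell_f_lip_mono[OF bell_f_lip_mi mi_le_m] assms n2 by simp
  then show ?thesis using True bell_f_lip_1 by simp
next
  case False
  then show ?thesis using bell_f_lip_mono[OF bell_f_lip_mi mi_le_m] assms by simp
qed

text \<open>The slope 3 c of f_2 at c = \<delta> / 2 already exceeds \<delta>. The bound is crude,
  but it yields positivity and growth to infinity at once.\<close>

lemma m_ge:
  assumes "0 < \<delta>"
  shows "\<delta> \<le> m n \<delta>"
  using bell_f_lip_2[OF bell_f_lip_m[OF assms], of "\<delta> / 2"] assms n2 by simp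

text \<open>The two scaling bounds of the single f_i pass to the maximum because i \<le> n. Strict
  monotonicity, continuity and smallness near 0 all come from here.\<close>

lemma m_scale:
  assumes s: "1 \<le> s" and \<delta>: "0 < \<delta>"
  shows "m n (s * \<delta>) \<le> s ^ n * m n \<delta>" and "s * m n \<delta> \<le> m n (s * \<delta>)"
proof -
  have pos: "0 \<le> m n \<delta>" "0 < s * \<delta>" "0 \<le> m n (s * \<delta>)"
    using m_ge[of \<delta>] m_ge[of "s * \<delta>"] s \<delta> mult_pos_pos[of s \<delta>] by linarith+
  show "m n (s * \<delta>) \<le> s ^ n * m n \<delta>"
  proof (rule m_le[OF pos(2)])
    fix i assume i: "i \<in> {2..n}"
    have "mi i (s * \<delta>) \<le> s ^ i * m n \<delta>"
      using i s \<delta> pos by (intro mi_le bell_f_lip_scale bell_f_lip_m) auto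
    also have "\<dots> \<le> s ^ n * m n \<delta>"
      using i s pos by (intro mult_right_mono power_increasing) auto
    finally show "mi i (s * \<delta>) \<le> s ^ n * m n \<delta>" .
  qed
  have "m n \<delta> \<le> m n (s * \<delta>) / s"
    by (intro m_le mi_le bell_f_lip_scale bell_f_lip_m) (use s \<delta> pos in auto)
  then show "s * m n \<delta> \<le> m n (s * \<delta>)" using s by (simp add: field_simps)
qed

lemma m_mono:
  assumes "0 < \<delta>" "\<delta> < \<delta>'"
  shows "m n \<delta> < m n \<delta>'"
proof -
  have "1 * m n \<delta> < \<delta>' / \<delta> * m n \<delta>"
    using assms m_ge[of \<delta>] by (intro mult_strict_right_mono) (auto simp: field_simps)
  then show ?thesis using m_scale(2)[of "\<delta>' / \<delta>" \<delta>] assms by simp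
qed

text \<open>Monotonicity and the upper scaling bound trap \<open>m n x\<close>, on either side of
  \<delta>, between \<open>m n \<delta>\<close> and
  \<open>(x / \<delta>) ^ n * m n \<delta>\<close>.\<close>

lemma isCont_m:
  assumes \<delta>: "0 < \<delta>"
  shows "isCont (m n) \<delta>"
proof -
  define g where "g x = \<bar>(x / \<delta>) ^ n - 1\<bar> * m n \<delta>" for x
  have mono: "m n x \<le> m n x'" if "0 < x" "x \<le> x'" for x x'
    using m_mono[of x x'] that by (cases "x = x'") auto
  have "norm (m n x - m n \<delta>) \<le> g x" if x: "0 < x" for x
  proof (cases "\<delta> \<le> x")
    case True
    have "m n x \<le> (x / \<delta>) ^ n * m n \<delta>" using m_scale(1)[of "x / \<delta>" \<delta>] True \<delta> by simp
    moreover have "1 \<le> (x / \<delta>) ^ n" using True \<delta> by (intro one_le_power) auto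
    ultimately show ?thesis using mono[OF \<delta> True] by (simp add: g_def algebra_simps)
  next
    case False
    then have "m n \<delta> \<le> (\<delta> / x) ^ n * m n x" using m_scale(1)[of "\<delta> / x" x] x by simp
    then have "(x / \<delta>) ^ n * m n \<delta> \<le> m n x"
      using x \<delta> by (simp add: field_simps power_divide)
    moreover have "(x / \<delta>) ^ n \<le> 1" using False x by (intro power_le_one) auto
    ultimately show ?thesis using mono[OF x] False by (simp add: g_def algebra_simps)
  qed
  moreover have "eventually (\<lambda>x. 0 < x) (at \<delta>)"
    using order_tendstoD(1)[OF tendsto_ident_at \<delta>] by blast
  ultimately have ev: "eventually (\<lambda>x. norm (m n x - m n \<delta>) \<le> g x) (at \<delta>)"
    by (auto elim: eventually_mono)
  have "(g \<longlongrightarrow> g \<delta>) (at \<delta>)" unfolding g_def using \<delta> by (intro tendsto_intros) auto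
  then have "(g \<longlongrightarrow> 0) (at \<delta>)" using \<delta> by (simp add: g_def)
  from Lim_null_comparison[OF ev this] show ?thesis
    by (simp add: isCont_def LIM_zero_iff)
qed

text \<open>This makes the definite description in \<open>delta_lambda\<close> meaningful: existence
  by the intermediate value theorem, uniqueness by strict monotonicity.\<close>

lemma m_attains:
  assumes "0 < c"
  shows "\<exists>!d. 0 < d \<and> (\<forall>\<delta>\<in>{0<..<d}. 0 < m n \<delta> \<and> m n \<delta> < c) \<and> m n d = c"
proof -
  \<comment> \<open>Chosen so that \<open>m n p \<le> p * m n 1 \<le> c\<close>, the first
    inequality by scaling; \<open>p\<close> is the lower end for the intermediate value theorem, and
    \<open>m_ge\<close> supplies the upper end.\<close>
  define p where "p = min 1 (c / m n 1)"
  have m1: "0 < m n 1" using m_ge[of 1] by simp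
  have p: "0 < p" "p \<le> 1" using m1 assms by (auto simp: p_def)
  have "m n p \<le> p * m n 1" using m_scale(2)[of "1 / p" p] p by (simp add: field_simps)
  also have "\<dots> \<le> c" using m1 by (simp add: p_def min_def field_simps)
  finally have lo: "m n p \<le> c" .
  have hi: "c \<le> m n (max p c)" using m_ge[of "max p c"] p by linarith
  have "\<exists>x\<ge>p. x \<le> max p c \<and> m n x = c"
    by (rule IVT[where f="m n", OF lo hi]) (use p isCont_m in auto)
  then obtain d where d: "0 < d" "m n d = c" using less_le_trans[OF p(1)] by blast
  have lt: "m n \<delta> < m n d'" "0 < m n \<delta>" if "0 < \<delta>" "\<delta> < d'" for \<delta> d'
    using m_mono[OF that] m_ge[of \<delta>] that by auto
  show ?thesis
  proof (rule ex1I[of _ d])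
    fix d' assume d': "0 < d' \<and> (\<forall>\<delta>\<in>{0<..<d'}. 0 < m n \<delta> \<and> m n \<delta> < c) \<and> m n d' = c"
    show "d' = d"
    proof (rule ccontr)
      assume "d' \<noteq> d"
      then show False using lt(1)[of d d'] lt(1)[of d' d] d d' by linarith
    qed
  qed (use d lt in auto)
qed

end

text \<open>The maximum in the smallness assumption is attained: the function tends to 0 at both ends of
  the interval.\<close>

lemma greatest_attained:
  assumes n: "2 \<le> n" and A: "0 < A" and Q: "0 < Q" and L: "L + A = 1"
    and d: "d = (THE d. 0 < d \<and> (\<forall>\<delta>\<in>{0<..<d}. 0 < m n \<delta> \<and> m n \<delta> < (1 - L) / Q) \<and> m n d = (1 - L) / Q)"
  shows "\<exists>\<delta>>0. L + m n \<delta> * Q < 1 \<and>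
    (GREATEST v. v \<in> (\<lambda>\<delta>. (1 - L - m n \<delta> * Q) * \<delta>) ` {0<..<d}) = (1 - L - m n \<delta> * Q) * \<delta>"
proof -
  have c: "0 < (1 - L) / Q" using A Q L by simp
  have D: "0 < d \<and> (\<forall>\<delta>\<in>{0<..<d}. 0 < m n \<delta> \<and> m n \<delta> < (1 - L) / Q) \<and> m n d = (1 - L) / Q"
    unfolding d by (rule theI'[OF m_attains[OF n c]])
  have d0: "0 < d" and dm: "\<And>\<delta>. 0 < \<delta> \<Longrightarrow> \<delta> < d \<Longrightarrow> 0 < m n \<delta> \<and> m n \<delta> < (1 - L) / Q"
    and md: "m n d = (1 - L) / Q" using D by auto
  define f where "f \<delta> = (1 - L - m n \<delta> * Q) * \<delta>" for \<delta>
  have fpos: "0 < f \<delta>" if "0 < \<delta>" "\<delta> < d" for \<delta>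
    using dm[OF that] that Q unfolding f_def by (intro mult_pos_pos) (auto simp: field_simps)
  have fd: "f d = 0" using md Q by (simp add: f_def)
  define v where "v = f (d / 2)"
  have v: "0 < v" using fpos[of "d/2"] d0 by (simp add: v_def)
  \<comment> \<open>Since f \<delta> \<le> A \<delta>, the values of f on (0, e] stay below its
    value \<open>v\<close> at the midpoint. The supremum over the open interval is therefore a
    maximum over the compact interval from e to d, and f d = 0 excludes the end point d.\<close>
  define e where "e = min (d / 2) (v / A)"
  have e: "0 < e" "e \<le> d / 2" "e * A \<le> v" using v d0 A by (auto simp: e_def field_simps min_def)
  have small: "f \<delta> \<le> v" if "0 < \<delta>" "\<delta> \<le> e" for \<delta>
  proof -
    have "0 \<le> m n \<delta> * Q" using m_ge[OF n, of \<delta>] that Q by simp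
    then have "f \<delta> \<le> A * \<delta>" unfolding f_def using that L by (intro mult_right_mono) auto
    also have "\<dots> \<le> A * e" using that A by simp
    finally show ?thesis using e by (simp add: mult.commute)
  qed
  have "continuous_on {e..d} f"
    unfolding f_def
    by (intro continuous_intros continuous_at_imp_continuous_on ballI isCont_m n) (use e in auto)
  then obtain x where x: "x \<in> {e..d}" and xm: "\<And>y. y \<in> {e..d} \<Longrightarrow> f y \<le> f x"
    using continuous_attains_sup[of "{e..d}" f] e d0 by auto
  have "v \<le> f x" unfolding v_def using xm[of "d / 2"] e d0 by simp
  then have xd: "x \<noteq> d" using v fd by auto
  then have x0: "0 < x" "x < d" using x e by auto
  have "(GREATEST v. v \<in> f ` {0<..<d}) = f x"
  proof (rule Greatest_equality)
    show "f x \<in> f ` {0<..<d}" using x0 by auto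
    fix w assume "w \<in> f ` {0<..<d}"
    then obtain y where y: "0 < y" "y < d" "w = f y" by auto
    show "w \<le> f x"
    proof (cases "e \<le> y")
      case True then show ?thesis using xm y by auto
    next
      case False then show ?thesis using small[of y] y \<open>v \<le> f x\<close> by auto
    qed
  qed
  moreover have "L + m n x * Q < 1"
    using dm[OF x0] Q by (simp add: field_simps)
  ultimately show ?thesis using x0 unfolding f_def by blast
qed

section \<open>Bounded continuous functions\<close>

lemma BC_iff: "f \<in> BC \<longleftrightarrow> continuous_on UNIV f \<and> (\<exists>B. \<forall>t. cmod (f t) \<le> B)"
  by (auto simp: BC_def bounded_iff)

lemma BC_const: "(\<lambda>_. c) \<in> BC"
  by (auto simp: BC_iff)

lemma BC_add:
  assumes "f \<in> BC" "g \<in> BC"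
  shows "(\<lambda>t. f t + g t) \<in> BC"
proof -
  obtain A B where "\<And>t. cmod (f t) \<le> A" "\<And>t. cmod (g t) \<le> B"
    using assms unfolding BC_iff by blast
  then have "cmod (f t + g t) \<le> A + B" for t by (meson add_mono norm_triangle_le)
  then show ?thesis using assms by (auto simp: BC_iff intro: continuous_on_add)
qed

lemma BC_mult:
  assumes "f \<in> BC" "g \<in> BC"
  shows "(\<lambda>t. f t * g t) \<in> BC"
proof -
  obtain A B where A: "\<And>t. cmod (f t) \<le> A" and B: "\<And>t. cmod (g t) \<le> B"
    using assms unfolding BC_iff by blast
  have "0 \<le> A" using A norm_ge_zero order_trans by blast
  then have "cmod (f t * g t) \<le> A * B" for t
    unfolding norm_mult by (intro mult_mono A B) auto
  then show ?thesis using assms by (auto simp: BC_iff intro: continuous_on_mult)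
qed

lemma BC_minus: "f \<in> BC \<Longrightarrow> g \<in> BC \<Longrightarrow> (\<lambda>t. f t - g t) \<in> BC"
  using BC_add[OF _ BC_mult[OF BC_const[of "-1"]], of f g] by simp

lemma BC_sum: "(\<And>i. i \<in> I \<Longrightarrow> f i \<in> BC) \<Longrightarrow> (\<lambda>t. \<Sum>i\<in>I. f i t) \<in> BC"
proof (induction I rule: infinite_finite_induct)
  case (insert i I)
  then show ?case using BC_add[of "f i"] by simp
qed (simp_all add: BC_const)

lemma BC_measurable: "f \<in> BC \<Longrightarrow> f \<in> borel_measurable borel"
  by (simp add: BC_iff borel_measurable_continuous_onI)

lemma BC_uniform_limit:
  assumes f: "\<And>k. f k \<in> BC" and lim: "uniform_limit UNIV f g sequentially"
  shows "g \<in> BC"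
  unfolding BC_iff
proof
  show "continuous_on UNIV g"
    by (rule uniform_limit_theorem[OF _ lim]) (use f in \<open>auto simp: BC_iff\<close>)
  obtain k where k: "\<And>t. dist (f k t) (g t) < 1"
    using uniform_limitD[OF lim, of 1] by (auto simp: eventually_sequentially)
  obtain B where B: "\<And>t. cmod (f k t) \<le> B" using f unfolding BC_iff by blast
  have "cmod (g t) \<le> B + 1" for t
    using norm_triangle_sub[of "g t" "f k t"] k[of t] B[of t]
    by (simp add: dist_norm norm_minus_commute)
  then show "\<exists>B. \<forall>t. cmod (g t) \<le> B" by blast
qed

lemma BC_cmod: "f \<in> BC \<Longrightarrow> (\<lambda>t. of_real (cmod (f t))) \<in> BC"
  by (auto simp: BC_iff intro!: continuous_intros)

section \<open>Green operators\<close>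

lemma green_kernel_shift: "green_kernel \<omega> t s = green_kernel \<omega> 0 (s - t)"
  by (simp add: green_kernel_def)

lemma green_kernel_measurable [measurable]: "green_kernel \<omega> t \<in> borel_measurable borel"
  unfolding green_kernel_def[abs_def] by measurable

lemma cmod_green_kernel_Re: "cmod (green_kernel (of_real (Re \<omega>)) t s) = cmod (green_kernel \<omega> t s)"
  by (auto simp: green_kernel_def norm_mult sgn_if)

text \<open>Only the modulus of the kernel enters, and it depends on the real part alone. This links
  the estimates, which involve \<gamma>_j, with the constants, which are formed with
  \<alpha>_j.\<close>

lemma green_abs_Re: "green_abs (of_real (Re \<omega>)) f = green_abs \<omega> f"
  unfolding green_abs_def[abs_def] norm_mult cmod_green_kernel_Re ..

section \<open>Integrability and bounds for Green integrals\<close>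

lemma has_bochner_integral_exp_half_line:
  assumes "0 < (a::real)"
  shows "has_bochner_integral lborel (\<lambda>u. exp (- a * u) * indicator {0..} u) (1 / a)"
proof (rule has_bochner_integral_nn_integral)
  have "(\<integral>\<^sup>+ u. ennreal (exp (- a * u)) * indicator {0..} u \<partial>lborel) = 0 - (- exp (- a * 0) / a)"
  proof (rule nn_integral_FTC_atLeast)
    have "((\<lambda>u. exp (- a * u)) \<longlongrightarrow> 0) at_top"
      using assms by (intro filterlim_compose[OF exp_at_bot] filterlim_tendsto_neg_mult_at_bot[OF tendsto_const])
        (auto intro: filterlim_ident)
    from tendsto_mult_left[OF this, of "- 1 / a"]
    show "((\<lambda>u. - exp (- a * u) / a) \<longlongrightarrow> 0) at_top"
      by simp
  qed (use assms in \<open>auto intro!: derivative_eq_intros\<close>)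
  then show "(\<integral>\<^sup>+ u. ennreal (exp (- a * u) * indicator {0..} u) \<partial>lborel) = ennreal (1 / a)"
    by (simp add: ennreal_mult'' ennreal_indicator)
qed (use assms in auto)

text \<open>The reflection of u by the sign of \<open>Re \<omega>\<close> reduces both signs to the
  same decaying exponential on a half-line.\<close>

lemma has_bochner_integral_green_kernel_0:
  assumes "Re \<omega> \<noteq> 0"
  shows "has_bochner_integral lborel (\<lambda>u. cmod (green_kernel \<omega> 0 u)) (1 / \<bar>Re \<omega>\<bar>)"
proof -
  let ?f = "\<lambda>u. exp (- \<bar>Re \<omega>\<bar> * u) * indicator {0..} u"
  have 1: "has_bochner_integral lborel (\<lambda>u. ?f (0 + sgn (Re \<omega>) * u)) (1 / \<bar>Re \<omega>\<bar>)"
    using assms has_bochner_integral_exp_half_line[of "\<bar>Re \<omega>\<bar>"]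
      lborel_has_bochner_integral_real_affine_iff[of "sgn (Re \<omega>)" ?f "1 / \<bar>Re \<omega>\<bar>" 0]
    by (auto simp: sgn_if split: if_splits)
  \<comment> \<open>At u = 0 the kernel is 0 while the exponential is 1, so equality holds only
    almost everywhere.\<close>
  have "AE u in lborel. ?f (0 + sgn (Re \<omega>) * u) = cmod (green_kernel \<omega> 0 u)"
    using AE_lborel_singleton[of 0]
    by eventually_elim (use assms in \<open>auto simp: green_kernel_def norm_mult sgn_if indicator_def\<close>)
  moreover have "(\<lambda>u. cmod (green_kernel \<omega> 0 u)) \<in> borel_measurable lborel" by measurable
  moreover have "(\<lambda>u. ?f (0 + sgn (Re \<omega>) * u)) \<in> borel_measurable lborel" by measurable
  ultimately have "has_bochner_integral lborel (\<lambda>u. ?f (0 + sgn (Re \<omega>) * u)) (1 / \<bar>Re \<omega>\<bar>) \<longleftrightarrow>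
      has_bochner_integral lborel (\<lambda>u. cmod (green_kernel \<omega> 0 u)) (1 / \<bar>Re \<omega>\<bar>)"
    by (intro has_bochner_integral_cong_AE)
  then show ?thesis using 1 by blast
qed

lemma has_bochner_integral_green_kernel:
  assumes "Re \<omega> \<noteq> 0"
  shows "has_bochner_integral lborel (\<lambda>s. cmod (green_kernel \<omega> t s)) (1 / \<bar>Re \<omega>\<bar>)"
  using lborel_has_bochner_integral_real_affine_iff
    [of 1 "\<lambda>s. cmod (green_kernel \<omega> t s)" "1 / \<bar>Re \<omega>\<bar>" t]
    has_bochner_integral_green_kernel_0[OF assms]
  by (simp add: green_kernel_shift[of \<omega> t])

lemma integrable_green:
  assumes "Re \<omega> \<noteq> 0" "f \<in> BC"
  shows "integrable lborel (\<lambda>s. green_kernel \<omega> t s * f s)"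
proof -
  obtain B where B: "\<And>s. cmod (f s) \<le> B" using assms(2) unfolding BC_iff by blast
  show ?thesis
  proof (rule Bochner_Integration.integrable_bound)
  show "integrable lborel (\<lambda>s. cmod (green_kernel \<omega> t s) * B)"
    using has_bochner_integral_green_kernel[OF assms(1)]
    by (auto simp: has_bochner_integral_iff)
  show "AE s in lborel. norm (green_kernel \<omega> t s * f s) \<le> norm (cmod (green_kernel \<omega> t s) * B)"
    using B order_trans[OF norm_ge_zero B]
    by (auto simp: norm_mult abs_mult intro!: mult_left_mono order_trans[OF _ abs_ge_self])
  qed (use BC_measurable[OF assms(2)] in measurable)
qed

lemma green1_shift: "green1 \<omega> f (t + c) = green1 \<omega> (\<lambda>s. f (s + c)) t"
proof -
  have "green_kernel \<omega> (t + c) (c + 1 * s) = green_kernel \<omega> t s" for s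
    by (simp add: green_kernel_def)
  then show ?thesis
    unfolding green1_def by (subst lborel_integral_real_affine[of 1 _ c]) (simp_all add: add.commute)
qed

lemma green1_convolution: "green1 \<omega> f t = (LBINT u. green_kernel \<omega> 0 u * f (t + u))"
  using green1_shift[of \<omega> f 0 t] by (simp add: green1_def add.commute)

lemma has_bochner_integral_green_abs:
  assumes "Re \<omega> \<noteq> 0" "f \<in> BC"
  shows "has_bochner_integral lborel (\<lambda>s. cmod (green_kernel \<omega> t s) * cmod (f s)) (green_abs \<omega> f t)"
  using integrable_norm[OF integrable_green[OF assms]]
  by (simp add: has_bochner_integral_iff green_abs_def norm_mult)

text \<open>The majorant \<open>b\<close> may vary with s. This is essential: \<open>L0\<close> and
  \<open>Q0\<close> contain Green integrals of the coefficients, which a supremum bound on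
  \<open>f\<close> would only overestimate.\<close>

lemma cmod_green1_le_bochner:
  assumes f: "Re \<omega> \<noteq> 0" "f \<in> BC"
    and b: "has_bochner_integral lborel (\<lambda>s. cmod (green_kernel \<omega> t s) * b s) B" "\<And>s. cmod (f s) \<le> b s"
  shows "cmod (green1 \<omega> f t) \<le> B"
proof -
  have "cmod (green1 \<omega> f t) \<le> (LBINT s. cmod (green_kernel \<omega> t s) * b s)"
    unfolding green1_def
    by (rule Bochner_Integration.integral_norm_bound_integral[OF integrable_green[OF f]])
      (use b in \<open>auto simp: has_bochner_integral_iff norm_mult intro!: mult_left_mono\<close>)
  then show ?thesis using b(1) by (simp add: has_bochner_integral_iff)
qed

lemma cmod_green1_le:
  assumes "Re \<omega> \<noteq> 0" "f \<in> BC" "\<And>s. cmod (f s) \<le> B"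
  shows "cmod (green1 \<omega> f t) \<le> B / \<bar>Re \<omega>\<bar>"
  using cmod_green1_le_bochner[OF assms(1,2)
      has_bochner_integral_mult_left[OF has_bochner_integral_green_kernel[OF assms(1)]] assms(3)]
  by simp

lemma green_abs_nonneg: "0 \<le> green_abs \<omega> f t"
  unfolding green_abs_def by (rule integral_nonneg_AE) simp

lemma green_abs_le_supnorm:
  assumes "Re \<omega> \<noteq> 0" "f \<in> BC"
  shows "green_abs \<omega> f t \<le> supnorm (green_abs (of_real (Re \<omega>)) f)"
proof -
  obtain B where B: "\<And>s. cmod (f s) \<le> B" using assms(2) unfolding BC_iff by blast
  have hb: "has_bochner_integral lborel (\<lambda>s. cmod (green_kernel \<omega> t s) * B) (1 / \<bar>Re \<omega>\<bar> * B)" for t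
    by (intro has_bochner_integral_mult_left has_bochner_integral_green_kernel assms)
  have "green_abs \<omega> f t \<le> (LBINT s. cmod (green_kernel \<omega> t s) * B)" for t
    unfolding green_abs_def norm_mult
    using hb[of t] has_bochner_integral_green_abs[OF assms, of t] B
    by (intro integral_mono mult_left_mono) (auto simp: has_bochner_integral_iff)
  then have "green_abs \<omega> f t \<le> 1 / \<bar>Re \<omega>\<bar> * B" for t
    unfolding has_bochner_integral_integral_eq[OF hb] .
  then have "norm (green_abs \<omega> f t) \<le> (SUP t. norm (green_abs \<omega> f t))"
    using green_abs_nonneg[of \<omega> f]
    by (intro cSUP_upper bdd_aboveI2[of _ _ "1 / \<bar>Re \<omega>\<bar> * B"]) auto
  then show ?thesis by (simp add: supnorm_def green_abs_Re)
qed

text \<open>The kernels at \<open>t = \<plusminus>k\<close> recover \<open>h\<close> on larger and larger half-lines.\<close>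

lemma green_integrable_imp_measurable:
  assumes \<omega>: "Re \<omega> \<noteq> 0" and h: "\<And>t. integrable lborel (\<lambda>s. green_kernel \<omega> t s * h s)"
  shows "h \<in> borel_measurable borel"
proof -
  define T where "T k = - sgn (Re \<omega>) * real k" for k
  define F where "F k s = - of_real (sgn (Re \<omega>)) * exp (- \<omega> * of_real (T k - s)) *
    (green_kernel \<omega> (T k) s * h s)" for k s
  have [measurable]: "(\<lambda>s. green_kernel \<omega> t s * h s) \<in> borel_measurable borel" for t
    using borel_measurable_integrable[OF h[of t]] by simp
  show ?thesis
  proof (rule borel_measurable_LIMSEQ_metric)
    show "F k \<in> borel_measurable borel" for k unfolding F_def[abs_def] by measurable
  next
    fix s
    obtain N :: nat where N: "\<bar>s\<bar> < real N" using reals_Archimedean2 by blast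
    have "F k s = h s" if "N \<le> k" for k
    proof -
      have "sgn (Re \<omega>) * (T k - s) < 0"
        using that N \<omega> by (auto simp: T_def sgn_if)
      then show ?thesis
        using \<omega> by (cases "0 < Re \<omega>") (simp_all add: F_def green_kernel_def exp_minus)
    qed
    then show "(\<lambda>k. F k s) \<longlonglongrightarrow> h s"
      by (intro tendsto_eventually) (auto simp: eventually_sequentially)
  qed
qed

text \<open>Variation of constants for u' = \<omega> u + h. The kernels at t and, after
  multiplication by exp (\<omega> (t - a)), at a cancel outside \<open>{a..t}\<close>, whichever
  half-line they live on. No continuity of \<open>h\<close> enters, so the formula is available in
  the converse part.\<close>

lemma green1_local:
  fixes h :: "real \<Rightarrow> complex"
  assumes \<omega>: "Re \<omega> \<noteq> 0" and h: "\<And>t. integrable lborel (\<lambda>s. green_kernel \<omega> t s * h s)"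
    and at: "a \<le> t"
  shows "set_integrable lborel {a..t} (\<lambda>s. exp (- \<omega> * of_real s) * h s)"
    and "green1 \<omega> h t = exp (\<omega> * of_real t) *
      (exp (- \<omega> * of_real a) * green1 \<omega> h a + integral {a..t} (\<lambda>s. exp (- \<omega> * of_real s) * h s))"
proof -
  have [measurable]: "h \<in> borel_measurable borel" by (rule green_integrable_imp_measurable[OF \<omega> h])
  let ?e = "exp (\<omega> * of_real (t - a))"
  let ?d = "\<lambda>s. green_kernel \<omega> t s * h s - ?e * (green_kernel \<omega> a s * h s)"
  let ?k = "\<lambda>s. exp (- \<omega> * of_real s) * h s"
  have int: "integrable lborel ?d" using h by auto
  \<comment> \<open>At an end point the strict inequality in the kernel and the closed interval
    disagree.\<close>
  have "AE s in lborel. ?d s = indicator {a..t} s *\<^sub>R (exp (\<omega> * of_real t) * ?k s)"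
    using AE_lborel_singleton[of a] AE_lborel_singleton[of t]
  proof eventually_elim
    case (elim s)
    have "exp (\<omega> * of_real (t - a)) * exp (\<omega> * of_real (a - s)) = exp (\<omega> * of_real (t - s))"
      "exp (\<omega> * of_real t) * exp (- \<omega> * of_real s) = exp (\<omega> * of_real (t - s))"
      by (simp_all add: exp_add[symmetric] algebra_simps)
    then show ?case
      using elim at \<omega> by (cases "Re \<omega> > 0")
        (auto simp: green_kernel_def indicator_def mult.assoc[symmetric])
  qed
  moreover have "(\<lambda>s. indicator {a..t} s *\<^sub>R (exp (\<omega> * of_real t) * ?k s)) \<in> borel_measurable lborel"
    by measurable
  moreover have "?d \<in> borel_measurable lborel" by measurable
  ultimately have i1: "integrable lborel (\<lambda>s. indicator {a..t} s *\<^sub>R (exp (\<omega> * of_real t) * ?k s))"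
    and e1: "(LBINT s. ?d s) = (LBINT s. indicator {a..t} s *\<^sub>R (exp (\<omega> * of_real t) * ?k s))"
    using int integrable_cong_AE[of ?d lborel "\<lambda>s. indicator {a..t} s *\<^sub>R (exp (\<omega> * of_real t) * ?k s)"]
      integral_cong_AE[of ?d lborel "\<lambda>s. indicator {a..t} s *\<^sub>R (exp (\<omega> * of_real t) * ?k s)"]
    by blast+
  have "set_integrable lborel {a..t} (\<lambda>s. exp (- \<omega> * of_real t) * (exp (\<omega> * of_real t) * ?k s))"
    by (rule set_integrable_mult_right) (use i1 in \<open>simp add: set_integrable_def\<close>)
  moreover have "exp (- \<omega> * of_real t) * (exp (\<omega> * of_real t) * ?k s) = ?k s" for s
    by (simp add: exp_minus)
  ultimately show si: "set_integrable lborel {a..t} ?k" by simp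
  have "(LBINT s. ?d s) = green1 \<omega> h t - ?e * green1 \<omega> h a"
    unfolding green1_def using h by simp
  then have "green1 \<omega> h t - ?e * green1 \<omega> h a = (LBINT s:{a..t}. exp (\<omega> * of_real t) * ?k s)"
    unfolding e1 set_lebesgue_integral_def by (rule sym)
  also have "\<dots> = exp (\<omega> * of_real t) * (LBINT s:{a..t}. ?k s)"
    by (rule set_integral_mult_right)
  also have "(LBINT s:{a..t}. ?k s) = integral {a..t} ?k"
    by (rule set_borel_integral_eq_integral(2)[OF si])
  finally show "green1 \<omega> h t = exp (\<omega> * of_real t) *
      (exp (- \<omega> * of_real a) * green1 \<omega> h a + integral {a..t} ?k)"
    by (simp add: algebra_simps exp_diff exp_minus field_simps)
qed

lemma green1_has_vector_derivative:
  assumes \<omega>: "Re \<omega> \<noteq> 0" and h: "\<And>t. integrable lborel (\<lambda>s. green_kernel \<omega> t s * h s)"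
    and cont: "continuous_on UNIV h"
  shows "(green1 \<omega> h has_vector_derivative \<omega> * green1 \<omega> h t + h t) (at t)"
proof -
  define K where "K x = integral {t - 1..x} (\<lambda>s. exp (- \<omega> * of_real s) * h s)" for x
  define C where "C = exp (- \<omega> * of_real (t - 1)) * green1 \<omega> h (t - 1)"
  have eq: "green1 \<omega> h x = exp (\<omega> * of_real x) * (C + K x)" if "t - 1 \<le> x" for x
    unfolding K_def C_def by (rule green1_local(2)[OF \<omega> h that])
  have "(K has_vector_derivative exp (- \<omega> * of_real t) * h t) (at t within {t - 1..t + 1})"
    unfolding K_def[abs_def]
    by (rule integral_has_vector_derivative)
      (auto intro!: continuous_intros continuous_on_subset[OF cont])
  then have K: "(K has_vector_derivative exp (- \<omega> * of_real t) * h t) (at t)"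
    by (simp add: at_within_Icc_at)
  have "((\<lambda>x. exp (\<omega> * of_real x) * (C + K x)) has_vector_derivative
      \<omega> * (exp (\<omega> * of_real t) * (C + K t)) + h t) (at t)"
    by (rule derivative_eq_intros exp_scaleR_has_vector_derivative_right K
        has_vector_derivative_real_field | rule refl)+
      (simp add: exp_minus field_simps)
  then show ?thesis
    unfolding eq[of t, simplified, symmetric]
    by (rule has_vector_derivative_transform_within_open[where S="{t - 1<..}"]) (auto simp: eq)
qed

section \<open>Differentiating combinations of Green integrals without continuity\<close>

lemma norm_exp_minus_one_le: "cmod (exp z - 1) \<le> cmod z * exp (cmod z)"
proof -
  have "cmod (exp z - exp 0) \<le> exp (cmod z) * cmod (z - 0)"
  proof (rule field_differentiable_bound[where S="cball 0 (cmod z)" and f'=exp])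
    fix w :: complex assume "w \<in> cball 0 (cmod z)"
    then show "cmod (exp w) \<le> exp (cmod z)"
      using norm_exp[of w] by (auto intro: order_trans)
  qed (auto intro!: derivative_eq_intros)
  then show ?thesis by (simp add: mult.commute)
qed

text \<open>Because the weights sum to 0, each exponential may be replaced by its difference from 1,
  which is O(x). This is the quantitative form of the cancellation of the kernel jumps.\<close>

lemma exp_sum_le_linear:
  fixes c \<gamma> :: "'i \<Rightarrow> complex"
  assumes "(\<Sum>j\<in>J. c j) = 0"
  shows "\<exists>C\<ge>0. \<forall>x. \<bar>x\<bar> \<le> 1 \<longrightarrow> cmod (\<Sum>j\<in>J. c j * exp (\<gamma> j * of_real x)) \<le> C * \<bar>x\<bar>"
proof (intro exI[of _ "\<Sum>j\<in>J. cmod (c j) * (cmod (\<gamma> j) * exp (cmod (\<gamma> j)))"] conjI allI impI)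
  fix x :: real assume x: "\<bar>x\<bar> \<le> 1"
  have "(\<Sum>j\<in>J. c j * exp (\<gamma> j * of_real x)) = (\<Sum>j\<in>J. c j * (exp (\<gamma> j * of_real x) - 1))"
    using assms by (simp add: algebra_simps sum_subtractf)
  also have "cmod \<dots> \<le> (\<Sum>j\<in>J. cmod (c j) * (cmod (\<gamma> j) * exp (cmod (\<gamma> j))) * \<bar>x\<bar>)"
  proof (intro order_trans[OF norm_sum] sum_mono)
    fix j
    have "cmod (exp (\<gamma> j * of_real x) - 1) \<le> cmod (\<gamma> j) * \<bar>x\<bar> * exp (cmod (\<gamma> j) * \<bar>x\<bar>)"
      using norm_exp_minus_one_le[of "\<gamma> j * of_real x"] by (simp add: norm_mult)
    also have "\<dots> \<le> cmod (\<gamma> j) * \<bar>x\<bar> * exp (cmod (\<gamma> j))"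
      using x by (intro mult_left_mono) (auto intro: mult_left_le)
    finally show "cmod (c j * (exp (\<gamma> j * of_real x) - 1)) \<le>
        cmod (c j) * (cmod (\<gamma> j) * exp (cmod (\<gamma> j))) * \<bar>x\<bar>"
      unfolding norm_mult[of "c j"] mult.assoc
      by (intro mult_left_mono) (simp_all add: mult_ac)
  qed
  finally show "cmod (\<Sum>j\<in>J. c j * exp (\<gamma> j * of_real x)) \<le>
      (\<Sum>j\<in>J. cmod (c j) * (cmod (\<gamma> j) * exp (cmod (\<gamma> j)))) * \<bar>x\<bar>"
    by (simp add: sum_distrib_right)
qed (intro sum_nonneg mult_nonneg_nonneg; simp)

lemma has_vector_derivative_zero_of_bound:
  fixes R :: "real \<Rightarrow> 'a::real_normed_vector"
  assumes R0: "R t = 0" and bound: "eventually (\<lambda>x. norm (R x) \<le> g x * \<bar>x - t\<bar>) (at t)"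
    and g: "(g \<longlongrightarrow> 0) (at t)"
  shows "(R has_vector_derivative 0) (at t)"
  unfolding has_vector_derivative_def has_derivative_iff_norm
proof (intro conjI)
  have "eventually (\<lambda>x. norm (norm (R x - R t - (x - t) *\<^sub>R 0) / norm (x - t)) \<le> g x) (at t)"
    using bound eventually_neq_at_within[of t t]
    by eventually_elim (simp add: R0 field_simps)
  then show "((\<lambda>x. norm (R x - R t - (x - t) *\<^sub>R 0) / norm (x - t)) \<longlongrightarrow> 0) (at t)"
    by (rule Lim_null_comparison) (rule g)
qed simp

text \<open>Although \<open>h\<close> need not be continuous, the combination is differentiable: when the weights
  sum to 0, the jumps of the kernels on the diagonal cancel.\<close>

lemma green_combination_has_vector_derivative:
  fixes c \<gamma> :: "'i \<Rightarrow> complex"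
  assumes \<gamma>: "\<And>j. j \<in> J \<Longrightarrow> Re (\<gamma> j) \<noteq> 0"
    and h: "\<And>j t. j \<in> J \<Longrightarrow> integrable lborel (\<lambda>s. green_kernel (\<gamma> j) t s * h s)"
    and c: "(\<Sum>j\<in>J. c j) = 0" and J: "J \<noteq> {}" "finite J"
  shows "((\<lambda>t. \<Sum>j\<in>J. c j * green1 (\<gamma> j) h t) has_vector_derivative
    (\<Sum>j\<in>J. c j * \<gamma> j * green1 (\<gamma> j) h t)) (at t)"
proof -
  obtain j0 where j0: "j0 \<in> J" using J by blast
  have hm [measurable]: "h \<in> borel_measurable borel"
    by (rule green_integrable_imp_measurable[OF \<gamma>[OF j0] h[OF j0]])
  define a where "a = t - 1"
  define k where "k j s = exp (- \<gamma> j * of_real s) * h s" for j s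
  define K where "K j x = integral {a..x} (k j)" for j x
  define C where "C j = exp (- \<gamma> j * of_real a) * green1 (\<gamma> j) h a" for j
  have eq: "green1 (\<gamma> j) h x = exp (\<gamma> j * of_real x) * (C j + K j x)" if "a \<le> x" "j \<in> J" for x j
    unfolding K_def k_def C_def by (rule green1_local(2)[OF \<gamma> h]) (use that in auto)
  have ki: "k j integrable_on {x..y}" if "j \<in> J" for x y j
  proof (cases "x \<le> y")
    case True
    show ?thesis unfolding k_def
      by (rule set_borel_integral_eq_integral(1)[OF green1_local(1)[OF \<gamma> h True]]) (use that in auto)
  qed (auto simp: integrable_on_empty)
  \<comment> \<open>On a compact interval the exponential factor in \<open>k j0\<close> is bounded
    away from 0, so local integrability passes from \<open>k j0\<close> to \<open>h\<close>.\<close>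
  have hi: "set_integrable lborel {x..y} h" if "x \<le> y" for x y
  proof -
    let ?M = "exp (cmod (\<gamma> j0) * (\<bar>x\<bar> + \<bar>y\<bar>))"
    have "set_integrable lborel {x..y} (\<lambda>s. of_real ?M * k j0 s)"
      using green1_local(1)[OF \<gamma>[OF j0] h[OF j0] that] unfolding k_def
      by (rule set_integrable_mult_right)
    then show ?thesis
      unfolding set_integrable_def
    proof (rule Bochner_Integration.integrable_bound)
      have "cmod (h s) \<le> ?M * cmod (k j0 s)" if "s \<in> {x..y}" for s
      proof -
        have "h s = exp (\<gamma> j0 * of_real s) * k j0 s" by (simp add: k_def exp_minus)
        moreover have "cmod (exp (\<gamma> j0 * of_real s)) \<le> ?M"
        proof (rule order_trans[OF norm_exp])
          show "exp (cmod (\<gamma> j0 * of_real s)) \<le> ?M"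
            using that by (auto simp: norm_mult intro!: mult_left_mono)
        qed
        ultimately show ?thesis by (metis mult_right_mono norm_ge_zero norm_mult)
      qed
      then show "AE s in lborel. norm (indicat_real {x..y} s *\<^sub>R h s)
          \<le> norm (indicat_real {x..y} s *\<^sub>R (of_real ?M * k j0 s))"
        by (auto simp: norm_mult indicator_def)
    qed measurable
  qed
  have ni: "(\<lambda>s. cmod (h s)) integrable_on {x..y}" for x y
  proof (cases "x \<le> y")
    case True
    show ?thesis
      by (rule set_borel_integral_eq_integral(1)[OF set_integrable_norm[OF hi[OF True]]])
  qed (auto simp: integrable_on_empty)
  \<comment> \<open>\<open>h\<close> may be unbounded near t, so \<open>R\<close> below is estimated
    by \<open>D * \<bar>x - t\<bar>\<close> times an increment of \<open>H\<close>. Continuity of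
    \<open>H\<close> makes this o(x - t).\<close>
  define H where "H x = integral {a..x} (\<lambda>s. cmod (h s))" for x
  have "continuous_on {a..t + 1} H"
    unfolding H_def[abs_def] by (rule indefinite_integral_continuous_1[OF ni])
  then have "isCont H t"
    by (rule continuous_on_interior) (simp add: a_def)
  then have H0: "((\<lambda>x. H x - H t) \<longlongrightarrow> 0) (at t)"
    by (simp add: isCont_def LIM_zero_iff)
  obtain D where D: "D \<ge> 0" and
    DL: "\<And>x. \<bar>x\<bar> \<le> 1 \<Longrightarrow> cmod (\<Sum>j\<in>J. c j * exp (\<gamma> j * of_real x)) \<le> D * \<bar>x\<bar>"
    using exp_sum_le_linear[OF c, of \<gamma>] by blast
  \<comment> \<open>\<open>R\<close> collects the contribution of \<open>h\<close> between t and x;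
    what remains of the combination is a sum of exponentials with constant coefficients.\<close>
  define R where "R x = (\<Sum>j\<in>J. c j * exp (\<gamma> j * of_real x) * (K j x - K j t))" for x
  have piece: "cmod (\<Sum>j\<in>J. c j * exp (\<gamma> j * of_real z) * integral {x..y} (k j))
      \<le> D * \<bar>x - y\<bar> * integral {x..y} (\<lambda>s. cmod (h s))"
    if z: "z \<in> {x..y}" "\<bar>x - y\<bar> \<le> 1" for x y z
  proof -
    have "(\<Sum>j\<in>J. c j * exp (\<gamma> j * of_real z) * integral {x..y} (k j)) =
        integral {x..y} (\<lambda>s. \<Sum>j\<in>J. c j * exp (\<gamma> j * of_real z) * k j s)"
      using ki J by (subst integral_sum)
        (auto intro!: sum.cong integrable_on_mult_right)
    also have "cmod \<dots> \<le> integral {x..y} (\<lambda>s. D * \<bar>x - y\<bar> * cmod (h s))"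
    proof (rule integral_norm_bound_integral)
      fix s assume s: "s \<in> {x..y}"
      have "(\<Sum>j\<in>J. c j * exp (\<gamma> j * of_real z) * k j s) =
          (\<Sum>j\<in>J. c j * exp (\<gamma> j * of_real (z - s))) * h s"
        unfolding k_def sum_distrib_right
        by (intro sum.cong refl) (simp add: algebra_simps exp_diff exp_minus divide_inverse)
      moreover have "cmod (\<Sum>j\<in>J. c j * exp (\<gamma> j * of_real (z - s))) \<le> D * \<bar>x - y\<bar>"
        using z s D by (intro order_trans[OF DL] mult_left_mono) auto
      ultimately show "cmod (\<Sum>j\<in>J. c j * exp (\<gamma> j * of_real z) * k j s) \<le> D * \<bar>x - y\<bar> * cmod (h s)"
        by (simp add: norm_mult mult_right_mono)
    qed (use J in \<open>auto intro!: integrable_sum integrable_on_mult_right ki ni\<close>)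
    finally show ?thesis by simp
  qed
  have split: "integral {a..x} f - integral {a..t} f =
      (if t \<le> x then integral {t..x} f else - integral {x..t} f)"
    if "\<And>x y. f integrable_on {x..y}" "a \<le> x" for f :: "real \<Rightarrow> 'b::banach" and x
    using Henstock_Kurzweil_Integration.integral_combine[of a t x f]
      Henstock_Kurzweil_Integration.integral_combine[of a x t f] that
    by (auto simp: a_def algebra_simps)
  have Rb: "cmod (R x) \<le> D * \<bar>H x - H t\<bar> * \<bar>x - t\<bar>" if x: "\<bar>x - t\<bar> < 1" for x
  proof -
    let ?I = "{min t x..max t x}"
    have ax: "a \<le> x" using x by (simp add: a_def)
    have "cmod (R x) = cmod (\<Sum>j\<in>J. c j * exp (\<gamma> j * of_real x) * integral ?I (k j))"
      using split[OF ki ax] by (cases "t \<le> x") (simp_all add: R_def K_def sum_negf)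
    also have "\<dots> \<le> D * \<bar>x - t\<bar> * integral ?I (\<lambda>s. cmod (h s))"
      using piece[of x "min t x" "max t x"] x by (cases "t \<le> x") (simp_all add: abs_minus_commute)
    also have "integral ?I (\<lambda>s. cmod (h s)) = \<bar>H x - H t\<bar>"
      using split[OF ni ax] by (cases "t \<le> x") (simp_all add: H_def integral_nonneg[OF ni])
    finally show ?thesis by (simp add: mult_ac)
  qed
  have "(R has_vector_derivative 0) (at t)"
  proof (rule has_vector_derivative_zero_of_bound)
    show "R t = 0" by (simp add: R_def)
    show "eventually (\<lambda>x. norm (R x) \<le> (D * \<bar>H x - H t\<bar>) * \<bar>x - t\<bar>) (at t)"
      unfolding eventually_at using Rb by (intro exI[of _ 1]) (auto simp: dist_real_def)
    show "((\<lambda>x. D * \<bar>H x - H t\<bar>) \<longlongrightarrow> 0) (at t)"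
      using tendsto_mult_right_zero[OF tendsto_rabs_zero[OF H0]] .
  qed
  moreover have "((\<lambda>x. \<Sum>j\<in>J. c j * exp (\<gamma> j * of_real x) * (C j + K j t)) has_vector_derivative
      (\<Sum>j\<in>J. c j * (\<gamma> j * exp (\<gamma> j * of_real t)) * (C j + K j t))) (at t)"
    by (rule derivative_eq_intros has_vector_derivative_real_field | rule refl | simp add: mult_ac)+
  ultimately have "((\<lambda>x. R x + (\<Sum>j\<in>J. c j * exp (\<gamma> j * of_real x) * (C j + K j t))) has_vector_derivative
      0 + (\<Sum>j\<in>J. c j * (\<gamma> j * exp (\<gamma> j * of_real t)) * (C j + K j t))) (at t)"
    by (rule has_vector_derivative_add)
  moreover have "0 + (\<Sum>j\<in>J. c j * (\<gamma> j * exp (\<gamma> j * of_real t)) * (C j + K j t)) =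
      (\<Sum>j\<in>J. c j * \<gamma> j * green1 (\<gamma> j) h t)"
    by (auto simp: eq a_def mult_ac intro!: sum.cong)
  moreover have "R x + (\<Sum>j\<in>J. c j * exp (\<gamma> j * of_real x) * (C j + K j t)) =
      (\<Sum>j\<in>J. c j * green1 (\<gamma> j) h x)" if "x \<in> {a<..}" for x
    using that by (auto simp: eq R_def sum.distrib[symmetric] algebra_simps intro!: sum.cong)
  ultimately show ?thesis
    by (auto intro: has_vector_derivative_transform_within_open[where S="{a<..}"] simp: a_def)
qed

lemma continuous_green1:
  assumes \<omega>: "Re \<omega> \<noteq> 0" and h: "\<And>t. integrable lborel (\<lambda>s. green_kernel \<omega> t s * h s)"
  shows "continuous_on UNIV (green1 \<omega> h)"
proof (rule continuous_at_imp_continuous_on, rule ballI)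
  fix t :: real
  let ?k = "\<lambda>s. exp (- \<omega> * of_real s) * h s"
  let ?g = "\<lambda>x. exp (\<omega> * of_real x) *
      (exp (- \<omega> * of_real (t - 1)) * green1 \<omega> h (t - 1) + integral {t - 1..x} ?k)"
  have "?k integrable_on {t - 1..t + 1}"
    by (rule set_borel_integral_eq_integral(1)[OF green1_local(1)[OF \<omega> h]]) simp
  then have "continuous_on {t - 1..t + 1} ?g"
    by (intro continuous_intros indefinite_integral_continuous_1)
  then have "continuous_on {t - 1..t + 1} (green1 \<omega> h)"
    by (subst continuous_on_cong[OF refl green1_local(2)[OF \<omega> h]]) auto
  then show "isCont (green1 \<omega> h) t"
    by (rule continuous_on_interior) simp
qed

section \<open>Almost periodic and vanishing functions\<close>

lemma AP_iff_Cauchy: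
  "f \<in> AP \<longleftrightarrow> continuous_on UNIV f \<and>
    (\<forall>b :: nat \<Rightarrow> real. \<exists>\<rho>. strict_mono \<rho> \<and> uniformly_Cauchy_on UNIV (\<lambda>k t. f (t + b (\<rho> k))))"

  unfolding AP_def mem_Collect_eq uniformly_convergent_on_def[symmetric] uniformly_convergent_eq_Cauchy ..

lemma uniformly_Cauchy_UNIV_obtain:
  assumes "uniformly_Cauchy_on UNIV f" "0 < e"
  obtains M where "\<And>t k l. k \<ge> M \<Longrightarrow> l \<ge> M \<Longrightarrow> dist (f k t) (f l t) < e"
  using assms unfolding uniformly_Cauchy_on_def by blast

lemma AP_continuous: "f \<in> AP \<Longrightarrow> continuous_on UNIV f"
  by (simp add: AP_def)

lemma AP_bounded:
  assumes "f \<in> AP"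
  shows "\<exists>B. \<forall>t. cmod (f t) \<le> B"
proof (rule ccontr)
  assume "\<not> ?thesis"
  then have "\<forall>k::nat. \<exists>t. real k < cmod (f t)" by (meson not_le)
  then obtain b where b: "\<And>k::nat. real k < cmod (f (b k))" by metis
  obtain \<rho> g where \<rho>: "strict_mono \<rho>" and "uniform_limit UNIV (\<lambda>k t. f (t + b (\<rho> k))) g sequentially"
    using assms unfolding AP_def by blast
  then have "(\<lambda>k. f (0 + b (\<rho> k))) \<longlonglongrightarrow> g 0"
    by (intro tendsto_uniform_limitI) auto
  then have "Bseq (\<lambda>k. f (b (\<rho> k)))" by (auto intro: convergent_imp_Bseq convergentI)
  then obtain K where K: "\<And>k. cmod (f (b (\<rho> k))) \<le> K" by (auto simp: Bseq_def)
  obtain k :: nat where "K < real k" using reals_Archimedean2 by blast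
  also have "real k \<le> real (\<rho> k)" using seq_suble[OF \<rho>, of k] by simp
  finally show False using b[of "\<rho> k"] K[of k] by simp
qed

text \<open>Two successive extractions give a subsequence along which the translates of
  \<open>f1\<close> and \<open>f2\<close> are both uniformly Cauchy; the modulus of dependence
  transfers this to \<open>g\<close>. Sums, products and Green integrals are all instances.\<close>

lemma AP_I2:
  assumes f: "f1 \<in> AP" "f2 \<in> AP" and g: "continuous_on UNIV g"
    and imp: "\<And>e. 0 < e \<Longrightarrow> \<exists>d>0. \<forall>c c'. (\<forall>t. dist (f1 (t + c)) (f1 (t + c')) < d \<and>
       dist (f2 (t + c)) (f2 (t + c')) < d) \<longrightarrow> (\<forall>t. dist (g (t + c)) (g (t + c')) < e)"
  shows "g \<in> AP"
  unfolding AP_iff_Cauchy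
proof (intro conjI allI g)
  fix b :: "nat \<Rightarrow> real"
  obtain \<rho> where \<rho>: "strict_mono \<rho>" and c1: "uniformly_Cauchy_on UNIV (\<lambda>k t. f1 (t + b (\<rho> k)))"
    using f(1) unfolding AP_iff_Cauchy by blast
  obtain \<sigma> where \<sigma>: "strict_mono \<sigma>" and c2: "uniformly_Cauchy_on UNIV (\<lambda>k t. f2 (t + (b \<circ> \<rho>) (\<sigma> k)))"
    using f(2) unfolding AP_iff_Cauchy by blast
  have "uniformly_Cauchy_on UNIV (\<lambda>k t. g (t + b (\<rho> (\<sigma> k))))"
  proof (rule uniformly_Cauchy_onI)
    fix e :: real assume "0 < e"
    from imp[OF this] obtain d where d: "0 < d" and
      imp': "\<forall>c c'. (\<forall>t. dist (f1 (t + c)) (f1 (t + c')) < d \<and>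
        dist (f2 (t + c)) (f2 (t + c')) < d) \<longrightarrow> (\<forall>t. dist (g (t + c)) (g (t + c')) < e)"
      by (elim exE conjE)
    obtain M1 where M1: "\<And>t k l. k \<ge> M1 \<Longrightarrow> l \<ge> M1 \<Longrightarrow> dist (f1 (t + b (\<rho> k))) (f1 (t + b (\<rho> l))) < d"
      using uniformly_Cauchy_UNIV_obtain[OF c1 d] by blast
    obtain M2 where M2: "\<And>t k l. k \<ge> M2 \<Longrightarrow> l \<ge> M2 \<Longrightarrow>
        dist (f2 (t + b (\<rho> (\<sigma> k)))) (f2 (t + b (\<rho> (\<sigma> l)))) < d"
      using uniformly_Cauchy_UNIV_obtain[OF c2 d] unfolding comp_def by blast
    have "dist (g (t + b (\<rho> (\<sigma> k)))) (g (t + b (\<rho> (\<sigma> l)))) < e"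
      if "k \<ge> max M1 M2" "l \<ge> max M1 M2" for t k l
    proof (rule imp'[rule_format])
      fix t
      show "dist (f1 (t + b (\<rho> (\<sigma> k)))) (f1 (t + b (\<rho> (\<sigma> l)))) < d \<and>
        dist (f2 (t + b (\<rho> (\<sigma> k)))) (f2 (t + b (\<rho> (\<sigma> l)))) < d"
        using that seq_suble[OF \<sigma>, of k] seq_suble[OF \<sigma>, of l] by (intro conjI M1 M2) auto
    qed
    then show "\<exists>M. \<forall>x\<in>UNIV. \<forall>k\<ge>M. \<forall>l\<ge>M. dist (g (x + b (\<rho> (\<sigma> k)))) (g (x + b (\<rho> (\<sigma> l)))) < e"
      by blast
  qed
  then show "\<exists>\<rho>. strict_mono \<rho> \<and> uniformly_Cauchy_on UNIV (\<lambda>k t. g (t + b (\<rho> k)))"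
    using strict_mono_o[OF \<rho> \<sigma>] by (intro exI[of _ "\<rho> \<circ> \<sigma>"]) (simp add: comp_def)
qed

lemma AP_const: "(\<lambda>_. c) \<in> AP"
  unfolding AP_iff_Cauchy by (auto simp: uniformly_Cauchy_on_def intro!: exI[of _ "\<lambda>k. k"] strict_monoI)

lemma AP_add:
  assumes "f \<in> AP" "g \<in> AP"
  shows "(\<lambda>t. f t + g t) \<in> AP"
proof (rule AP_I2[OF assms])
  fix e :: real assume "0 < e"
  then show "\<exists>d>0. \<forall>c c'. (\<forall>t. dist (f (t + c)) (f (t + c')) < d \<and> dist (g (t + c)) (g (t + c')) < d) \<longrightarrow>
      (\<forall>t. dist (f (t + c) + g (t + c)) (f (t + c') + g (t + c')) < e)"
    by (intro exI[of _ "e / 2"] conjI allI impI dist_triangle_add_half) simp_all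
qed (rule continuous_on_add[OF AP_continuous AP_continuous, OF assms])

lemma AP_mult:
  assumes f: "f \<in> AP" and g: "g \<in> AP"
  shows "(\<lambda>t. f t * g t) \<in> AP"
proof (rule AP_I2[OF f g])
  obtain A B where A: "\<And>t. cmod (f t) \<le> A" and B: "\<And>t. cmod (g t) \<le> B"
    using AP_bounded[OF f] AP_bounded[OF g] by blast
  have AB: "0 \<le> A" "0 \<le> B" using A B norm_ge_zero order_trans by blast+
  fix e :: real assume e: "0 < e"
  let ?d = "e / (A + B + 1)"
  have "dist (f s * g s) (f s' * g s') < e" if d: "dist (f s) (f s') < ?d" "dist (g s) (g s') < ?d" for s s'
  proof -
    have d0: "0 \<le> ?d" using e AB by simp
    have "f s * g s - f s' * g s' = (f s - f s') * g s + f s' * (g s - g s')" by (simp add: algebra_simps)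
    then have "dist (f s * g s) (f s' * g s') \<le> dist (f s) (f s') * cmod (g s) + cmod (f s') * dist (g s) (g s')"
      unfolding dist_norm by (metis norm_mult norm_triangle_ineq)
    also have "\<dots> \<le> ?d * B + A * ?d" using d A B AB d0 by (intro add_mono mult_mono) auto
    also have "\<dots> = ?d * (A + B)" by (simp only: distrib_left mult.commute[of A] add.commute)
    also have "\<dots> < ?d * (A + B + 1)" using e AB by (intro mult_strict_left_mono) auto
    also have "\<dots> = e" using AB by simp
    finally show ?thesis .
  qed
  then show "\<exists>d>0. \<forall>c c'. (\<forall>t. dist (f (t + c)) (f (t + c')) < d \<and> dist (g (t + c)) (g (t + c')) < d) \<longrightarrow>
      (\<forall>t. dist (f (t + c) * g (t + c)) (f (t + c') * g (t + c')) < e)"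
    using e AB by (intro exI[of _ ?d] conjI allI impI) simp_all
qed (rule continuous_on_mult[OF AP_continuous AP_continuous, OF f g])

text \<open>A diagonal sequence works for all \<open>f k\<close> simultaneously, and a three-epsilon
  estimate passes to the limit.\<close>

lemma AP_uniform_limit:
  assumes f: "\<And>k. f k \<in> AP" and lim: "uniform_limit UNIV f g sequentially"
  shows "g \<in> AP"
  unfolding AP_iff_Cauchy
proof (intro conjI allI)
  show "continuous_on UNIV g"
    by (rule uniform_limit_theorem[OF _ lim]) (auto simp: f AP_continuous)
  fix b :: "nat \<Rightarrow> real"
  define P where "P k s \<longleftrightarrow> uniformly_Cauchy_on UNIV (\<lambda>j t. f k (t + b (s j)))" for k and s :: "nat \<Rightarrow> nat"
  interpret subseqs P
  proof
    fix k and s :: "nat \<Rightarrow> nat" assume "strict_mono s"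
    show "\<exists>r'. strict_mono r' \<and> P k (s \<circ> r')"
      using f[of k, unfolded AP_iff_Cauchy, THEN conjunct2, rule_format, of "b \<circ> s"]
      by (simp add: P_def)
  qed
  have P: "\<exists>M. \<forall>t. \<forall>i\<ge>M. \<forall>j\<ge>M. dist (f k (t + b (diagseq i))) (f k (t + b (diagseq j))) < e"
    if e: "0 < e" for k e
  proof -
    \<comment> \<open>From index k + 1 on, the diagonal sequence runs inside the sequence selected
      for \<open>f k\<close>.\<close>
    have "P k (diagseq \<circ> (+) (Suc k))"
    proof (rule diagseq_holds)
      fix r s :: "nat \<Rightarrow> nat" and k assume r: "strict_mono r" and "P k s"
      then have c: "uniformly_Cauchy_on UNIV (\<lambda>j t. f k (t + b (s j)))" by (simp add: P_def)
      show "P k (s \<circ> r)"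
        unfolding P_def
      proof (rule uniformly_Cauchy_onI)
        fix e :: real assume "0 < e"
        then obtain M where M: "\<And>t i j. i \<ge> M \<Longrightarrow> j \<ge> M \<Longrightarrow> dist (f k (t + b (s i))) (f k (t + b (s j))) < e"
          using uniformly_Cauchy_UNIV_obtain[OF c] by blast
        have "M \<le> r i" if "M \<le> i" for i using seq_suble[OF r, of i] that by linarith
        then show "\<exists>M. \<forall>x\<in>UNIV. \<forall>i\<ge>M. \<forall>j\<ge>M.
            dist (f k (x + b ((s \<circ> r) i))) (f k (x + b ((s \<circ> r) j))) < e"
          using M by (intro exI[of _ M]) simp
      qed
    qed
    then have "uniformly_Cauchy_on UNIV (\<lambda>j t. f k (t + b (diagseq (Suc k + j))))"
      by (simp add: P_def comp_def)
    from uniformly_Cauchy_UNIV_obtain[OF this e] obtain M where M: "\<And>t i j. i \<ge> M \<Longrightarrow> j \<ge> M \<Longrightarrow>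
        dist (f k (t + b (diagseq (Suc k + i)))) (f k (t + b (diagseq (Suc k + j)))) < e"
      by blast
    have "dist (f k (t + b (diagseq i))) (f k (t + b (diagseq j))) < e"
      if "i \<ge> Suc k + M" "j \<ge> Suc k + M" for t i j
      using that M[of "i - Suc k" "j - Suc k" t] by simp
    then show ?thesis by blast
  qed
  have "uniformly_Cauchy_on UNIV (\<lambda>j t. g (t + b (diagseq j)))"
  proof (rule uniformly_Cauchy_onI)
    fix e :: real assume e: "0 < e"
    obtain k where k: "\<And>t. dist (f k t) (g t) < e / 3"
      using uniform_limitD[OF lim, of "e / 3"] e by (auto simp: eventually_sequentially)
    obtain M where M: "\<And>t i j. i \<ge> M \<Longrightarrow> j \<ge> M \<Longrightarrow>
        dist (f k (t + b (diagseq i))) (f k (t + b (diagseq j))) < e / 3"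
      using P[of "e / 3" k] e by auto
    have "dist (g (t + b (diagseq i))) (g (t + b (diagseq j))) < e" if "i \<ge> M" "j \<ge> M" for t i j
      using k[of "t + b (diagseq i)"] k[of "t + b (diagseq j)"] M[OF that, of t]
        dist_triangle_third[of "g (t + b (diagseq i))" "f k (t + b (diagseq i))" e
          "f k (t + b (diagseq j))" "g (t + b (diagseq j))"] by (simp add: dist_commute)
    then show "\<exists>M. \<forall>x\<in>UNIV. \<forall>i\<ge>M. \<forall>j\<ge>M. dist (g (x + b (diagseq i))) (g (x + b (diagseq j))) < e"
      by blast
  qed
  then show "\<exists>\<rho>. strict_mono \<rho> \<and> uniformly_Cauchy_on UNIV (\<lambda>k t. g (t + b (\<rho> k)))"
    using subseq_diagseq by blast
qed

text \<open>Almost periods tending to \<open>+\<infinity>\<close> carry the value of \<open>f\<close> at \<open>t\<close> to places where \<open>g\<close> is small.\<close>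

lemma AP_norm_le:
  assumes f: "f \<in> AP" and g: "(g \<longlongrightarrow> 0) at_top" and bd: "\<And>t. cmod (f t + g t) \<le> M"
  shows "cmod (f t) \<le> M"
proof (rule field_le_epsilon)
  fix e :: real assume e: "0 < e"
  obtain \<rho> where \<rho>: "strict_mono \<rho>" and c: "uniformly_Cauchy_on UNIV (\<lambda>k t. f (t + real (\<rho> k)))"
    using f unfolding AP_iff_Cauchy by blast
  obtain N where N: "\<And>t k l. k \<ge> N \<Longrightarrow> l \<ge> N \<Longrightarrow> dist (f (t + real (\<rho> k))) (f (t + real (\<rho> l))) < e / 2"
    using uniformly_Cauchy_UNIV_obtain[OF c half_gt_zero[OF e]] by blast
  obtain T where T: "\<And>s. s \<ge> T \<Longrightarrow> cmod (g s) < e / 2"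
    using tendstoD[OF g, of "e / 2"] e by (auto simp: eventually_at_top_linorder)
  obtain q :: nat where q: "T - t + real (\<rho> N) \<le> real q" using real_arch_simple by blast
  define k where "k = max N q"
  have "real q \<le> real (\<rho> k)" using seq_suble[OF \<rho>, of k] by (simp add: k_def)
  then have s: "t - real (\<rho> N) + real (\<rho> k) \<ge> T" using q by linarith
  let ?s = "t - real (\<rho> N) + real (\<rho> k)"
  \<comment> \<open>At the argument \<open>t - real (\<rho> N)\<close> the translate with index N is
    f at t itself, and the one with index k is f far to the right.\<close>
  have "dist (f ?s) (f t) < e / 2" using N[of k N "t - real (\<rho> N)"] by (simp add: k_def)
  then have "cmod (f t) \<le> cmod (f ?s) + e / 2"
    using norm_triangle_sub[of "f t" "f ?s"] by (simp add: dist_norm norm_minus_commute)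
  also have "cmod (f ?s) \<le> cmod (f ?s + g ?s) + cmod (g ?s)"
    using norm_triangle_ineq4[of "f ?s + g ?s" "g ?s"] by simp
  finally show "cmod (f t) \<le> M + e" using bd[of ?s] T[OF s] by linarith
qed

text \<open>Dominated convergence in the convolution form. The path \<open>X\<close> serves to treat
  both ends at once: it is later t or - t, up to writing it as a multiple.\<close>

lemma green1_tendsto_0:
  assumes \<omega>: "Re \<omega> \<noteq> 0" and f: "f \<in> BC"
    and X: "\<And>u. ((\<lambda>t. f (X t + u)) \<longlongrightarrow> 0) at_top"
  shows "((\<lambda>t::real. green1 \<omega> f (X t)) \<longlongrightarrow> 0) at_top"
proof -
  obtain B where B: "\<And>s. cmod (f s) \<le> B" using f unfolding BC_iff by blast
  have "((\<lambda>t. LBINT u. green_kernel \<omega> 0 u * f (X t + u)) \<longlongrightarrow> (LBINT u::real. 0)) at_top"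
  proof (rule integral_dominated_convergence_at_top[where f="\<lambda>_. 0" and M=lborel
        and s="\<lambda>t u. green_kernel \<omega> 0 u * f (X t + u)" and w="\<lambda>u. cmod (green_kernel \<omega> 0 u) * B"])
    show "integrable lborel (\<lambda>u. cmod (green_kernel \<omega> 0 u) * B)"
      using has_bochner_integral_green_kernel[OF \<omega>] by (auto simp: has_bochner_integral_iff)
    show "eventually (\<lambda>t. AE u in lborel. norm (green_kernel \<omega> 0 u * f (X t + u))
        \<le> cmod (green_kernel \<omega> 0 u) * B) at_top"
      by (intro always_eventually allI AE_I2) (auto simp: norm_mult intro!: mult_left_mono B)
    show "AE u in lborel. ((\<lambda>t. green_kernel \<omega> 0 u * f (X t + u)) \<longlongrightarrow> 0) at_top"
      by (intro AE_I2 tendsto_mult_right_zero X)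
  qed (use BC_measurable[OF f] in measurable)
  then show ?thesis by (simp add: green1_convolution)
qed

text \<open>The filter is a parameter so that the two versions of the theorem share one proof:
  \<open>at_top\<close> gives \<open>BC0\<close> and \<open>sup at_top at_bot\<close> gives
  \<open>C00\<close>.\<close>

definition vanishing :: "real filter \<Rightarrow> (real \<Rightarrow> complex) set" where
  "vanishing F = {f \<in> BC. (f \<longlongrightarrow> 0) F}"

lemma tendsto_sup_iff:
  "(f \<longlongrightarrow> l) (sup F G) \<longleftrightarrow> (f \<longlongrightarrow> l) F \<and> (f \<longlongrightarrow> l) G"
  by (simp add: filterlim_def filtermap_sup)

lemma BC0_eq_vanishing: "BC0 = vanishing at_top"
  by (simp add: BC0_def vanishing_def)

lemma C00_eq_vanishing: "C00 = vanishing (sup at_top at_bot)"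
  by (auto simp: C00_def BC0_def vanishing_def tendsto_sup_iff)

lemma AP_BC: "f \<in> AP \<Longrightarrow> f \<in> BC"
  by (simp add: BC_iff AP_continuous AP_bounded)

lemma vanishing_BC: "f \<in> vanishing F \<Longrightarrow> f \<in> BC"
  by (simp add: vanishing_def)

lemma vanishing_add: "f \<in> vanishing F \<Longrightarrow> g \<in> vanishing F \<Longrightarrow> (\<lambda>t. f t + g t) \<in> vanishing F"
  unfolding vanishing_def using tendsto_add[of f 0 F g 0] by (auto intro: BC_add)

lemma vanishing_mult_BC:
  assumes "f \<in> BC" "g \<in> vanishing F"
  shows "(\<lambda>t. f t * g t) \<in> vanishing F"
proof -
  obtain B where "\<And>t. cmod (f t) \<le> B" using assms(1) unfolding BC_iff by blast
  then have "Bfun f F" by (intro BfunI[of _ B]) simp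
  moreover have "Zfun g F"
    using assms(2) by (simp add: vanishing_def tendsto_Zfun_iff)
  ultimately have "Zfun (\<lambda>t. f t * g t) F"
    by (rule bounded_bilinear.Bfun_prod_Zfun[OF bounded_bilinear_mult])
  then have "((\<lambda>t. f t * g t) \<longlongrightarrow> 0) F" by (simp add: tendsto_Zfun_iff)
  then show ?thesis using assms by (auto simp: vanishing_def intro: BC_mult)
qed

lemma vanishing_uniform_limit:
  assumes f: "\<And>k. f k \<in> vanishing F" and lim: "uniform_limit UNIV f g sequentially"
  shows "g \<in> vanishing F"
proof -
  have "(g \<longlongrightarrow> 0) F"
  proof (rule tendstoI)
    fix e :: real assume e: "0 < e"
    obtain k where k: "\<And>t. dist (f k t) (g t) < e / 2"
      using uniform_limitD[OF lim, of "e / 2"] e by (auto simp: eventually_sequentially)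
    have "eventually (\<lambda>t. dist (f k t) 0 < e / 2) F"
      using f[of k] e unfolding vanishing_def by (intro tendstoD) auto
    then show "eventually (\<lambda>t. dist (g t) 0 < e) F"
      by eventually_elim (rule dist_triangle_half_r[OF k])
  qed
  then show ?thesis
    using BC_uniform_limit[OF _ lim] f by (simp add: vanishing_def)
qed

lemma BC_green1:
  assumes \<omega>: "Re \<omega> \<noteq> 0" and f: "f \<in> BC"
  shows "green1 \<omega> f \<in> BC"
proof -
  obtain B where "\<And>s. cmod (f s) \<le> B" using f unfolding BC_iff by blast
  from cmod_green1_le[OF \<omega> f this] show ?thesis
    unfolding BC_iff using continuous_green1[OF \<omega> integrable_green[OF \<omega> f]] by blast
qed

abbreviation infinity_filters :: "real filter set" where
  "infinity_filters \<equiv> {at_top, sup at_top at_bot}"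

lemma vanishing_green1:
  assumes \<omega>: "Re \<omega> \<noteq> 0" and f: "f \<in> vanishing F" and F: "F \<in> infinity_filters"
  shows "green1 \<omega> f \<in> vanishing F"
proof -
  have bc: "f \<in> BC" and lim: "(f \<longlongrightarrow> 0) F" using f by (auto simp: vanishing_def)
  have *: "((\<lambda>t. green1 \<omega> f (e * t)) \<longlongrightarrow> 0) at_top"
    if "(f \<longlongrightarrow> 0) G" "\<And>u. filterlim (\<lambda>t. e * t + u) G at_top" for e G
    by (rule green1_tendsto_0[OF \<omega> bc]) (rule filterlim_compose[OF that])
  have "eventually (\<lambda>t. Z \<le> t + u) at_top" for u Z :: real
    using eventually_ge_at_top[of "Z - u"] by eventually_elim simp
  moreover have "eventually (\<lambda>t. u - t \<le> Z) at_top" for u Z :: real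
    using eventually_ge_at_top[of "u - Z"] by eventually_elim simp
  ultimately have "filterlim (\<lambda>t. 1 * t + u) at_top at_top" "filterlim (\<lambda>t. - 1 * t + u) at_bot at_top" for u :: real
    by (simp_all add: filterlim_at_top filterlim_at_bot)
  then have top: "(f \<longlongrightarrow> 0) at_top \<Longrightarrow> (green1 \<omega> f \<longlongrightarrow> 0) at_top"
    and bot: "(f \<longlongrightarrow> 0) at_bot \<Longrightarrow> (green1 \<omega> f \<longlongrightarrow> 0) at_bot"
    using *[of at_top 1] *[of at_bot "- 1"] by (simp_all add: filterlim_at_bot_mirror)
  show ?thesis
    using F top bot lim BC_green1[OF \<omega> bc] by (auto simp: vanishing_def tendsto_sup_iff)
qed

lemma green1_diff:
  assumes "Re \<omega> \<noteq> 0" "f \<in> BC" "g \<in> BC"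
  shows "green1 \<omega> (\<lambda>s. f s - g s) t = green1 \<omega> f t - green1 \<omega> g t"
  unfolding green1_def right_diff_distrib
  by (rule Bochner_Integration.integral_diff integrable_green assms)+

lemma AP_green1:
  assumes \<omega>: "Re \<omega> \<noteq> 0" and f: "f \<in> AP"
  shows "green1 \<omega> f \<in> AP"
proof (rule AP_I2[OF f f])
  obtain B where B: "\<And>s. cmod (f s) \<le> B" using AP_bounded[OF f] by blast
  show "continuous_on UNIV (green1 \<omega> f)"
    by (rule continuous_green1[OF \<omega> integrable_green[OF \<omega> AP_BC[OF f]]])
  have cm: "(\<lambda>s. f (s + c)) \<in> BC" for c
    using B unfolding BC_iff
    by (auto intro!: continuous_on_compose2[OF AP_continuous[OF f]] continuous_intros)
  fix e :: real assume e: "0 < e"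
  let ?d = "e * \<bar>Re \<omega>\<bar> / 2"
  have "dist (green1 \<omega> f (t + c)) (green1 \<omega> f (t + c')) < e"
    if d: "\<And>t. dist (f (t + c)) (f (t + c')) < ?d" for t c c'
  proof -
    have "green1 \<omega> f (t + c) - green1 \<omega> f (t + c') = green1 \<omega> (\<lambda>s. f (s + c) - f (s + c')) t"
      unfolding green1_shift by (rule green1_diff[OF \<omega> cm cm, symmetric])
    also have "cmod \<dots> \<le> ?d / \<bar>Re \<omega>\<bar>"
      by (intro cmod_green1_le \<omega> BC_minus cm) (use d in \<open>auto simp: dist_norm less_imp_le\<close>)
    also have "\<dots> < e" using \<omega> e by simp
    finally show ?thesis by (simp add: dist_norm)
  qed
  then show "\<exists>d>0. \<forall>c c'. (\<forall>t. dist (f (t + c)) (f (t + c')) < d \<and> dist (f (t + c)) (f (t + c')) < d) \<longrightarrow>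
      (\<forall>t. dist (green1 \<omega> f (t + c)) (green1 \<omega> f (t + c')) < e)"
    using e \<omega> by (intro exI[of _ ?d]) auto
qed

lemma green1_tendsto_uniform_limit:
  assumes \<omega>: "Re \<omega> \<noteq> 0" and h: "\<And>k. h k \<in> BC" and lim: "uniform_limit UNIV h g sequentially"
  shows "(\<lambda>k. green1 \<omega> (h k) t) \<longlonglongrightarrow> green1 \<omega> g t"
proof (rule LIMSEQ_I)
  have g: "g \<in> BC" using BC_uniform_limit[OF h lim] .
  fix e :: real assume e: "0 < e"
  then have "0 < e * \<bar>Re \<omega>\<bar> / 2" using \<omega> by simp
  from uniform_limitD[OF lim this] obtain K where
    K: "\<And>k s. K \<le> k \<Longrightarrow> dist (h k s) (g s) < e * \<bar>Re \<omega>\<bar> / 2"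
    by (auto simp: eventually_sequentially)
  have "norm (green1 \<omega> (h k) t - green1 \<omega> g t) < e" if "K \<le> k" for k
  proof -
    have "norm (green1 \<omega> (h k) t - green1 \<omega> g t) = cmod (green1 \<omega> (\<lambda>s. h k s - g s) t)"
      by (simp add: green1_diff \<omega> h g)
    also have "\<dots> \<le> (e * \<bar>Re \<omega>\<bar> / 2) / \<bar>Re \<omega>\<bar>"
      using K[OF that] by (intro cmod_green1_le \<omega> BC_minus h g)
        (auto simp: dist_norm less_imp_le)
    also have "\<dots> < e" using \<omega> e by simp
    finally show ?thesis .
  qed
  then show "\<exists>K. \<forall>k\<ge>K. norm (green1 \<omega> (h k) t - green1 \<omega> g t) < e" by blast
qed

text \<open>A relation instead of a space: it records which almost periodic function belongs to
  \<open>f\<close>. It is preserved by sums, products, \<open>bell\<close> and Green integrals, so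
  an expression in the r_i is automatically related to the same expression in the \<mu>_i.\<close>

definition ap_part :: "real filter \<Rightarrow> (real \<Rightarrow> complex) \<Rightarrow> (real \<Rightarrow> complex) \<Rightarrow> bool" where
  "ap_part F f g \<longleftrightarrow> g \<in> AP \<and> (\<lambda>t. f t - g t) \<in> vanishing F"

lemma ap_part_BC: "ap_part F f g \<Longrightarrow> f \<in> BC"
  using BC_add[OF AP_BC vanishing_BC, of g "\<lambda>t. f t - g t"] unfolding ap_part_def by auto

lemma ap_part_const: "ap_part F (\<lambda>_. c) (\<lambda>_. c)"
  by (auto simp: ap_part_def AP_const vanishing_def BC_const)

lemma ap_part_add:
  assumes "ap_part F f1 g1" "ap_part F f2 g2"
  shows "ap_part F (\<lambda>t. f1 t + f2 t) (\<lambda>t. g1 t + g2 t)"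
proof -
  have "(\<lambda>t. (f1 t - g1 t) + (f2 t - g2 t)) \<in> vanishing F"
    using assms by (intro vanishing_add) (simp_all add: ap_part_def)
  moreover have "(\<lambda>t. (f1 t - g1 t) + (f2 t - g2 t)) = (\<lambda>t. f1 t + f2 t - (g1 t + g2 t))" by auto
  ultimately show ?thesis using assms AP_add[of g1 g2] by (simp add: ap_part_def)
qed

lemma ap_part_mult:
  assumes "ap_part F f1 g1" "ap_part F f2 g2"
  shows "ap_part F (\<lambda>t. f1 t * f2 t) (\<lambda>t. g1 t * g2 t)"
proof -
  have "g2 \<in> BC" "(\<lambda>t. f2 t - g2 t) \<in> vanishing F" "(\<lambda>t. f1 t - g1 t) \<in> vanishing F"
    using assms by (simp_all add: ap_part_def AP_BC)
  then have "(\<lambda>t. f1 t * (f2 t - g2 t) + g2 t * (f1 t - g1 t)) \<in> vanishing F"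
    by (intro vanishing_add vanishing_mult_BC ap_part_BC[OF assms(1)])
  moreover have "(\<lambda>t. f1 t * (f2 t - g2 t) + g2 t * (f1 t - g1 t)) = (\<lambda>t. f1 t * f2 t - g1 t * g2 t)"
    by (auto simp: algebra_simps)
  ultimately show ?thesis using assms AP_mult[of g1 g2] by (simp add: ap_part_def)
qed

lemma ap_part_cmult: "ap_part F f g \<Longrightarrow> ap_part F (\<lambda>t. c * f t) (\<lambda>t. c * g t)"
  by (rule ap_part_mult[OF ap_part_const])

lemma ap_part_sum:
  assumes "\<And>i. i \<in> I \<Longrightarrow> ap_part F (f i) (g i)"
  shows "ap_part F (\<lambda>t. \<Sum>i\<in>I. f i t) (\<lambda>t. \<Sum>i\<in>I. g i t)"
  using assms
proof (induction I rule: infinite_finite_induct)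
  case (insert i I)
  then show ?case using ap_part_add[of F "f i" "g i"] by simp
qed (simp_all add: ap_part_const)

lemma ap_part_bell:
  assumes "\<And>k. k \<in> {1..i} \<Longrightarrow> ap_part F (\<lambda>t. x t k) (\<lambda>t. y t k)"
  shows "ap_part F (\<lambda>t. bell i (x t)) (\<lambda>t. bell i (y t))"
  using assms
proof (induction i rule: less_induct)
  case (less i)
  show ?case
  proof (cases i)
    case (Suc p)
    have "ap_part F (\<lambda>t. bell (p - j) (x t)) (\<lambda>t. bell (p - j) (y t))"
      "ap_part F (\<lambda>t. x t (j + 1)) (\<lambda>t. y t (j + 1))" if "j \<in> {0..p}" for j
      using less Suc that by auto
    then show ?thesis unfolding Suc bell.simps
      by (intro ap_part_sum ap_part_mult ap_part_const)
  qed (simp add: ap_part_const)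
qed

lemma ap_part_bell_f:
  assumes "\<And>k. k \<in> {1..i} \<Longrightarrow> ap_part F (\<lambda>t. x t k) (\<lambda>t. y t k)"
  shows "ap_part F (\<lambda>t. bell_f i (x t)) (\<lambda>t. bell_f i (y t))"
  unfolding bell_f_eq
  by (intro ap_part_sum ap_part_mult ap_part_const ap_part_bell assms) auto

lemma ap_part_green1:
  assumes \<omega>: "Re \<omega> \<noteq> 0" and F: "F \<in> infinity_filters" and f: "ap_part F f g"
  shows "ap_part F (green1 \<omega> f) (green1 \<omega> g)"
proof -
  have eq: "green1 \<omega> (\<lambda>t. f t - g t) = (\<lambda>t. green1 \<omega> f t - green1 \<omega> g t)"
    using green1_diff[OF \<omega> ap_part_BC[OF f] AP_BC] f by (auto simp: ap_part_def)
  have "green1 \<omega> (\<lambda>t. f t - g t) \<in> vanishing F"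
    using f by (intro vanishing_green1[OF \<omega> _ F]) (simp add: ap_part_def)
  then show ?thesis
    using AP_green1[OF \<omega>, of g] f unfolding eq ap_part_def by simp
qed

text \<open>\<open>AP_norm_le\<close> applied to the difference. Passing to almost periodic parts
  never increases uniform distances, so it preserves uniform Cauchy sequences.\<close>

lemma ap_part_diff_le:
  assumes F: "F \<in> infinity_filters" and f: "ap_part F f1 g1" "ap_part F f2 g2"
    and le: "\<And>t. cmod (f1 t - f2 t) \<le> M"
  shows "cmod (g1 t - g2 t) \<le> M"
proof -
  have m: "ap_part F (\<lambda>t. f1 t + (- 1) * f2 t) (\<lambda>t. g1 t + (- 1) * g2 t)"
    by (intro ap_part_add ap_part_cmult f)
  then have "((\<lambda>t. f1 t + (- 1) * f2 t - (g1 t + (- 1) * g2 t)) \<longlongrightarrow> 0) at_top"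
    using F unfolding ap_part_def vanishing_def by (auto simp: tendsto_sup_iff)
  then have "cmod (g1 t + (- 1) * g2 t) \<le> M"
    using m le unfolding ap_part_def by (intro AP_norm_le[of "\<lambda>t. g1 t + (- 1) * g2 t"]) auto
  then show ?thesis by simp
qed

lemma ap_part_uniform_limit:
  assumes F: "F \<in> infinity_filters" and f: "\<And>k. ap_part F (f k) (g k)"
    and lim: "uniform_limit UNIV f f' sequentially"
  obtains g' where "uniform_limit UNIV g g' sequentially" "ap_part F f' g'"
proof -
  have "uniformly_Cauchy_on UNIV f"
    using lim by (intro uniformly_convergent_Cauchy) (auto simp: uniformly_convergent_on_def)
  have "uniformly_Cauchy_on UNIV g"
  proof (rule uniformly_Cauchy_onI)
    fix e :: real assume e: "0 < e"
    obtain K where K: "\<And>t k l. k \<ge> K \<Longrightarrow> l \<ge> K \<Longrightarrow> dist (f k t) (f l t) < e / 2"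
      using uniformly_Cauchy_UNIV_obtain[OF \<open>uniformly_Cauchy_on UNIV f\<close> half_gt_zero[OF e]] by blast
    have "dist (g k t) (g l t) < e" if "k \<ge> K" "l \<ge> K" for k l t
      using ap_part_diff_le[OF F f[of k] f[of l], of "e / 2" t] K[OF that] e
      by (auto simp: dist_norm less_imp_le)
    then show "\<exists>M. \<forall>x\<in>UNIV. \<forall>k\<ge>M. \<forall>l\<ge>M. dist (g k x) (g l x) < e" by blast
  qed
  then obtain g' where g': "uniform_limit UNIV g g' sequentially"
    using Cauchy_uniformly_convergent unfolding uniformly_convergent_on_def by blast
  have "uniform_limit UNIV (\<lambda>k t. f k t - g k t) (\<lambda>t. f' t - g' t) sequentially"
    by (rule uniform_limit_minus[OF lim g'])
  then have "(\<lambda>t. f' t - g' t) \<in> vanishing F"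
    by (rule vanishing_uniform_limit[rotated]) (use f in \<open>simp add: ap_part_def\<close>)
  moreover have "g' \<in> AP"
    by (rule AP_uniform_limit[OF _ g']) (use f in \<open>simp add: ap_part_def\<close>)
  ultimately have "ap_part F f' g'" by (simp add: ap_part_def)
  with g' show ?thesis by (rule that)
qed

section \<open>Taylor coefficients and Lagrange interpolation\<close>

text \<open>The inner sums over j in \<open>Fop\<close> and in the tilde operators are these Taylor
  coefficients of P(c;x) at \<open>lam\<close>; this is where their binomials and powers of
  \<lambda> come from.\<close>

lemma Taylor_coeff:
  assumes "k \<le> n"
  shows "dP k n c lam / fact k = (\<Sum>j=0..n-k. of_nat ((k + j) choose j) * c (k + j) * lam ^ j)"
proof -
  have sym: "(k + j) choose k = (k + j) choose j" for j
    using binomial_symmetric[of k "k + j"] by simp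
  have mon: "poly ((pderiv ^^ k) (monom (c i) i)) lam =
      (if i < k then 0 else fact k * of_nat (i choose k) * c i * lam ^ (i - k))" for i
  proof (cases "i < k")
    case True
    have "(pderiv ^^ k) (monom (c i) i) = 0"
      by (rule poly_eqI) (use True in \<open>simp add: coeff_higher_pderiv\<close>)
    then show ?thesis using True by simp
  next
    case False
    have "(pderiv ^^ k) (monom (c i) i) = monom (fact k * of_nat (i choose k) * c i) (i - k)"
    proof (rule poly_eqI)
      fix j
      show "coeff ((pderiv ^^ k) (monom (c i) i)) j = coeff (monom (fact k * of_nat (i choose k) * c i) (i - k)) j"
      proof (cases "j = i - k")
        case True
        have "pochhammer (of_nat (Suc (i - k))) k = (of_nat (pochhammer (Suc (i - k)) k) :: complex)"
          by (rule pochhammer_of_nat)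
        also have "pochhammer (Suc (i - k)) k = fact k * (i choose k)"
        proof -
          have "fact (i - k) * pochhammer (Suc (i - k)) k = (fact i :: nat)"
            using pochhammer_product[of "i - k" i "1::nat"] False by (simp add: pochhammer_fact)
          also have "\<dots> = fact (i - k) * (fact k * (i choose k))"
            using binomial_fact_lemma[of k i] False by (simp add: mult_ac)
          finally show ?thesis by simp
        qed
        finally show ?thesis using True False by (simp add: coeff_higher_pderiv)
      next
        case F: False
        then show ?thesis using False by (auto simp: coeff_higher_pderiv)
      qed
    qed
    then show ?thesis using False by (simp add: poly_monom)
  qed
  have "dP k n c lam = (\<Sum>i=0..n. if i < k then 0 else fact k * of_nat (i choose k) * c i * lam ^ (i - k))"
    by (simp add: dP_def Pol_def higher_pderiv_sum poly_sum mon)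
  also have "\<dots> = (\<Sum>i=k..n. fact k * of_nat (i choose k) * c i * lam ^ (i - k))"
    by (rule sum.mono_neutral_cong_right) auto
  also have "\<dots> = (\<Sum>j=0..n-k. fact k * of_nat ((k + j) choose k) * c (k + j) * lam ^ j)"
    by (rule sum.reindex_bij_witness[of _ "\<lambda>j. k + j" "\<lambda>i. i - k"]) (use assms in auto)
  also have "\<dots> = fact k * (\<Sum>j=0..n-k. of_nat ((k + j) choose j) * c (k + j) * lam ^ j)"
    unfolding sum_distrib_left
    by (intro sum.cong refl) (simp add: sym mult_ac)
  finally show ?thesis by simp
qed

text \<open>Taylor expansion at \<open>lam\<close> with the powers x^k replaced by arbitrary
  weights. Powers as weights give \<open>poly_Pol_shift\<close>, Bell polynomials as weights give
  the reduction of the linear equation.\<close>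

lemma Taylor_sum:
  fixes w :: "nat \<Rightarrow> complex"
  shows "(\<Sum>i\<le>n. c i * (\<Sum>k\<le>i. of_nat (i choose k) * lam ^ (i - k) * w k)) =
    (\<Sum>k\<le>n. dP k n c lam / fact k * w k)"
proof -
  have "(\<Sum>i\<le>n. c i * (\<Sum>k\<le>i. of_nat (i choose k) * lam ^ (i - k) * w k)) =
      (\<Sum>(i, k)\<in>(SIGMA i:{..n}. {..i}). of_nat (i choose k) * c i * lam ^ (i - k) * w k)"
    by (simp add: sum.Sigma sum_distrib_left mult_ac)
  also have "\<dots> = (\<Sum>(k, j)\<in>(SIGMA k:{..n}. {0..n-k}). of_nat ((k + j) choose j) * c (k + j) * lam ^ j * w k)"
    by (rule sum.reindex_bij_witness[of _ "\<lambda>(k, j). (k + j, k)" "\<lambda>(i, k). (k, i - k)"])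
      (auto simp: binomial_symmetric[symmetric])
  also have "\<dots> = (\<Sum>k\<le>n. dP k n c lam / fact k * w k)"
    by (simp add: sum.Sigma[symmetric] Taylor_coeff sum_distrib_right)
  finally show ?thesis .
qed

lemma poly_Pol: "poly (Pol n c) x = (\<Sum>i\<le>n. c i * x ^ i)"
  by (simp add: Pol_def poly_sum poly_monom atLeast0AtMost)

lemma poly_Pol_shift: "poly (Pol n c) (lam + x) = (\<Sum>k\<le>n. dP k n c lam / fact k * x ^ k)"
  unfolding poly_Pol Taylor_sum[symmetric]
  by (simp add: add.commute[of lam] binomial_ring mult_ac)

text \<open>A polynomial of degree below the number of nodes equals its Lagrange interpolant;
  compare top coefficients. All identities for the weights 1 / \<Gamma>_j are instances.\<close>

lemma Lagrange_top_coeff: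
  fixes x :: "'i \<Rightarrow> complex" and q :: "complex poly"
  assumes I: "finite I" "inj_on x I" and q: "degree q < card I"
  shows "(\<Sum>j\<in>I. poly q (x j) / (\<Prod>k\<in>I - {j}. x j - x k)) = coeff q (card I - 1)"
proof -
  define l where "l j = smult (1 / (\<Prod>k\<in>I - {j}. x j - x k)) (\<Prod>k\<in>I - {j}. [:- x k, 1:])" for j
  define p where "p = (\<Sum>j\<in>I. smult (poly q (x j)) (l j))"
  have lin: "degree (\<Prod>k\<in>A. [:- x k, 1:]) = card A" "coeff (\<Prod>k\<in>A. [:- x k, 1:]) (card A) = 1" if "finite A" for A
  proof -
    show d: "degree (\<Prod>k\<in>A. [:- x k, 1:]) = card A"
      using that by (subst degree_prod_eq_sum_degree) auto
    show "coeff (\<Prod>k\<in>A. [:- x k, 1:]) (card A) = 1"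
      using lead_coeff_prod[of "\<lambda>k. [:- x k, 1:]" A] d by simp
  qed
  have nz: "(\<Prod>k\<in>I - {j}. x j - x k) \<noteq> 0" if "j \<in> I" for j
    using I that by (auto simp: inj_on_def)
  have l_eval: "poly (l j) (x i) = (if i = j then 1 else 0)" if "i \<in> I" "j \<in> I" for i j
    using that nz[of j] I by (auto simp: l_def poly_prod)
  have "poly p (x i) = poly q (x i)" if "i \<in> I" for i
    using that I l_eval[OF that] by (simp add: p_def poly_sum if_distrib[of "\<lambda>z. _ * z"] cong: if_cong)
  then have sub: "x ` I \<subseteq> {z. poly (p - q) z = 0}" by auto
  have dl: "degree (l j) \<le> card I - 1" if "j \<in> I" for j
    using that I lin(1)[of "I - {j}"] by (auto simp: l_def intro: order_trans[OF degree_smult_le])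
  have "degree p \<le> card I - 1"
    unfolding p_def by (rule degree_sum_le) (use dl I in \<open>auto intro: order_trans[OF degree_smult_le]\<close>)
  then have "degree (p - q) \<le> card I - 1" using q by (intro degree_diff_le) auto
  then have deg: "degree (p - q) < card I" using q by simp
  have "p - q = 0"
  proof (rule ccontr)
    assume nz: "p - q \<noteq> 0"
    have "card I = card (x ` I)" using I by (simp add: card_image)
    also have "\<dots> \<le> card {z. poly (p - q) z = 0}" by (rule card_mono[OF poly_roots_finite[OF nz] sub])
    also have "\<dots> \<le> degree (p - q)" by (rule card_poly_roots_bound[OF nz])
    finally show False using deg by simp
  qed
  have l2: "coeff (\<Prod>k\<in>I - {j}. [:- x k, 1:]) (card I - 1) = 1" if "j \<in> I" for j
    using lin(2)[of "I - {j}"] that I by simp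
  from \<open>p - q = 0\<close> have "coeff q (card I - 1) = coeff p (card I - 1)" by simp
  also have "\<dots> = (\<Sum>j\<in>I. poly q (x j) / (\<Prod>k\<in>I - {j}. x j - x k))"
    using l2 by (simp add: p_def l_def coeff_sum)
  finally show ?thesis by simp
qed

section \<open>The nonlinearity of the Riccati type equation\<close>

text \<open>The inhomogeneity \<open>h\<close> with the jet as a free argument, so that it can be
  estimated on arbitrary vectors and evaluated at Green integrals without mentioning
  derivatives.\<close>

definition Phi :: "nat \<Rightarrow> (nat \<Rightarrow> complex) \<Rightarrow> complex \<Rightarrow> (nat \<Rightarrow> real \<Rightarrow> complex) \<Rightarrow>
    (nat \<Rightarrow> complex) \<Rightarrow> real \<Rightarrow> complex" where
  "Phi n a lam c x t = Pfun n c lam t + (\<Sum>k=1..n-1. 1 / fact k * dP k n (\<lambda>i. c i t) lam * x k) +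
    (\<Sum>i=2..n. \<Sum>j=0..n-i. of_nat ((i + j) choose j) * (a (i + j) + c (i + j) t) * lam ^ j *
      bell_f (i - 1) x)"

lemma Phi_jet:
  "Pfun n c lam t + Lop n lam c z t + Fop n a lam c z t = Phi n a lam c (jet z t) t"
  by (simp add: Phi_def Lop_def Fop_def jet_def)

lemma Phi_cong:
  assumes "\<And>k. k \<in> {1..n-1} \<Longrightarrow> x k = y k"
  shows "Phi n a lam c x t = Phi n a lam c y t"
proof -
  have "bell_f (i - 1) x = bell_f (i - 1) y" if "i \<in> {2..n}" for i
    using that by (intro bell_f_cong assms) auto
  then show ?thesis unfolding Phi_def using assms by simp
qed

text \<open>Regroups by the index i + j of the coefficient, which is how \<open>Q0\<close> is
  organised.\<close>

lemma sum_triangle_shift: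
  fixes g :: "nat \<Rightarrow> nat \<Rightarrow> nat \<Rightarrow> 'a::comm_monoid_add"
  shows "(\<Sum>i=2..n. \<Sum>j=0..n-i. g (i + j) j i) = (\<Sum>i=2..n. \<Sum>k=0..i-2. g i k (i - k))"
  by (simp add: sum.Sigma)
    (rule sum.reindex_bij_witness[of _ "\<lambda>(i, k). (i - k, k)" "\<lambda>(i, j). (i + j, j)"]; auto)

lemma Phi_zero: "Phi n a lam c (\<lambda>_. 0) t = Pfun n c lam t"
  by (simp add: Phi_def bell_f_zero)

abbreviation jnorm :: "nat \<Rightarrow> (nat \<Rightarrow> complex) \<Rightarrow> real" where
  "jnorm n x \<equiv> (\<Sum>k=1..n-1. cmod (x k))"

text \<open>The balls behind \<open>m\<close> are open, whereas the iterates are only known to stay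
  in the closed ball of radius \<delta>. The estimate is taken at radii d > \<delta>, and continuity
  of \<open>m\<close> allows d to decrease to \<delta>.\<close>

lemma norm_bell_f_diff_le:
  fixes x y :: "nat \<Rightarrow> complex"
  assumes n: "2 \<le> n" and \<delta>: "0 < \<delta>" and i: "i \<in> {1..n-1}"
    and x: "jnorm n x \<le> \<delta>" and y: "jnorm n y \<le> \<delta>"
  shows "cmod (bell_f i x - bell_f i y) \<le> m n \<delta> * jnorm n (\<lambda>k. x k - y k)"
proof (rule tendsto_lowerbound)
  let ?S = "\<Sum>k=1..n-1. cmod (x k - y k)"
  have le: "(\<Sum>k=1..i. cmod (w k)) \<le> jnorm n w" for w :: "nat \<Rightarrow> complex"
    using i by (intro sum_mono2) auto
  have "(m n \<longlongrightarrow> m n \<delta>) (at_right \<delta>)"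
    using isCont_m[OF n \<delta>] unfolding isCont_def by (rule tendsto_mono[OF at_le, rotated]) simp
  then show "((\<lambda>d. m n d * ?S) \<longlongrightarrow> m n \<delta> * ?S) (at_right \<delta>)"
    by (intro tendsto_intros)
  have "cmod (bell_f i x - bell_f i y) \<le> m n d * ?S" if "\<delta> < d" for d
  proof -
    have "cmod (bell_f i x - bell_f i y) \<le> m n d * (\<Sum>k=1..i. cmod (x k - y k))"
      using that i \<delta> le[of x] le[of y] x y by (intro bell_f_lip_norm[where \<delta>=d] bell_f_lip_m[OF n]) auto
    also have "\<dots> \<le> m n d * ?S"
      using m_ge[OF n, of d] that \<delta> by (intro mult_left_mono le) auto
    finally show ?thesis .
  qed
  then show "eventually (\<lambda>d. cmod (bell_f i x - bell_f i y) \<le> m n d * ?S) (at_right \<delta>)"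
    by (auto simp: eventually_at_filter)
qed simp

text \<open>The common shape of the pointwise Lipschitz constant of \<open>Phi\<close> and of the constants \<open>L0\<close>
  and \<open>Q0\<close>.\<close>

definition wsum :: "nat \<Rightarrow> real \<Rightarrow> complex \<Rightarrow> (nat \<Rightarrow> real) \<Rightarrow> (nat \<Rightarrow> real) \<Rightarrow> real" where
  "wsum n w lam p q = (\<Sum>k=1..n-1. 1 / fact k * p k) +
    (\<Sum>i=2..n. \<Sum>k=0..i-2. w * (of_nat (i choose k) * cmod lam ^ k * q i))"

lemma wsum_mono:
  assumes "0 \<le> w" "\<And>k. k \<in> {1..n-1} \<Longrightarrow> p k \<le> p' k" "\<And>i. i \<in> {2..n} \<Longrightarrow> q i \<le> q' i"
  shows "wsum n w lam p q \<le> wsum n w lam p' q'"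
  unfolding wsum_def by (intro add_mono sum_mono mult_left_mono assms) (use assms(1) in auto)

lemma wsum_scale: "u * wsum n w lam p q = wsum n w lam (\<lambda>k. u * p k) (\<lambda>i. u * q i)"
  unfolding wsum_def distrib_left sum_distrib_left by (simp only: mult_ac)

lemma has_bochner_integral_wsum:
  assumes "\<And>k. k \<in> {1..n-1} \<Longrightarrow> has_bochner_integral M (\<lambda>s. p s k) (P k)"
    and "\<And>i. i \<in> {2..n} \<Longrightarrow> has_bochner_integral M (\<lambda>s. q s i) (Q i)"
  shows "has_bochner_integral M (\<lambda>s. wsum n w lam (p s) (q s)) (wsum n w lam P Q)"
  unfolding wsum_def
  by (intro has_bochner_integral_add has_bochner_integral_sum has_bochner_integral_mult_right assms)

text \<open>The factor is kept pointwise in t, through the coefficients at that time, so that it can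
  afterwards be integrated against the Green kernel.\<close>

lemma Phi_lipschitz:
  fixes x y :: "nat \<Rightarrow> complex"
  assumes n: "2 \<le> n" and \<delta>: "0 < \<delta>"
    and x: "jnorm n x \<le> \<delta>" and y: "jnorm n y \<le> \<delta>"
    and D: "jnorm n (\<lambda>k. x k - y k) \<le> D"
  shows "cmod (Phi n a lam c x t - Phi n a lam c y t) \<le>
    wsum n (m n \<delta>) lam (\<lambda>k. cmod (dP k n (\<lambda>i. c i t) lam)) (\<lambda>i. cmod (a i) + cmod (c i t)) * D"
proof -
  let ?f = "\<lambda>i k. of_nat (i choose k) * (a i + c i t) * lam ^ k"
  have eq: "Phi n a lam c w t = Pfun n c lam t + (\<Sum>k=1..n-1. 1 / fact k * dP k n (\<lambda>i. c i t) lam * w k) +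
    (\<Sum>i=2..n. \<Sum>k=0..i-2. ?f i k * bell_f (i - k - 1) w)" for w
    unfolding Phi_def
    by (rule arg_cong2[where f="(+)", OF refl
          sum_triangle_shift[where g="\<lambda>i k l. ?f i k * bell_f (l - 1) w"]])
  have diff: "Phi n a lam c x t - Phi n a lam c y t =
      (\<Sum>k=1..n-1. 1 / fact k * dP k n (\<lambda>i. c i t) lam * (x k - y k)) +
      (\<Sum>i=2..n. \<Sum>k=0..i-2. ?f i k * (bell_f (i - k - 1) x - bell_f (i - k - 1) y))"
    unfolding eq right_diff_distrib sum_subtractf by (simp only: add_diff_add diff_self add_0)
  have lin: "cmod (1 / fact k * dP k n (\<lambda>i. c i t) lam * (x k - y k)) \<le>
      1 / fact k * cmod (dP k n (\<lambda>i. c i t) lam) * D" if k: "k \<in> {1..n-1}" for k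
  proof -
    have "cmod (x k - y k) \<le> jnorm n (\<lambda>k. x k - y k)"
      by (rule member_le_sum[OF k]) auto
    then have d: "cmod (x k - y k) \<le> D" using D by (rule order_trans)
    have "cmod (1 / fact k * dP k n (\<lambda>i. c i t) lam * (x k - y k)) =
        1 / fact k * cmod (dP k n (\<lambda>i. c i t) lam) * cmod (x k - y k)"
      unfolding norm_mult norm_divide by simp
    also have "\<dots> \<le> 1 / fact k * cmod (dP k n (\<lambda>i. c i t) lam) * D"
      using d by (rule mult_left_mono) simp
    finally show ?thesis .
  qed
  have nonlin: "cmod (?f i k * (bell_f (i - k - 1) x - bell_f (i - k - 1) y)) \<le>
      m n \<delta> * (of_nat (i choose k) * cmod lam ^ k * (cmod (a i) + cmod (c i t))) * D"
    if i: "i \<in> {2..n}" and k: "k \<in> {0..i-2}" for i k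
  proof -
    define d where "d = bell_f (i - k - 1) x - bell_f (i - k - 1) y"
    have "cmod d \<le> m n \<delta> * jnorm n (\<lambda>k. x k - y k)"
      unfolding d_def using i k by (intro norm_bell_f_diff_le[OF n \<delta> _ x y]) auto
    also have "\<dots> \<le> m n \<delta> * D"
      by (rule mult_left_mono[OF D order_trans[OF less_imp_le[OF \<delta>] m_ge[OF n \<delta>]]])
    finally have b: "cmod d \<le> m n \<delta> * D" .
    have "cmod (?f i k * d) = of_nat (i choose k) * cmod lam ^ k * (cmod (a i + c i t) * cmod d)"
      by (simp only: norm_mult norm_power norm_of_nat mult_ac)
    also have "\<dots> \<le> of_nat (i choose k) * cmod lam ^ k * ((cmod (a i) + cmod (c i t)) * (m n \<delta> * D))"
      by (intro mult_left_mono mult_mono b norm_triangle_ineq) simp_all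
    finally show ?thesis unfolding d_def by (simp only: mult_ac)
  qed
  show ?thesis
    unfolding diff wsum_def distrib_right[of _ _ D] sum_distrib_right
    by (rule norm_triangle_le, rule add_mono)
      (rule order_trans[OF norm_sum], rule sum_mono, (rule lin | rule order_trans[OF norm_sum], rule sum_mono, rule nonlin); assumption)+
qed

section \<open>Almost periodicity, boundedness and continuity of the nonlinearity\<close>

lemma dP_expand:
  assumes "k \<le> n"
  shows "dP k n c lam = fact k * (\<Sum>j=0..n-k. of_nat ((k + j) choose j) * c (k + j) * lam ^ j)"
  using Taylor_coeff[OF assms, of c lam] by (simp add: field_simps)

lemma Pfun_expand: "Pfun n c lam t = (\<Sum>i\<le>n. c i t * lam ^ i)"
  by (simp add: Pfun_def poly_Pol)

lemma ap_part_dP: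
  assumes "k \<le> n" "\<And>i. i \<le> n \<Longrightarrow> ap_part F (c i) (d i)"
  shows "ap_part F (\<lambda>t. dP k n (\<lambda>i. c i t) lam) (\<lambda>t. dP k n (\<lambda>i. d i t) lam)"
  unfolding dP_expand[OF assms(1)]
  by (intro ap_part_sum ap_part_mult ap_part_const assms(2)) (use assms(1) in auto)

lemma ap_part_Pfun:
  assumes "\<And>i. i \<le> n \<Longrightarrow> ap_part F (c i) (d i)"
  shows "ap_part F (Pfun n c lam) (Pfun n d lam)"
  unfolding Pfun_expand[abs_def]
  by (intro ap_part_sum ap_part_mult ap_part_const assms) auto

lemma ap_part_Phi:
  assumes c: "\<And>i. i \<le> n \<Longrightarrow> ap_part F (c i) (d i)"
    and x: "\<And>k. k \<in> {1..n-1} \<Longrightarrow> ap_part F (\<lambda>t. x t k) (\<lambda>t. y t k)"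
  shows "ap_part F (\<lambda>t. Phi n a lam c (x t) t) (\<lambda>t. Phi n a lam d (y t) t)"
  unfolding Phi_def
  by (intro ap_part_add ap_part_sum ap_part_mult ap_part_const ap_part_bell_f x ap_part_dP
      ap_part_Pfun c) auto

lemma dP_BC:
  assumes "\<And>i. i \<le> n \<Longrightarrow> r i \<in> BC" "k \<le> n"
  shows "(\<lambda>s. dP k n (\<lambda>i. r i s) lam) \<in> BC"
  unfolding dP_expand[OF assms(2)]
  by (intro BC_mult BC_const BC_sum assms) (use assms(2) in auto)

lemma Pfun_BC:
  assumes "\<And>i. i \<le> n \<Longrightarrow> r i \<in> BC"
  shows "Pfun n r lam \<in> BC"
  unfolding Pfun_expand[abs_def] by (intro BC_mult BC_const BC_sum assms) auto

lemma tendsto_bell: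
  fixes x :: "'i \<Rightarrow> nat \<Rightarrow> complex"
  assumes "\<And>k. k \<in> {1..i} \<Longrightarrow> ((\<lambda>p. x p k) \<longlongrightarrow> y k) F"
  shows "((\<lambda>p. bell i (x p)) \<longlongrightarrow> bell i y) F"
  using assms
proof (induction i rule: less_induct)
  case (less i)
  then show ?case by (cases i) (auto intro!: tendsto_intros)
qed

lemma tendsto_bell_f:
  fixes x :: "'i \<Rightarrow> nat \<Rightarrow> complex"
  assumes "\<And>k. k \<in> {1..i} \<Longrightarrow> ((\<lambda>p. x p k) \<longlongrightarrow> y k) F"
  shows "((\<lambda>p. bell_f i (x p)) \<longlongrightarrow> bell_f i y) F"
  unfolding bell_f_eq using assms by (intro tendsto_intros tendsto_bell) auto

text \<open>The time \<open>\<tau>\<close> is constant when the limit of the iteration is taken, and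
  moves when continuity in t is derived.\<close>

lemma tendsto_Phi:
  assumes c: "\<And>i. i \<le> n \<Longrightarrow> ((\<lambda>p. c i (\<tau> p)) \<longlongrightarrow> c i t) F"
    and x: "\<And>k. k \<in> {1..n-1} \<Longrightarrow> ((\<lambda>p. x p k) \<longlongrightarrow> y k) F"
  shows "((\<lambda>p. Phi n a lam c (x p) (\<tau> p)) \<longlongrightarrow> Phi n a lam c y t) F"
proof -
  have "((\<lambda>p. dP k n (\<lambda>i. c i (\<tau> p)) lam) \<longlongrightarrow> dP k n (\<lambda>i. c i t) lam) F" if "k \<in> {1..n-1}" for k
  proof -
    have k: "k \<le> n" using that by auto
    show ?thesis unfolding dP_expand[OF k] using k by (intro tendsto_intros c) auto
  qed
  moreover have "((\<lambda>p. bell_f (i - 1) (x p)) \<longlongrightarrow> bell_f (i - 1) y) F" if "i \<in> {2..n}" for i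
    using that by (intro tendsto_bell_f x) auto
  ultimately show ?thesis
    unfolding Phi_def Pfun_expand using c x by (intro tendsto_intros) auto
qed

text \<open>Subtracting the equation for \<open>\<theta>\<close> from the one for \<open>\<theta> + \<psi>\<close> leaves the equation for \<open>\<psi>\<close>:
  this is the origin of the tilde operators.\<close>

lemma Phi_diff_eq:
  assumes n: "2 \<le> n" and r: "\<And>i. i \<le> n \<Longrightarrow> r i t = \<mu> i t + \<nu> i t"
  shows "Pfun n \<nu> lam t + Lop n lam \<nu> \<theta> t + Ftilde_nu n lam \<nu> \<theta> t
      + Lop n lam r \<psi> t + Ltilde_theta n a lam r \<theta> \<psi> t + Ftilde_theta n a lam r \<theta> \<psi> t =
    Phi n a lam r (\<lambda>k. jet \<theta> t k + jet \<psi> t k) t - Phi n a lam \<mu> (jet \<theta> t) t"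
proof -
  let ?x = "jet \<theta> t" and ?w = "jet \<psi> t"
  have P: "Pfun n r lam t = Pfun n \<mu> lam t + Pfun n \<nu> lam t"
    by (simp add: Pfun_expand r algebra_simps sum.distrib)
  have dP: "dP k n (\<lambda>i. r i t) lam = dP k n (\<lambda>i. \<mu> i t) lam + dP k n (\<lambda>i. \<nu> i t) lam" if "k \<in> {1..n-1}" for k
  proof -
    have k: "k \<le> n" using that by auto
    show ?thesis
      unfolding dP_expand[OF k] distrib_left[symmetric] sum.distrib[symmetric]
      by (intro arg_cong2[where f="(*)"] sum.cong refl) (use k r in \<open>auto simp: algebra_simps\<close>)
  qed
  \<comment> \<open>In the addition formula the term k = 0 is free of \<psi>. Each other B_k splits
    into its linear part and the rest: the linear term with k = i cancels against the one removed in
    \<open>bell_f\<close>, and the rest starts at k = 2 because B_1(x) = x.\<close>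
  have bf: "bell_f (i - 1) (\<lambda>k. ?x k + ?w k) = bell i ?x - ?x i +
      (\<Sum>k=1..i-1. of_nat (i choose k) * bell (i - k) ?x * ?w k) +
      (\<Sum>k=2..i. of_nat (i choose k) * bell (i - k) ?x * (bell k ?w - ?w k))" if i: "i \<in> {2..n}" for i
  proof -
    let ?b = "\<lambda>k. of_nat (i choose k) * bell (i - k) ?x"
    obtain p where p: "i = Suc (Suc p)" using i by (metis atLeastAtMost_iff add_2_eq_Suc le_Suc_ex)
    have "bell i (\<lambda>k. ?x k + ?w k) = (\<Sum>k\<le>i. ?b k * bell k ?w)" by (rule bell_add)
    also have "\<dots> = bell i ?x + (\<Sum>k=1..i. ?b k * bell k ?w)"
      unfolding atMost_atLeast0 by (subst sum.atLeast_Suc_atMost) auto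
    also have "(\<Sum>k=1..i. ?b k * bell k ?w) = (\<Sum>k=1..i. ?b k * ?w k) + (\<Sum>k=1..i. ?b k * (bell k ?w - ?w k))"
      by (simp add: sum.distrib[symmetric] algebra_simps)
    also have "(\<Sum>k=1..i. ?b k * (bell k ?w - ?w k)) = (\<Sum>k=2..i. ?b k * (bell k ?w - ?w k))"
      by (subst sum.atLeast_Suc_atMost) (use i in \<open>auto simp: numeral_2_eq_2\<close>)
    also have "(\<Sum>k=1..i. ?b k * ?w k) = (\<Sum>k=1..i-1. ?b k * ?w k) + ?w i"
      unfolding p by simp
    finally show ?thesis by (simp add: bell_f_def p)
  qed
  have L: "(\<Sum>k=1..n-1. 1 / fact k * dP k n (\<lambda>i. r i t) lam * (?x k + ?w k)) =
      (\<Sum>k=1..n-1. 1 / fact k * dP k n (\<lambda>i. \<mu> i t) lam * ?x k) + Lop n lam \<nu> \<theta> t + Lop n lam r \<psi> t"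
  proof -
    have "1 / fact k * dP k n (\<lambda>i. r i t) lam * (?x k + ?w k) =
        1 / fact k * dP k n (\<lambda>i. \<mu> i t) lam * ?x k + 1 / fact k * dP k n (\<lambda>i. \<nu> i t) lam * ?x k
        + 1 / fact k * dP k n (\<lambda>i. r i t) lam * ?w k" if "k \<in> {1..n-1}" for k
      using dP[OF that] by (simp add: field_simps)
    then show ?thesis
      unfolding Lop_def jet_def[symmetric] by (simp add: sum.distrib)
  qed
  have F: "(\<Sum>i=2..n. \<Sum>j=0..n-i. of_nat ((i + j) choose j) * (a (i + j) + r (i + j) t) * lam ^ j *
      bell_f (i - 1) (\<lambda>k. ?x k + ?w k)) =
    (\<Sum>i=2..n. \<Sum>j=0..n-i. of_nat ((i + j) choose j) * (a (i + j) + \<mu> (i + j) t) * lam ^ j *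
      bell_f (i - 1) ?x) + Ftilde_nu n lam \<nu> \<theta> t + Ltilde_theta n a lam r \<theta> \<psi> t + Ftilde_theta n a lam r \<theta> \<psi> t"
    unfolding Ftilde_nu_def Ltilde_theta_def Ftilde_theta_def jet_def[symmetric] sum.distrib[symmetric]
  proof (intro sum.cong refl)
    fix i j assume i: "i \<in> {2..n}" and j: "j \<in> {0..n-i}"
    have x: "bell_f (i - 1) ?x = bell i ?x - ?x i" using i by (simp add: bell_f_def)
    have "r (i + j) t = \<mu> (i + j) t + \<nu> (i + j) t" using i j by (intro r) auto
    then show "of_nat ((i + j) choose j) * (a (i + j) + r (i + j) t) * lam ^ j *
        bell_f (i - 1) (\<lambda>k. ?x k + ?w k) =
      of_nat ((i + j) choose j) * (a (i + j) + \<mu> (i + j) t) * lam ^ j * bell_f (i - 1) ?x +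
      of_nat ((i + j) choose j) * \<nu> (i + j) t * lam ^ j * (bell i ?x - ?x i) +
      of_nat ((i + j) choose j) * (a (i + j) + r (i + j) t) * lam ^ j *
        (\<Sum>k=1..i-1. of_nat (i choose k) * bell (i - k) ?x * ?w k) +
      of_nat ((i + j) choose j) * (a (i + j) + r (i + j) t) * lam ^ j *
        (\<Sum>k=2..i. of_nat (i choose k) * bell (i - k) ?x * (bell k ?w - ?w k))"
      unfolding bf[OF i] x by (simp only: algebra_simps)
  qed
  show ?thesis
    unfolding Phi_def L F P by simp
qed

section \<open>The Green operator of distinct exponents\<close>

lemma nderiv_Suc: "nderiv (Suc i) f = (\<lambda>t. vector_derivative (nderiv i f) (at t))"
  by (simp add: nderiv_def)

lemma nderiv_0: "nderiv 0 f = f"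
  by (simp add: nderiv_def)

lemma nderiv_chain:
  assumes "\<And>i t. i < k \<Longrightarrow> (g i has_vector_derivative g (Suc i) t) (at t)"
  shows "i \<le> k \<Longrightarrow> nderiv i (g 0) = g i" and "times_differentiable k (g 0)"
proof -
  show *: "nderiv i (g 0) = g i" if "i \<le> k" for i
    using that
  proof (induction i)
    case (Suc i)
    then have "vector_derivative (g i) (at t) = g (Suc i) t" for t
      using assms[of i t] by (intro vector_derivative_at) simp
    then show ?case using Suc by (simp add: nderiv_Suc)
  qed (simp add: nderiv_0)
  show "times_differentiable k (g 0)"
    unfolding times_differentiable_def
    using assms * differentiableI_vector by (metis less_imp_le)
qed

lemma nderiv_has_vector_derivative:
  assumes "times_differentiable k f" "i < k"
  shows "(nderiv i f has_vector_derivative nderiv (Suc i) f t) (at t)"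
  using assms by (simp add: times_differentiable_def nderiv_Suc vector_derivative_works)

locale distinct_exponents =
  fixes n :: nat and \<gamma> :: "nat \<Rightarrow> complex"
  assumes n3: "3 \<le> n" and inj: "inj_on \<gamma> {1..n-1}"
    and Re_nz: "\<And>j. j \<in> {1..n-1} \<Longrightarrow> Re (\<gamma> j) \<noteq> 0"
begin

text \<open>The i-th derivative of G[h] as far as the exponentials are concerned: the terms in
  \<open>h\<close> produced by differentiation cancel for i \<le> n - 2.\<close>

definition Gi :: "nat \<Rightarrow> (real \<Rightarrow> complex) \<Rightarrow> real \<Rightarrow> complex" where
  "Gi i h t = (\<Sum>j=1..n-1. \<gamma> j ^ i / Gam n \<gamma> j * green1 (\<gamma> j) h t)"

definition J :: "(real \<Rightarrow> complex) \<Rightarrow> real \<Rightarrow> nat \<Rightarrow> complex" where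
  "J h t k = - Gi (k - 1) h t"

lemma green_eq_Gi: "green n \<gamma> h = Gi 0 h"
  by (simp add: green_def[abs_def] Gi_def[abs_def])

text \<open>Lagrange interpolation of x^i at the n - 1 nodes \<gamma>_j. The sum is the total jump
  of the i-th differentiated kernel, so \<open>h\<close> itself first appears in the derivative of
  order n - 1, with coefficient 1.\<close>

lemma sum_power_Gam:
  assumes "i \<le> n - 2"
  shows "(\<Sum>j=1..n-1. \<gamma> j ^ i / Gam n \<gamma> j) = (if i = n - 2 then 1 else 0)"
  using Lagrange_top_coeff[of "{1..n-1}" \<gamma> "monom 1 i"] inj n3 assms
  by (auto simp: Gam_def degree_monom_eq poly_monom)

text \<open>Interpolation of the constant 1 with 0 as an additional node: the full sum is 0, and the
  term of the node 0 moves to the other side. This is the origin of the factor in front of the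
  integral in \<open>y_formula\<close>.\<close>

lemma sum_inverse_Gam:
  "(\<Sum>j=1..n-1. 1 / (Gam n \<gamma> j * \<gamma> j)) = (-1) ^ n * (\<Prod>j=1..n-1. inverse (\<gamma> j))"
proof -
  let ?x = "\<lambda>j. if j = 0 then 0 else \<gamma> j"
  have nz: "\<gamma> j \<noteq> 0" if "j \<in> {1..n-1}" for j using Re_nz[OF that] by auto
  have I: "{0..n-1} = insert 0 {1..n-1}" by auto
  have "inj_on ?x {0..n-1}"
    unfolding I using inj nz by (auto simp: inj_on_def)
  then have "(\<Sum>j\<in>{0..n-1}. poly 1 (?x j) / (\<Prod>k\<in>{0..n-1} - {j}. ?x j - ?x k)) = coeff 1 (card {0..n-1} - 1)"
    by (intro Lagrange_top_coeff) (use n3 in auto)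
  also have "\<dots> = 0" using n3 by simp
  finally have "0 = (\<Sum>j\<in>{0..n-1}. 1 / (\<Prod>k\<in>{0..n-1} - {j}. ?x j - ?x k))" by simp
  also have "\<dots> = 1 / (\<Prod>k\<in>{1..n-1}. - \<gamma> k) + (\<Sum>j=1..n-1. 1 / (\<Prod>k\<in>{0..n-1} - {j}. ?x j - ?x k))"
  proof -
    have "{0..n-1} - {0} = {1..n-1}" by auto
    moreover have "(\<Prod>k\<in>{1..n-1}. ?x 0 - ?x k) = (\<Prod>k\<in>{1..n-1}. - \<gamma> k)"
      by (rule prod.cong) auto
    ultimately show ?thesis unfolding I by (subst sum.insert) auto
  qed
  also have "(\<Sum>j=1..n-1. 1 / (\<Prod>k\<in>{0..n-1} - {j}. ?x j - ?x k)) = (\<Sum>j=1..n-1. 1 / (Gam n \<gamma> j * \<gamma> j))"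
  proof (intro sum.cong refl)
    fix j assume j: "j \<in> {1..n-1}"
    have "{0..n-1} - {j} = insert 0 ({1..n-1} - {j})" using j by auto
    moreover have "(\<Prod>k\<in>{1..n-1} - {j}. ?x j - ?x k) = Gam n \<gamma> j"
      unfolding Gam_def by (rule prod.cong) (use j in auto)
    ultimately show "1 / (\<Prod>k\<in>{0..n-1} - {j}. ?x j - ?x k) = 1 / (Gam n \<gamma> j * \<gamma> j)"
      using j by simp
  qed
  finally have "(\<Sum>j=1..n-1. 1 / (Gam n \<gamma> j * \<gamma> j)) = - (1 / (\<Prod>k\<in>{1..n-1}. - \<gamma> k))"
    by (simp add: eq_neg_iff_add_eq_0 add.commute)
  also have "(\<Prod>k\<in>{1..n-1}. - \<gamma> k) = (-1) ^ (n - 1) * (\<Prod>k\<in>{1..n-1}. \<gamma> k)"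
    by (simp add: prod_uminus)
  also have "- (1 / ((-1) ^ (n - 1) * (\<Prod>k\<in>{1..n-1}. \<gamma> k))) = (-1) ^ n * (\<Prod>j=1..n-1. inverse (\<gamma> j))"
  proof -
    obtain p where "n = Suc p" using n3 by (cases n) auto
    moreover have "1 / ((-1) ^ p * q) = (-1) ^ p * inverse q" for q :: complex
      by (cases "even p") (auto simp: field_simps)
    ultimately show ?thesis by (simp add: prod_inversef[symmetric] comp_def)
  qed
  finally show ?thesis .
qed

section \<open>Derivatives of the Green operator\<close>

lemma Gi_has_vector_derivative:
  assumes h: "green_defined n \<gamma> h" and i: "i < n - 2"
  shows "(Gi i h has_vector_derivative Gi (Suc i) h t) (at t)"
proof -
  have "((\<lambda>t. \<Sum>j\<in>{1..n-1}. \<gamma> j ^ i / Gam n \<gamma> j * green1 (\<gamma> j) h t) has_vector_derivative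
      (\<Sum>j\<in>{1..n-1}. \<gamma> j ^ i / Gam n \<gamma> j * \<gamma> j * green1 (\<gamma> j) h t)) (at t)"
    using h sum_power_Gam[of i] i n3
    by (intro green_combination_has_vector_derivative Re_nz) (auto simp: green_defined_def)
  then show ?thesis by (simp add: Gi_def[abs_def] mult_ac)
qed

lemma Gi_has_vector_derivative_top:
  assumes h: "green_defined n \<gamma> h" "continuous_on UNIV h"
  shows "(Gi (n - 2) h has_vector_derivative Gi (n - 1) h t + h t) (at t)"
proof -
  have "((\<lambda>t. \<Sum>j\<in>{1..n-1}. \<gamma> j ^ (n - 2) / Gam n \<gamma> j * green1 (\<gamma> j) h t) has_vector_derivative
      (\<Sum>j\<in>{1..n-1}. \<gamma> j ^ (n - 2) / Gam n \<gamma> j * (\<gamma> j * green1 (\<gamma> j) h t + h t))) (at t)"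
  proof (rule has_vector_derivative_sum)
    fix j assume j: "j \<in> {1..n-1}"
    have "(green1 (\<gamma> j) h has_vector_derivative \<gamma> j * green1 (\<gamma> j) h t + h t) (at t)"
      using h j by (intro green1_has_vector_derivative Re_nz) (auto simp: green_defined_def)
    then show "((\<lambda>t. \<gamma> j ^ (n - 2) / Gam n \<gamma> j * green1 (\<gamma> j) h t) has_vector_derivative
        \<gamma> j ^ (n - 2) / Gam n \<gamma> j * (\<gamma> j * green1 (\<gamma> j) h t + h t)) (at t)"
      by (rule has_vector_derivative_mult_right)
  qed
  moreover have "(\<Sum>j\<in>{1..n-1}. \<gamma> j ^ (n - 2) / Gam n \<gamma> j * (\<gamma> j * green1 (\<gamma> j) h t + h t)) =
      Gi (n - 1) h t + h t"
  proof -
    have "n - 1 = Suc (n - 2)" using n3 by simp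
    then have pw: "x ^ (n - 1) = x * x ^ (n - 2)" for x :: complex by (simp only: power_Suc)
    have "(\<Sum>j\<in>{1..n-1}. \<gamma> j ^ (n - 2) / Gam n \<gamma> j * (\<gamma> j * green1 (\<gamma> j) h t + h t)) =
        Gi (n - 1) h t + (\<Sum>j=1..n-1. \<gamma> j ^ (n - 2) / Gam n \<gamma> j) * h t"
      unfolding Gi_def sum_distrib_right sum.distrib[symmetric]
      by (intro sum.cong refl) (unfold pw, simp add: distrib_left mult_ac add_divide_distrib)
    then show ?thesis using sum_power_Gam[of "n - 2"] by simp
  qed
  ultimately show ?thesis by (simp add: Gi_def[abs_def])
qed

lemma continuous_Gi:
  assumes "green_defined n \<gamma> h"
  shows "continuous_on UNIV (Gi i h)"
  unfolding Gi_def[abs_def] using assms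
  by (intro continuous_intros continuous_green1 Re_nz) (auto simp: green_defined_def)

lemma nderiv_green:
  assumes "green_defined n \<gamma> h"
  shows "i \<le> n - 2 \<Longrightarrow> nderiv i (green n \<gamma> h) = Gi i h"
  using nderiv_chain(1)[of "n - 2" "\<lambda>i. Gi i h" i] Gi_has_vector_derivative[OF assms]
  by (simp add: green_eq_Gi)

lemma nderiv_minus_green:
  assumes "green_defined n \<gamma> h" "\<And>t. z t = - green n \<gamma> h t"
  shows "i \<le> n - 2 \<Longrightarrow> nderiv i z = (\<lambda>t. - Gi i h t)" and "times_differentiable (n - 2) z"
proof -
  have z: "z = (\<lambda>t. - Gi 0 h t)" using assms(2) by (auto simp: green_eq_Gi)
  have d: "((\<lambda>t. - Gi i h t) has_vector_derivative - Gi (Suc i) h t) (at t)" if "i < n - 2" for i t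
    using Gi_has_vector_derivative[OF assms(1) that] by (rule has_vector_derivative_minus)
  show "i \<le> n - 2 \<Longrightarrow> nderiv i z = (\<lambda>t. - Gi i h t)" "times_differentiable (n - 2) z"
    using nderiv_chain(1)[of "n - 2" "\<lambda>i t. - Gi i h t" i, OF d]
      nderiv_chain(2)[of "n - 2" "\<lambda>i t. - Gi i h t", OF d] unfolding z by auto
qed

lemma jet_minus_green:
  assumes "green_defined n \<gamma> h" "\<And>t. z t = - green n \<gamma> h t" "k \<in> {1..n-1}"
  shows "jet z t k = J h t k"
  using nderiv_minus_green(1)[OF assms(1,2), of "k - 1"] assms(3) by (auto simp: jet_def J_def)

lemma nderiv_minus_green_top:
  assumes "green_defined n \<gamma> h" "\<And>t. z t = - green n \<gamma> h t" "continuous_on UNIV h"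
  shows "nderiv (n - 1) z = (\<lambda>t. - (Gi (n - 1) h t + h t))" and "times_differentiable (n - 1) z"
proof -
  have e: "n - 1 = Suc (n - 2)" using n3 by simp
  have top: "(nderiv (n - 2) z has_vector_derivative - (Gi (n - 1) h t + h t)) (at t)" for t
    unfolding nderiv_minus_green(1)[OF assms(1,2) order_refl]
    by (rule has_vector_derivative_minus Gi_has_vector_derivative_top assms)+
  then show "nderiv (n - 1) z = (\<lambda>t. - (Gi (n - 1) h t + h t))"
    unfolding e nderiv_Suc by (intro ext vector_derivative_at)
  show "times_differentiable (n - 1) z"
    using nderiv_minus_green(2)[OF assms(1,2)] differentiableI_vector[OF top]
    unfolding times_differentiable_def e by (auto simp: less_Suc_eq)
qed

lemma BC_green_defined: "h \<in> BC \<Longrightarrow> green_defined n \<gamma> h"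
  by (simp add: green_defined_def integrable_green Re_nz)

lemma Gi_diff: "h1 \<in> BC \<Longrightarrow> h2 \<in> BC \<Longrightarrow> Gi i (\<lambda>t. h1 t - h2 t) t = Gi i h1 t - Gi i h2 t"
  unfolding Gi_def sum_subtractf[symmetric]
  by (intro sum.cong refl) (simp add: green1_diff Re_nz algebra_simps)

lemma Gi_add:
  assumes "green_defined n \<gamma> h1" "green_defined n \<gamma> h2"
  shows "Gi i (\<lambda>t. h1 t + h2 t) t = Gi i h1 t + Gi i h2 t"
proof -
  have "green1 (\<gamma> j) (\<lambda>t. h1 t + h2 t) t = green1 (\<gamma> j) h1 t + green1 (\<gamma> j) h2 t" if "j \<in> {1..n-1}" for j
    using assms that by (simp add: green1_def green_defined_def distrib_left)
  then show ?thesis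
    unfolding Gi_def sum.distrib[symmetric] by (intro sum.cong refl) (simp add: algebra_simps)
qed

lemma ap_part_Gi:
  assumes "F \<in> infinity_filters" "ap_part F f g"
  shows "ap_part F (\<lambda>t. - Gi i f t) (\<lambda>t. - Gi i g t)"
proof -
  have "ap_part F (\<lambda>t. - 1 * Gi i f t) (\<lambda>t. - 1 * Gi i g t)"
    unfolding Gi_def[abs_def]
    by (intro ap_part_cmult ap_part_sum ap_part_green1 Re_nz assms)
  then show ?thesis by simp
qed

lemma vanishing_Gi:
  assumes "F \<in> infinity_filters" "f \<in> vanishing F"
  shows "(\<lambda>t. - Gi i f t) \<in> vanishing F"
proof -
  have "ap_part F f (\<lambda>_. 0)" using assms(2) by (simp add: ap_part_def AP_const)
  from ap_part_Gi[OF assms(1) this] show ?thesis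
    by (simp add: ap_part_def Gi_def green1_def)
qed

section \<open>Continuity and contraction estimates for the jets\<close>

lemma J_tendsto:
  assumes "\<And>k. H k \<in> BC" "uniform_limit UNIV H h sequentially"
  shows "(\<lambda>p. J (H p) t k) \<longlonglongrightarrow> J h t k"
  unfolding J_def Gi_def
  by (intro tendsto_intros green1_tendsto_uniform_limit Re_nz assms)

text \<open>The origin of \<open>alpha_tilde\<close>: it adds up the weights |\<gamma>_j|^(k-1) of
  the n - 1 components of the jet.\<close>

lemma sum_cmod_J_le:
  "jnorm n (J d t) \<le>
    (\<Sum>j=1..n-1. alpha_tilde n \<gamma> j / cmod (Gam n \<gamma> j) * cmod (green1 (\<gamma> j) d t))"
proof -
  have "jnorm n (J d t) \<le>
      (\<Sum>k=1..n-1. \<Sum>j=1..n-1. cmod (\<gamma> j) ^ (k - 1) / cmod (Gam n \<gamma> j) * cmod (green1 (\<gamma> j) d t))"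
  proof (intro sum_mono)
    fix k
    show "cmod (J d t k) \<le> (\<Sum>j=1..n-1. cmod (\<gamma> j) ^ (k - 1) / cmod (Gam n \<gamma> j) * cmod (green1 (\<gamma> j) d t))"
      unfolding J_def Gi_def norm_minus_cancel
      by (rule order_trans[OF norm_sum]) (simp add: norm_mult norm_divide norm_power)
  qed
  also have "\<dots> = (\<Sum>j=1..n-1. \<Sum>k=1..n-1. cmod (\<gamma> j) ^ (k - 1) / cmod (Gam n \<gamma> j) * cmod (green1 (\<gamma> j) d t))"
    by (rule sum.swap)
  also have "\<dots> = (\<Sum>j=1..n-1. alpha_tilde n \<gamma> j / cmod (Gam n \<gamma> j) * cmod (green1 (\<gamma> j) d t))"
  proof (intro sum.cong refl)
    fix j
    have "(\<Sum>k=1..n-1. cmod (\<gamma> j) ^ (k - 1)) = alpha_tilde n \<gamma> j"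
      unfolding alpha_tilde_def
      by (rule sum.reindex_bij_witness[of _ Suc "\<lambda>k. k - 1"]) (use n3 in auto)
    then show "(\<Sum>k=1..n-1. cmod (\<gamma> j) ^ (k - 1) / cmod (Gam n \<gamma> j) * cmod (green1 (\<gamma> j) d t)) =
        alpha_tilde n \<gamma> j / cmod (Gam n \<gamma> j) * cmod (green1 (\<gamma> j) d t)"
      by (simp add: sum_distrib_right[symmetric] sum_divide_distrib[symmetric])
  qed
  finally show ?thesis .
qed

text \<open>The pointwise Lipschitz factor is integrated against the modulus of the kernel. The
  constants a_i contribute |a_i| / |\<alpha>_j|, the coefficients r_i their Green integrals; this
  explains the two summands in \<open>Q0\<close>.\<close>

lemma green1_Phi_diff_le:
  assumes r: "\<And>i. i \<le> n \<Longrightarrow> r i \<in> BC" and \<delta>: "0 < \<delta>" and j: "j \<in> {1..n-1}"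
    and x: "\<And>t. jnorm n (x t) \<le> \<delta>" and y: "\<And>t. jnorm n (y t) \<le> \<delta>"
    and D: "\<And>t. jnorm n (\<lambda>k. x t k - y t k) \<le> D"
    and BC: "(\<lambda>t. Phi n a lam r (x t) t - Phi n a lam r (y t) t) \<in> BC"
  shows "cmod (green1 (\<gamma> j) (\<lambda>t. Phi n a lam r (x t) t - Phi n a lam r (y t) t) t) \<le>
    wsum n (m n \<delta>) lam (\<lambda>k. supnorm (green_abs (of_real (Re (\<gamma> j))) (\<lambda>s. dP k n (\<lambda>i. r i s) lam)))
      (\<lambda>i. cmod (a i) / \<bar>Re (\<gamma> j)\<bar> +
        supnorm (green_abs (of_real (Re (\<gamma> j))) (\<lambda>s. of_real (cmod (r i s))))) * D"
proof -
  let ?\<omega> = "\<gamma> j"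
  let ?K = "\<lambda>s. cmod (green_kernel ?\<omega> t s)"
  have \<omega>: "Re ?\<omega> \<noteq> 0" by (rule Re_nz[OF j])
  have D0: "0 \<le> D" using D[of t] by (rule order_trans[rotated]) (simp add: sum_nonneg)
  have n2: "2 \<le> n" using n3 by simp
  have m0: "0 \<le> m n \<delta>" using m_ge[OF n2 \<delta>] \<delta> by linarith
  note hb = has_bochner_integral_green_abs[OF \<omega>]
  have dP: "(\<lambda>s. dP k n (\<lambda>i. r i s) lam) \<in> BC" if "k \<in> {1..n-1}" for k
    using that by (intro dP_BC r) auto
  have rc: "(\<lambda>s. of_real (cmod (r i s)) :: complex) \<in> BC" if "i \<in> {2..n}" for i
    using that by (intro BC_cmod r) auto
  let ?w = "wsum n (m n \<delta>) lam"
  let ?b = "\<lambda>s. ?w (\<lambda>k. cmod (dP k n (\<lambda>i. r i s) lam)) (\<lambda>i. cmod (a i) + cmod (r i s)) * D"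
  let ?B = "?w (\<lambda>k. green_abs ?\<omega> (\<lambda>s. dP k n (\<lambda>i. r i s) lam) t)
      (\<lambda>i. 1 / \<bar>Re ?\<omega>\<bar> * cmod (a i) + green_abs ?\<omega> (\<lambda>s. of_real (cmod (r i s))) t) * D"
  have "has_bochner_integral lborel (\<lambda>s. ?K s * (cmod (a i) + cmod (r i s)))
      (1 / \<bar>Re ?\<omega>\<bar> * cmod (a i) + green_abs ?\<omega> (\<lambda>s. of_real (cmod (r i s))) t)" if "i \<in> {2..n}" for i
    using has_bochner_integral_add[OF has_bochner_integral_mult_left[of "cmod (a i)", OF
        has_bochner_integral_green_kernel[OF \<omega>]] hb[OF rc[OF that]]]
    by (simp add: distrib_left)
  then have hB: "has_bochner_integral lborel (\<lambda>s. ?K s * ?b s) ?B"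
    unfolding mult.assoc[symmetric] wsum_scale
    by (intro has_bochner_integral_mult_left has_bochner_integral_wsum hb dP)
  have "cmod (green1 ?\<omega> (\<lambda>t. Phi n a lam r (x t) t - Phi n a lam r (y t) t) t) \<le> ?B"
    by (rule cmod_green1_le_bochner[OF \<omega> BC hB])
      (rule Phi_lipschitz[OF n2 \<delta> x y D])
  also have "\<dots> \<le> ?w (\<lambda>k. supnorm (green_abs (of_real (Re ?\<omega>)) (\<lambda>s. dP k n (\<lambda>i. r i s) lam)))
      (\<lambda>i. cmod (a i) / \<bar>Re ?\<omega>\<bar> + supnorm (green_abs (of_real (Re ?\<omega>)) (\<lambda>s. of_real (cmod (r i s))))) * D"
    by (intro mult_right_mono[OF _ D0] wsum_mono m0 add_mono green_abs_le_supnorm \<omega> dP rc) auto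
  finally show ?thesis .
qed

text \<open>Adding the bounds for the single exponents, weighted by \<alpha>~_j / |\<Gamma>_j|,
  reproduces the constants of the hypothesis exactly.\<close>

lemma J_Phi_diff_le:
  assumes r: "\<And>i. i \<le> n \<Longrightarrow> r i \<in> BC" and \<delta>: "0 < \<delta>"
    and x: "\<And>t. jnorm n (x t) \<le> \<delta>" and y: "\<And>t. jnorm n (y t) \<le> \<delta>"
    and D: "\<And>t. jnorm n (\<lambda>k. x t k - y t k) \<le> D"
    and BC: "(\<lambda>t. Phi n a lam r (x t) t) \<in> BC" "(\<lambda>t. Phi n a lam r (y t) t) \<in> BC"
  shows "jnorm n (\<lambda>k. J (\<lambda>t. Phi n a lam r (x t) t) t k - J (\<lambda>t. Phi n a lam r (y t) t) t k)
    \<le> (L0 n r lam \<gamma> + m n \<delta> * Q0 n a r lam \<gamma>) * D"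
proof -
  let ?d = "\<lambda>t. Phi n a lam r (x t) t - Phi n a lam r (y t) t"
  let ?w = "\<lambda>j. wsum n (m n \<delta>) lam (\<lambda>k. supnorm (green_abs (of_real (Re (\<gamma> j))) (\<lambda>s. dP k n (\<lambda>i. r i s) lam)))
      (\<lambda>i. cmod (a i) / \<bar>Re (\<gamma> j)\<bar> + supnorm (green_abs (of_real (Re (\<gamma> j))) (\<lambda>s. of_real (cmod (r i s)))))"
  let ?c = "\<lambda>j. alpha_tilde n \<gamma> j / cmod (Gam n \<gamma> j)"
  have a0: "0 \<le> alpha_tilde n \<gamma> j" for j by (simp add: alpha_tilde_def sum_nonneg)
  have "jnorm n (\<lambda>k. J (\<lambda>t. Phi n a lam r (x t) t) t k - J (\<lambda>t. Phi n a lam r (y t) t) t k) =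
      jnorm n (J ?d t)"
    by (simp add: J_def Gi_diff[OF BC] norm_minus_commute)
  also have "\<dots> \<le> (\<Sum>j=1..n-1. ?c j * cmod (green1 (\<gamma> j) ?d t))"
    by (rule sum_cmod_J_le)
  also have "\<dots> \<le> (\<Sum>j=1..n-1. ?c j * (?w j * D))"
    using a0 by (intro sum_mono mult_left_mono green1_Phi_diff_le r \<delta> x y D BC_minus BC) auto
  also have "\<dots> = (\<Sum>j=1..n-1. ?c j * ?w j) * D"
    by (simp only: sum_distrib_right mult.assoc)
  also have "(\<Sum>j=1..n-1. ?c j * ?w j) = L0 n r lam \<gamma> + m n \<delta> * Q0 n a r lam \<gamma>"
    unfolding wsum_def L0_def Q0_def distrib_left[of "?c _"] sum.distrib sum_distrib_left
    by (intro arg_cong2[where f="(+)"] sum.cong refl)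
      (use a0 in \<open>simp add: norm_mult norm_divide\<close>, simp only: mult_ac)
  finally show ?thesis .
qed

end

section \<open>Reduction of the linear equation\<close>

text \<open>If X' = x_1, then B_i(x) is exp(- X) times the i-th derivative of exp(X);
  differentiating this product gives the right-hand side.\<close>

lemma bell_has_vector_derivative:
  fixes x :: "real \<Rightarrow> nat \<Rightarrow> complex"
  assumes "\<And>k. k \<in> {1..i} \<Longrightarrow> ((\<lambda>t. x t k) has_vector_derivative x t (Suc k)) (at t)"
  shows "((\<lambda>t. bell i (x t)) has_vector_derivative bell (Suc i) (x t) - x t 1 * bell i (x t)) (at t)"
  using assms
proof (induction i rule: less_induct)
  case (less i)
  show ?case
  proof (cases i)
    case 0
    then show ?thesis by simp
  next
    case (Suc p)
    let ?B = "\<lambda>k. bell k (x t)"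
    let ?D = "\<lambda>j. of_nat (p choose j) * ((?B (Suc (p - j)) - x t 1 * ?B (p - j)) * x t (j + 1)
        + ?B (p - j) * x t (Suc (j + 1)))"
    have "((\<lambda>t. of_nat (p choose j) * (bell (p - j) (x t) * x t (j + 1))) has_vector_derivative ?D j) (at t)"
      if j: "j \<in> {..p}" for j
    proof -
      have 1: "((\<lambda>t. bell (p - j) (x t)) has_vector_derivative ?B (Suc (p - j)) - x t 1 * ?B (p - j)) (at t)"
        using Suc j by (intro less.IH less.prems) auto
      have 2: "((\<lambda>t. x t (j + 1)) has_vector_derivative x t (Suc (j + 1))) (at t)"
        using Suc j by (intro less.prems) auto
      have "((\<lambda>t. bell (p - j) (x t) * x t (j + 1)) has_vector_derivative
          ?B (p - j) * x t (Suc (j + 1)) + (?B (Suc (p - j)) - x t 1 * ?B (p - j)) * x t (j + 1)) (at t)"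
        by (rule has_vector_derivative_mult[OF 1 2])
      from has_vector_derivative_mult_right[OF this, of "of_nat (p choose j)"] show ?thesis
        by (simp only: add.commute)
    qed
    then have "((\<lambda>t. \<Sum>j\<le>p. of_nat (p choose j) * (bell (p - j) (x t) * x t (j + 1)))
        has_vector_derivative (\<Sum>j\<le>p. ?D j)) (at t)"
      by (rule has_vector_derivative_sum)
    moreover have "(\<Sum>j\<le>p. ?D j) = bell (Suc i) (x t) - x t 1 * bell i (x t)"
    proof -
      have "(\<Sum>j\<le>p. ?D j) = (\<Sum>j\<le>p. of_nat (p choose j) *
            (?B (Suc (p - j)) * x t (j + 1) + ?B (p - j) * x t (Suc j + 1))) -
          x t 1 * (\<Sum>j\<le>p. of_nat (p choose j) * ?B (p - j) * x t (j + 1))"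
        unfolding sum_distrib_left sum_subtractf[symmetric]
        by (intro sum.cong refl) (simp add: algebra_simps)
      also have "(\<Sum>j\<le>p. of_nat (p choose j) *
            (?B (Suc (p - j)) * x t (j + 1) + ?B (p - j) * x t (Suc j + 1))) = bell (Suc i) (x t)"
        unfolding Suc bell.simps(2)[of "Suc p"] atLeast0AtMost
        by (rule sum_choose_Suc[symmetric])
      finally show ?thesis unfolding Suc bell.simps(2)[of p] atLeast0AtMost .
    qed
    ultimately show ?thesis unfolding Suc by (simp add: atLeast0AtMost mult.assoc)
  qed
qed

lemma bell_single: "bell i (\<lambda>k. if k = 1 then c else 0) = c ^ i"
proof (induction i)
  case (Suc i)
  have "bell (Suc i) (\<lambda>k. if k = 1 then c else 0) =
      (\<Sum>j\<in>{0}. of_nat (i choose j) * bell (i - j) (\<lambda>k. if k = 1 then c else 0) * c)"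
    unfolding bell.simps by (rule sum.mono_neutral_cong_right) auto
  then show ?case using Suc by simp
qed simp

text \<open>Since \<open>y = exp (\<integral> (\<lambda> + z))\<close> has \<open>y\<^sup>(\<^sup>i\<^sup>) = y B\<^sub>i(\<lambda> + z, z', \<dots>)\<close>, the first sum is the left-hand
  side of \<open>(E)\<close> divided by \<open>y\<close>.\<close>

lemma linear_ode_eq_Riccati:
  assumes n: "2 \<le> n" and root: "poly (Pol n a) lam = 0" and r_n: "r n t = 0"
  shows "(\<Sum>i\<le>n. (a i + r i t) * bell i (\<lambda>k. (if k = 1 then lam else 0) + jet z t k)) =
    Dop n a lam z t + Pfun n r lam t + Lop n lam r z t + Fop n a lam r z t"
proof -
  let ?w = "jet z t" and ?c = "\<lambda>i. a i + r i t"
  have split: "dP k n ?c lam = dP k n a lam + dP k n (\<lambda>i. r i t) lam" if k: "k \<le> n" for k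
    unfolding dP_expand[OF k] distrib_left[symmetric] sum.distrib[symmetric]
    by (intro arg_cong2[where f="(*)"] sum.cong refl) (simp add: algebra_simps)
  have "(\<Sum>i\<le>n. ?c i * bell i (\<lambda>k. (if k = 1 then lam else 0) + ?w k)) =
      (\<Sum>i\<le>n. ?c i * (\<Sum>k\<le>i. of_nat (i choose k) * lam ^ (i - k) * bell k ?w))"
    by (simp only: bell_add bell_single)
  also have "\<dots> = (\<Sum>k\<le>n. dP k n ?c lam / fact k * bell k ?w)"
    by (rule Taylor_sum)
  also have "\<dots> = dP 0 n ?c lam + (\<Sum>k=1..n. dP k n ?c lam / fact k * bell k ?w)"
    unfolding atMost_atLeast0 by (subst sum.atLeast_Suc_atMost) auto
  also have "dP 0 n ?c lam = Pfun n r lam t"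
    using root by (simp add: split) (simp add: dP_def Pfun_def)
  also have "(\<Sum>k=1..n. dP k n ?c lam / fact k * bell k ?w) =
      (\<Sum>k=1..n. 1 / fact k * dP k n a lam * ?w k) + (\<Sum>k=1..n. 1 / fact k * dP k n (\<lambda>i. r i t) lam * ?w k) +
      (\<Sum>k=1..n. dP k n ?c lam / fact k * bell_f (k - 1) ?w)"
    unfolding sum.distrib[symmetric]
  proof (intro sum.cong refl)
    fix k assume k: "k \<in> {1..n}"
    then have "bell k ?w = ?w k + bell_f (k - 1) ?w" by (simp add: bell_f_def)
    then have "dP k n ?c lam / fact k * bell k ?w = dP k n ?c lam / fact k * ?w k + dP k n ?c lam / fact k * bell_f (k - 1) ?w"
      by (simp only: distrib_left)
    also have "dP k n ?c lam / fact k * ?w k =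
        1 / fact k * dP k n a lam * ?w k + 1 / fact k * dP k n (\<lambda>i. r i t) lam * ?w k"
      using k by (simp add: split add_divide_distrib distrib_right)
    finally show "dP k n ?c lam / fact k * bell k ?w =
        1 / fact k * dP k n a lam * ?w k + 1 / fact k * dP k n (\<lambda>i. r i t) lam * ?w k +
        dP k n ?c lam / fact k * bell_f (k - 1) ?w" .
  qed
  also have "(\<Sum>k=1..n. 1 / fact k * dP k n a lam * ?w k) = Dop n a lam z t"
    by (simp add: Dop_def jet_def)
  also have "(\<Sum>k=1..n. 1 / fact k * dP k n (\<lambda>i. r i t) lam * ?w k) = Lop n lam r z t"
  proof -
    have "dP n n (\<lambda>i. r i t) lam = 0" using r_n by (simp add: dP_expand)
    moreover have "{1..n} = insert n {1..n-1}" "n \<notin> {1..n-1}" using n by auto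
    ultimately show ?thesis by (simp add: Lop_def jet_def)
  qed
  \<comment> \<open>The term k = 1 drops out because \<open>bell_f 0\<close> is 0.\<close>
  also have "(\<Sum>k=1..n. dP k n ?c lam / fact k * bell_f (k - 1) ?w) =
      (\<Sum>k=2..n. dP k n ?c lam / fact k * bell_f (k - 1) ?w)"
    by (rule sum.mono_neutral_right) (auto simp: bell_f_eq)
  also have "\<dots> = Fop n a lam r z t"
    unfolding Fop_def
  proof (intro sum.cong refl)
    fix k assume "k \<in> {2..n}"
    then have k: "k \<le> n" by simp
    show "dP k n ?c lam / fact k * bell_f (k - 1) ?w =
        (\<Sum>j=0..n-k. of_nat ((k + j) choose j) * (a (k + j) + r (k + j) t) * lam ^ j * bell_f (k - 1) ?w)"
      unfolding Taylor_coeff[OF k] sum_distrib_right ..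
  qed
  finally show ?thesis by (simp only: add_ac)
qed

text \<open>Stated through the logarithmic derivative because \<open>y_formula\<close> agrees with
  the exponential of the integral of \<lambda> + z only up to a constant factor.\<close>

lemma solves_E_exponential:
  assumes n: "2 \<le> n" and an: "a n = 1" and root: "poly (Pol n a) lam = 0"
    and r_n: "\<And>t. r n t = 0" and R: "solves_R n a r lam z"
    and y: "\<And>t. (y has_vector_derivative (lam + z t) * y t) (at t)"
  shows "solves_E n a r y"
proof -
  have td: "times_differentiable (n - 1) z" using R by (simp add: solves_R_def)
  define x where "x t k = (if k = 1 then lam else 0) + jet z t k" for t k
  have dx: "((\<lambda>t. x t k) has_vector_derivative x t (Suc k)) (at t)" if k: "k \<in> {1..n-1}" for k t
  proof -
    have "((\<lambda>t. (if k = 1 then lam else 0) + nderiv (k - 1) z t) has_vector_derivative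
        0 + nderiv (Suc (k - 1)) z t) (at t)"
      using k by (intro has_vector_derivative_add has_vector_derivative_const
          nderiv_has_vector_derivative[OF td]) auto
    then show ?thesis using k by (simp add: x_def jet_def)
  qed
  have x1: "x t 1 = lam + z t" for t by (simp add: x_def jet_def nderiv_0)
  define g where "g i t = y t * bell i (x t)" for i t
  have "(g i has_vector_derivative g (Suc i) t) (at t)" if "i < n" for i t
  proof -
    have "((\<lambda>t. bell i (x t)) has_vector_derivative bell (Suc i) (x t) - x t 1 * bell i (x t)) (at t)"
      using that by (intro bell_has_vector_derivative dx) auto
    from has_vector_derivative_mult[OF y this]
    have "(g i has_vector_derivative
        y t * (bell (Suc i) (x t) - x t 1 * bell i (x t)) + (lam + z t) * y t * bell i (x t)) (at t)"
      by (simp add: g_def[abs_def])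
    moreover have "y t * (bell (Suc i) (x t) - x t 1 * bell i (x t)) + (lam + z t) * y t * bell i (x t) = g (Suc i) t"
      unfolding x1 g_def by (simp only: algebra_simps)
    ultimately show ?thesis by simp
  qed
  note ch = nderiv_chain[where g=g and k=n, OF this]
  have g0: "g 0 = y" by (auto simp: g_def)
  have nd: "nderiv i y t = y t * bell i (x t)" if "i \<le> n" for i t
    using ch(1)[OF _ that] by (simp add: g0 g_def)
  have "nderiv n y t + (\<Sum>i=0..n-1. (a i + r i t) * nderiv i y t) = 0" for t
  proof -
    have I: "{..n} = insert n {0..n-1}" "n \<notin> {0..n-1}" using n by auto
    have "nderiv n y t + (\<Sum>i=0..n-1. (a i + r i t) * nderiv i y t) = (\<Sum>i\<le>n. (a i + r i t) * nderiv i y t)"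
      unfolding I(1) using I(2) an r_n by simp
    also have "\<dots> = y t * (\<Sum>i\<le>n. (a i + r i t) * bell i (x t))"
      unfolding sum_distrib_left by (intro sum.cong refl) (simp add: nd)
    also have "(\<Sum>i\<le>n. (a i + r i t) * bell i (x t)) = 0"
      using linear_ode_eq_Riccati[where r=r, OF n root r_n, of t z] R by (simp add: x_def[abs_def] solves_R_def)
    finally show ?thesis by simp
  qed
  then show ?thesis using ch(2) g0 by (simp add: solves_E_def)
qed

section \<open>The fixed point\<close>

context distinct_exponents
begin

lemma Phi_jet_eq_J:
  assumes "green_defined n \<gamma> h" "\<And>t. z t = - green n \<gamma> h t"
  shows "Phi n a lam c (jet z t) t = Phi n a lam c (J h t) t"
  by (intro Phi_cong jet_minus_green assms)

text \<open>The characteristic polynomial of \<open>Dop\<close> is P(a; \<lambda> + x) / x, with the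
  roots \<gamma>_j, so all Green integrals cancel. Only the summand \<open>h\<close> in the
  derivative of order n - 1 survives, with leading coefficient a_n = 1.\<close>

lemma Dop_minus_green:
  assumes an: "a n = 1" and root: "poly (Pol n a) lam = 0"
    and roots: "\<And>j. j \<in> {1..n-1} \<Longrightarrow> poly (Pol n a) (lam + \<gamma> j) = 0"
    and h: "green_defined n \<gamma> h" "continuous_on UNIV h" and z: "\<And>t. z t = - green n \<gamma> h t"
  shows "Dop n a lam z t = - h t"
proof -
  let ?p = "\<lambda>k. 1 / fact k * dP k n a lam"
  have top: "?p n = 1" using an by (simp add: dP_expand)
  \<comment> \<open>\<open>lam + \<gamma> j\<close> is a root of P(a;x); expand at
    \<open>lam\<close> and divide by \<open>\<gamma> j\<close>, which is nonzero.\<close>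
  have zero: "(\<Sum>k=1..n. ?p k * \<gamma> j ^ (k - 1)) = 0" if j: "j \<in> {1..n-1}" for j
  proof -
    have "0 = (\<Sum>k\<le>n. dP k n a lam / fact k * \<gamma> j ^ k)"
      using roots[OF j] by (simp add: poly_Pol_shift)
    also have "\<dots> = dP 0 n a lam + (\<Sum>k=1..n. dP k n a lam / fact k * \<gamma> j ^ k)"
      unfolding atMost_atLeast0 by (subst sum.atLeast_Suc_atMost) auto
    also have "dP 0 n a lam = 0" using root by (simp add: dP_def)
    also have "(\<Sum>k=1..n. dP k n a lam / fact k * \<gamma> j ^ k) = \<gamma> j * (\<Sum>k=1..n. ?p k * \<gamma> j ^ (k - 1))"
      unfolding sum_distrib_left
    proof (intro sum.cong refl)
      fix k assume "k \<in> {1..n}"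
      then have "\<gamma> j ^ k = \<gamma> j * \<gamma> j ^ (k - 1)" by (cases k) auto
      then show "dP k n a lam / fact k * \<gamma> j ^ k = \<gamma> j * (?p k * \<gamma> j ^ (k - 1))" by simp
    qed
    finally show ?thesis using Re_nz[OF j] by auto
  qed
  have nd: "nderiv (k - 1) z t = - Gi (k - 1) h t - (if k = n then h t else 0)" if "k \<in> {1..n}" for k
    using that nderiv_minus_green(1)[OF h(1) z, of "k - 1"] nderiv_minus_green_top(1)[OF h(1) z h(2)]
    by (cases "k = n") auto
  have "Dop n a lam z t = (\<Sum>k=1..n. ?p k * (- Gi (k - 1) h t - (if k = n then h t else 0)))"
    unfolding Dop_def by (intro sum.cong refl) (simp only: nd)
  also have "\<dots> = - (\<Sum>k=1..n. ?p k * Gi (k - 1) h t) - (\<Sum>k=1..n. ?p k * (if k = n then h t else 0))"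
    by (simp add: right_diff_distrib sum_subtractf sum_negf)
  also have "(\<Sum>k=1..n. ?p k * (if k = n then h t else 0)) = (\<Sum>k\<in>{n}. ?p k * h t)"
    using n3 by (intro sum.mono_neutral_cong_right) auto
  also have "(\<Sum>k\<in>{n}. ?p k * h t) = h t" using top by simp
  also have "(\<Sum>k=1..n. ?p k * Gi (k - 1) h t) =
      (\<Sum>j=1..n-1. (\<Sum>k=1..n. ?p k * \<gamma> j ^ (k - 1)) * (1 / Gam n \<gamma> j * green1 (\<gamma> j) h t))"
    unfolding Gi_def sum_distrib_left sum_distrib_right
    by (subst sum.swap) (intro sum.cong refl, simp)
  also have "\<dots> = 0" by (rule sum.neutral) (use zero in simp)
  finally show ?thesis by simp
qed

lemma solves_R_minus_green:
  assumes an: "a n = 1" and root: "poly (Pol n a) lam = 0"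
    and roots: "\<And>j. j \<in> {1..n-1} \<Longrightarrow> poly (Pol n a) (lam + \<gamma> j) = 0"
    and h: "green_defined n \<gamma> h" "continuous_on UNIV h" and z: "\<And>t. z t = - green n \<gamma> h t"
    and fix_h: "\<And>t. h t = Phi n a lam r (J h t) t"
  shows "solves_R n a r lam z"
  unfolding solves_R_def
proof (intro conjI allI)
  show "times_differentiable (n - 1) z" by (rule nderiv_minus_green_top(2)[OF h(1) z h(2)])
  fix t
  have "Pfun n r lam t + Lop n lam r z t + Fop n a lam r z t = h t"
    unfolding Phi_jet Phi_jet_eq_J[OF h(1) z] by (rule fix_h[symmetric])
  then have "Dop n a lam z t + (Pfun n r lam t + Lop n lam r z t + Fop n a lam r z t) = 0"
    using Dop_minus_green[OF an root roots h z, of t] by simp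
  then show "Dop n a lam z t + Pfun n r lam t + Lop n lam r z t + Fop n a lam r z t = 0"
    by (simp only: add.assoc)
qed

text \<open>Differentiating the second exponent gives z and a multiple of \<open>h\<close>; by
  \<open>sum_inverse_Gam\<close> this multiple cancels the derivative of the integral in the first
  exponent.\<close>

lemma y_formula_has_vector_derivative:
  assumes h: "green_defined n \<gamma> h" "continuous_on UNIV h" and z: "\<And>t. z t = - green n \<gamma> h t"
    and fix_h: "\<And>t. h t = Phi n a lam r (J h t) t"
  shows "(y_formula n a r lam \<gamma> z has_vector_derivative (lam + z t) * y_formula n a r lam \<gamma> z t) (at t)"
proof -
  let ?A = "(-1) ^ n * (\<Prod>j=1..n-1. inverse (\<gamma> j))"
  define E where "E t = lam * of_real t + ?A * (LBINT s=0..ereal t. h s)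
    - (\<Sum>j=1..n-1. 1 / (Gam n \<gamma> j * \<gamma> j) * green1 (\<gamma> j) h t)" for t
  have "Pfun n r lam t + Lop n lam r z t + Fop n a lam r z t = h t" for t
    unfolding Phi_jet Phi_jet_eq_J[OF h(1) z] by (rule fix_h[symmetric])
  then have y: "y_formula n a r lam \<gamma> z = (\<lambda>t. exp (E t))"
    by (simp add: y_formula_def E_def Let_def exp_add exp_diff exp_minus divide_inverse fun_eq_iff)
  \<comment> \<open>This interval contains 0 and has t in its interior, so the derivative within it
    is a full derivative.\<close>
  have "((\<lambda>u. LBINT s=ereal 0..ereal u. h s) has_vector_derivative h t) (at t within {-\<bar>t\<bar> - 1..\<bar>t\<bar> + 1})"
    by (rule interval_integral_FTC2) (auto intro: continuous_on_subset[OF h(2)])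
  then have I: "((\<lambda>u. LBINT s=0..ereal u. h s) has_vector_derivative h t) (at t)"
    by (simp add: at_within_Icc_at zero_ereal_def)
  have g: "((\<lambda>t. \<Sum>j=1..n-1. 1 / (Gam n \<gamma> j * \<gamma> j) * green1 (\<gamma> j) h t) has_vector_derivative
      (\<Sum>j=1..n-1. 1 / (Gam n \<gamma> j * \<gamma> j) * (\<gamma> j * green1 (\<gamma> j) h t + h t))) (at t)"
    by (intro has_vector_derivative_sum has_vector_derivative_mult_right green1_has_vector_derivative
        Re_nz h(2)) (use h(1) in \<open>auto simp: green_defined_def\<close>)
  have "(\<Sum>j=1..n-1. 1 / (Gam n \<gamma> j * \<gamma> j) * (\<gamma> j * green1 (\<gamma> j) h t + h t)) =
      (\<Sum>j=1..n-1. 1 / Gam n \<gamma> j * green1 (\<gamma> j) h t) + (\<Sum>j=1..n-1. 1 / (Gam n \<gamma> j * \<gamma> j)) * h t"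
    unfolding sum_distrib_right sum.distrib[symmetric]
  proof (intro sum.cong refl)
    fix j assume "j \<in> {1..n-1}"
    then have "\<gamma> j \<noteq> 0" using Re_nz[of j] by auto
    then show "1 / (Gam n \<gamma> j * \<gamma> j) * (\<gamma> j * green1 (\<gamma> j) h t + h t) =
        1 / Gam n \<gamma> j * green1 (\<gamma> j) h t + 1 / (Gam n \<gamma> j * \<gamma> j) * h t"
      by (simp add: distrib_left)
  qed
  also have "\<dots> = - z t + ?A * h t"
    unfolding sum_inverse_Gam by (simp add: z green_def)
  finally have g': "((\<lambda>t. \<Sum>j=1..n-1. 1 / (Gam n \<gamma> j * \<gamma> j) * green1 (\<gamma> j) h t) has_vector_derivative
      - z t + ?A * h t) (at t)"
    using g by simp
  have "((\<lambda>t. of_real t :: complex) has_vector_derivative 1) (at t)"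
    using has_vector_derivative_of_real[OF DERIV_ident] by simp
  from has_vector_derivative_mult_right[OF this, of lam]
  have "(E has_vector_derivative lam * 1 + ?A * h t - (- z t + ?A * h t)) (at t)"
    unfolding E_def[abs_def]
    by (intro has_vector_derivative_diff has_vector_derivative_add has_vector_derivative_mult_right[OF I] g')
  then have "(E has_vector_derivative lam + z t) (at t)" by simp
  from field_vector_diff_chain_at[OF this DERIV_exp]
  show ?thesis unfolding y by (simp add: comp_def)
qed

text \<open>The coefficient vector is an argument because the same iteration runs with r and with
  \<mu>. Starting from 0 makes the first iterate \<open>Pfun\<close>, the function in the smallness
  assumption.\<close>

fun picard :: "(nat \<Rightarrow> complex) \<Rightarrow> complex \<Rightarrow> (nat \<Rightarrow> real \<Rightarrow> complex) \<Rightarrow> nat \<Rightarrow> real \<Rightarrow> complex" where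
  "picard a lam c 0 = (\<lambda>_. 0)"
| "picard a lam c (Suc k) = (\<lambda>t. Phi n a lam c (J (picard a lam c k) t) t)"

lemma ap_part_picard:
  assumes F: "F \<in> infinity_filters" and c: "\<And>i. i \<le> n \<Longrightarrow> ap_part F (c i) (d i)"
  shows "ap_part F (picard a lam c k) (picard a lam d k)"
proof (induction k)
  case 0
  show ?case unfolding picard.simps by (rule ap_part_const)
next
  case (Suc k)
  show ?case unfolding picard.simps
    by (rule ap_part_Phi[OF c]) (simp_all only: J_def ap_part_Gi[OF F Suc])
qed

lemma J_zero: "J (\<lambda>_. 0) t k = 0"
  by (simp add: J_def Gi_def green1_def)

lemma picard_fixed_point:
  assumes BC: "\<And>k. picard a lam c k \<in> BC"
    and lim: "uniform_limit UNIV (picard a lam c) h sequentially"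
  shows "h t = Phi n a lam c (J h t) t"
proof -
  have "(\<lambda>k. picard a lam c k t) \<longlonglongrightarrow> h t"
    using lim by (rule tendsto_uniform_limitI) simp
  then have "(\<lambda>k. picard a lam c (Suc k) t) \<longlonglongrightarrow> h t"
    by (rule LIMSEQ_Suc)
  moreover have "(\<lambda>k. picard a lam c (Suc k) t) \<longlonglongrightarrow> Phi n a lam c (J h t) t"
    unfolding picard.simps by (intro tendsto_Phi tendsto_const J_tendsto[OF BC lim])
  ultimately show ?thesis by (rule LIMSEQ_unique)
qed

text \<open>Any finite constant will do: the contraction takes place in the jets, and this bound
  only carries the geometric decay back to the iterates \<open>h\<close>.\<close>

lemma Phi_lipschitz_uniform:
  assumes r: "\<And>i. i \<le> n \<Longrightarrow> r i \<in> BC" and \<delta>: "0 < \<delta>"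
  shows "\<exists>C. \<forall>t x y D. jnorm n x \<le> \<delta> \<longrightarrow> jnorm n y \<le> \<delta> \<longrightarrow>
    jnorm n (\<lambda>k. x k - y k) \<le> D \<longrightarrow> cmod (Phi n a lam r x t - Phi n a lam r y t) \<le> C * D"
proof -
  have n2: "2 \<le> n" using n3 by simp
  have m0: "0 \<le> m n \<delta>" using m_ge[OF n2 \<delta>] \<delta> by linarith
  have "\<exists>B. \<forall>t. k \<in> {1..n-1} \<longrightarrow> cmod (dP k n (\<lambda>i. r i t) lam) \<le> B" for k
  proof (cases "k \<in> {1..n-1}")
    case True
    then have "k \<le> n" by auto
    then show ?thesis using dP_BC[where r=r and lam=lam and k=k, OF r] unfolding BC_iff by blast
  qed blast
  then obtain B where B: "\<And>k t. k \<in> {1..n-1} \<Longrightarrow> cmod (dP k n (\<lambda>i. r i t) lam) \<le> B k"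
    by metis
  have "\<exists>B. \<forall>t. i \<le> n \<longrightarrow> cmod (r i t) \<le> B" for i
    using r[of i] unfolding BC_iff by blast
  then obtain R where R: "\<And>i t. i \<le> n \<Longrightarrow> cmod (r i t) \<le> R i" by metis
  show ?thesis
  proof (intro exI allI impI)
    fix t :: real and x y :: "nat \<Rightarrow> complex" and D
    assume x: "jnorm n x \<le> \<delta>" and y: "jnorm n y \<le> \<delta>"
      and D: "jnorm n (\<lambda>k. x k - y k) \<le> D"
    have D0: "0 \<le> D" using D by (rule order_trans[rotated]) (simp add: sum_nonneg)
    show "cmod (Phi n a lam r x t - Phi n a lam r y t) \<le>
        wsum n (m n \<delta>) lam B (\<lambda>i. cmod (a i) + R i) * D"
      by (rule order_trans[OF Phi_lipschitz[OF n2 \<delta> x y D] mult_right_mono[OF wsum_mono[OF m0] D0]])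
        (use B R in auto)
  qed
qed

lemma picard_converges:
  assumes r: "\<And>i. i \<le> n \<Longrightarrow> r i \<in> BC" and BC: "\<And>k. picard a lam r k \<in> BC" and \<delta>: "0 < \<delta>"
    and q: "L0 n r lam \<gamma> + m n \<delta> * Q0 n a r lam \<gamma> = q" "q < 1"
    and small: "\<And>t. jnorm n (J (Pfun n r lam) t) \<le> (1 - q) * \<delta>"
  shows "\<exists>h. uniform_limit UNIV (picard a lam r) h sequentially"
proof -
  let ?H = "picard a lam r"
  have contr: "jnorm n (\<lambda>k. J (?H (Suc p)) t k - J (\<lambda>t. Phi n a lam r (y t) t) t k) \<le> q * D"
    if "\<And>t. jnorm n (J (?H p) t) \<le> \<delta>" "\<And>t. jnorm n (y t) \<le> \<delta>"
      "\<And>t. jnorm n (\<lambda>k. J (?H p) t k - y t k) \<le> D" "(\<lambda>t. Phi n a lam r (y t) t) \<in> BC" for p t y D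
    unfolding q(1)[symmetric] picard.simps
    by (rule J_Phi_diff_le[OF r \<delta> that(1,2,3) _ that(4)]) (use BC[of "Suc p"] in simp_all)
  \<comment> \<open>Compare the new iterate with the one produced by the zero jet, which is
    \<open>Pfun\<close>: the distance is at most q \<delta>, and the smallness assumption leaves
    exactly (1 - q) \<delta> for the jet of \<open>Pfun\<close>.\<close>
  have ball: "jnorm n (J (?H p) t) \<le> \<delta>" for p t
  proof (induction p arbitrary: t)
    case 0
    show ?case using \<delta> by (simp add: J_zero)
  next
    case (Suc p)
    have P: "(\<lambda>t. Phi n a lam r ((\<lambda>_ _. 0) t) t) = Pfun n r lam" by (simp add: Phi_zero)
    have "jnorm n (\<lambda>k. J (?H (Suc p)) t k - J (\<lambda>t. Phi n a lam r ((\<lambda>_ _. 0) t) t) t k) \<le> q * \<delta>"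
      by (rule contr) (use Suc \<delta> Pfun_BC[where r=r, OF r] in \<open>simp_all add: Phi_zero[abs_def]\<close>)
    then have 1: "jnorm n (\<lambda>k. J (?H (Suc p)) t k - J (Pfun n r lam) t k) \<le> q * \<delta>"
      unfolding P .
    have "jnorm n (J (?H (Suc p)) t) \<le>
        (\<Sum>k=1..n-1. cmod (J (Pfun n r lam) t k) + cmod (J (?H (Suc p)) t k - J (Pfun n r lam) t k))"
      by (intro sum_mono norm_triangle_sub)
    also have "\<dots> \<le> (1 - q) * \<delta> + q * \<delta>"
      unfolding sum.distrib by (intro add_mono small 1)
    also have "\<dots> = \<delta>" by (simp add: algebra_simps)
    finally show ?case .
  qed
  \<comment> \<open>A nonnegative ratio for the geometric series, whatever the sign of q.\<close>
  define q' where "q' = max 0 q"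
  have q': "0 \<le> q'" "q' < 1" "q \<le> q'" using q by (auto simp: q'_def)
  have step: "jnorm n (\<lambda>k. J (?H (Suc p)) t k - J (?H p) t k) \<le> q' ^ p * \<delta>" for p t
  proof (induction p arbitrary: t)
    case 0
    show ?case using ball[where p="Suc 0" and t=t] by (simp add: J_zero)
  next
    case (Suc p)
    have "jnorm n (\<lambda>k. J (?H (Suc (Suc p))) t k - J (\<lambda>t. Phi n a lam r (J (?H p) t) t) t k) \<le> q * (q' ^ p * \<delta>)"
      by (rule contr[OF ball ball Suc]) (use BC[of "Suc p"] in simp)
    also have "\<dots> \<le> q' * (q' ^ p * \<delta>)" using q' \<delta> by (intro mult_right_mono) auto
    finally show ?case by (simp add: mult.assoc)
  qed
  obtain C where C: "\<And>t x y D. jnorm n x \<le> \<delta> \<Longrightarrow> jnorm n y \<le> \<delta> \<Longrightarrow>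
    jnorm n (\<lambda>k. x k - y k) \<le> D \<Longrightarrow> cmod (Phi n a lam r x t - Phi n a lam r y t) \<le> C * D"
    using Phi_lipschitz_uniform[where r=r and a=a and lam=lam, OF r \<delta>] by blast
  obtain B where B: "\<And>t. cmod (?H 1 t) \<le> B" using BC[of 1] unfolding BC_iff by blast
  \<comment> \<open>The increment with index p is controlled by the jets of index p - 1, hence the
    shift; the first increment has no predecessor and is bounded directly.\<close>
  define M where "M p = (case p of 0 \<Rightarrow> B | Suc p \<Rightarrow> C * (q' ^ p * \<delta>))" for p
  have "uniform_limit UNIV (\<lambda>N t. \<Sum>p<N. ?H (Suc p) t - ?H p t) (\<lambda>t. \<Sum>p. ?H (Suc p) t - ?H p t) sequentially"
  proof (rule Weierstrass_m_test)
    fix p t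
    show "norm (?H (Suc p) t - ?H p t) \<le> M p"
    proof (cases p)
      case 0
      then show ?thesis using B[of t] by (simp add: M_def)
    next
      case (Suc p')
      have "cmod (Phi n a lam r (J (?H (Suc p')) t) t - Phi n a lam r (J (?H p') t) t) \<le> C * (q' ^ p' * \<delta>)"
        by (intro C ball step)
      then show ?thesis unfolding Suc M_def by simp
    qed
  next
    have "summable (\<lambda>p. C * (q' ^ p * \<delta>))"
      using q' by (intro summable_mult summable_mult2 summable_geometric) simp
    then have "summable (\<lambda>p. M (Suc p))" by (simp add: M_def)
    then show "summable M" by (simp only: summable_Suc_iff)
  qed
  moreover have "(\<Sum>p<N. ?H (Suc p) t - ?H p t) = ?H N t" for N t
    using sum_lessThan_telescope[of "\<lambda>p. ?H p t" N] by simp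
  ultimately show ?thesis by auto
qed

end

section \<open>The theorem\<close>

context distinct_exponents
begin

section \<open>Exploiting the smallness assumption\<close>

lemma supnorm_green_abs_nonneg:
  assumes "j \<in> {1..n-1}" "f \<in> BC"
  shows "0 \<le> supnorm (green_abs (of_real (Re (\<gamma> j))) f)"
  using order_trans[OF green_abs_nonneg green_abs_le_supnorm[OF Re_nz[OF assms(1)] assms(2)]] .

text \<open>\<open>delta_lambda\<close> divides by \<open>Q0\<close>. The summand with j = 1, i = n
  and k = 0 is positive because a_n = 1, and all others are nonnegative.\<close>

lemma Q0_pos:
  assumes an: "a n = 1" and r: "\<And>i. i \<le> n \<Longrightarrow> r i \<in> BC"
  shows "0 < Q0 n a r lam \<gamma>"
proof -
  let ?s = "\<lambda>j i. supnorm (green_abs (of_real (Re (\<gamma> j))) (\<lambda>s. of_real (cmod (r i s))))"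
  let ?f = "\<lambda>j i k. alpha_tilde n \<gamma> j / cmod (Gam n \<gamma> j) * of_nat (i choose k) * cmod lam ^ k *
      (cmod (a i) / \<bar>Re (\<gamma> j)\<bar> + ?s j i)"
  have s0: "0 \<le> ?s j i" if "j \<in> {1..n-1}" "i \<in> {2..n}" for j i
    using that by (intro supnorm_green_abs_nonneg BC_cmod r) auto
  have a0: "0 \<le> alpha_tilde n \<gamma> j" for j by (simp add: alpha_tilde_def sum_nonneg)
  have f0: "0 \<le> ?f j i k" if "j \<in> {1..n-1}" "i \<in> {2..n}" for j i k
    using s0[OF that] a0[of j] by (intro mult_nonneg_nonneg add_nonneg_nonneg divide_nonneg_nonneg) auto
  have one: "1 \<in> {1..n-1}" and nn: "n \<in> {2..n}" using n3 by auto
  have "\<gamma> 1 \<noteq> \<gamma> k" if "k \<in> {1..n-1} - {1}" for k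
    using inj that one by (auto simp: inj_on_def)
  then have G: "0 < cmod (Gam n \<gamma> 1)" by (auto simp: Gam_def)
  have "1 \<le> alpha_tilde n \<gamma> 1"
    unfolding alpha_tilde_def using member_le_sum[of 0 "{0..n-2}" "\<lambda>i. cmod (\<gamma> 1) ^ i"] by simp
  then have p: "0 < ?f 1 n 0"
    using G an s0[OF one nn] Re_nz[OF one] by (simp add: add_pos_nonneg)
  have p: "0 < (\<Sum>k=0..n-2. ?f 1 n k)"
    by (rule sum_pos2[where f="?f 1 n" and i=0]) (simp, simp, rule p, rule f0[OF one nn])
  have p: "0 < (\<Sum>i=2..n. \<Sum>k=0..i-2. ?f 1 i k)"
    by (rule sum_pos2[where f="\<lambda>i. \<Sum>k=0..i-2. ?f 1 i k" and i=n])
      (simp, rule nn, rule p, rule sum_nonneg, rule f0[OF one])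
  have "0 < (\<Sum>j=1..n-1. \<Sum>i=2..n. \<Sum>k=0..i-2. ?f j i k)"
    by (rule sum_pos2[where f="\<lambda>j. \<Sum>i=2..n. \<Sum>k=0..i-2. ?f j i k" and i=1])
      (simp, rule one, rule p, rule sum_nonneg, rule sum_nonneg, rule f0)
  then show ?thesis unfolding Q0_def .
qed

lemma sum_J_le_supnorm:
  assumes h: "h \<in> BC"
  shows "jnorm n (J h t) \<le>
    supnorm (\<lambda>t. \<Sum>i=0..n-2. cmod (nderiv i (green n \<gamma> h) t))"
proof -
  let ?N = "\<lambda>t. \<Sum>i=0..n-2. cmod (nderiv i (green n \<gamma> h) t)"
  have eq: "?N t = jnorm n (J h t)" for t
  proof (rule sum.reindex_bij_witness[of _ "\<lambda>k. k - 1" Suc])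
    fix i assume "i \<in> {0..n-2}"
    then show "cmod (J h t (Suc i)) = cmod (nderiv i (green n \<gamma> h) t)"
      by (simp add: nderiv_green[OF BC_green_defined[OF h]] J_def)
  qed (use n3 in auto)
  obtain B where B: "\<And>s. cmod (h s) \<le> B" using h unfolding BC_iff by blast
  \<comment> \<open>Boundedness, without which the supremum in \<open>supnorm\<close> need not
    dominate the values.\<close>
  have "norm (?N t) \<le> (\<Sum>j=1..n-1. alpha_tilde n \<gamma> j / cmod (Gam n \<gamma> j) * (B / \<bar>Re (\<gamma> j)\<bar>))" for t
  proof -
    have "norm (?N t) = ?N t" by (simp add: sum_nonneg)
    also have "\<dots> \<le> (\<Sum>j=1..n-1. alpha_tilde n \<gamma> j / cmod (Gam n \<gamma> j) * cmod (green1 (\<gamma> j) h t))"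
      unfolding eq by (rule sum_cmod_J_le)
    also have "\<dots> \<le> (\<Sum>j=1..n-1. alpha_tilde n \<gamma> j / cmod (Gam n \<gamma> j) * (B / \<bar>Re (\<gamma> j)\<bar>))"
      by (intro sum_mono mult_left_mono cmod_green1_le Re_nz h B)
        (auto simp: alpha_tilde_def sum_nonneg)
    finally show ?thesis .
  qed
  then have "norm (?N t) \<le> supnorm ?N"
    unfolding supnorm_def by (intro cSUP_upper bdd_aboveI2) auto
  then show ?thesis unfolding eq[symmetric] by simp
qed

text \<open>The family \<open>\<mu>\<^sub>0\<close> only witnesses that the coefficients lie in the
  space. The quantifier over \<mu> stands inside the conclusion because one \<open>h\<close>, hence
  one \<open>z\<close>, has to serve every splitting.\<close>

lemma fixed_points_exist:
  assumes an: "a n = 1" and F: "F \<in> infinity_filters" and r: "\<And>i. i \<le> n \<Longrightarrow> ap_part F (r i) (\<mu>\<^sub>0 i)"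
    and L0_less: "L0 n r lam \<gamma> < 1"
    and small: "supnorm (\<lambda>t. \<Sum>i=0..n-2. cmod (nderiv i (green n \<gamma> (Pfun n r lam)) t))
      \<le> (GREATEST v. v \<in> (\<lambda>\<delta>. (1 - L0 n r lam \<gamma> - m n \<delta> * Q0 n a r lam \<gamma>) * \<delta>)
                            ` {0<..<delta_lambda n a r lam \<gamma>})"
  obtains h where "h \<in> BC" "\<And>t. h t = Phi n a lam r (J h t) t"
    and "\<And>\<mu>. (\<And>i. i \<le> n \<Longrightarrow> ap_part F (r i) (\<mu> i)) \<Longrightarrow>
      \<exists>g. ap_part F h g \<and> (\<forall>t. g t = Phi n a lam \<mu> (J g t) t)"
proof -
  have rBC: "r i \<in> BC" if "i \<le> n" for i using ap_part_BC[OF r[OF that]] .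
  have pBC: "picard a lam r k \<in> BC" for k
    by (rule ap_part_BC[OF ap_part_picard[where c=r and d="\<mu>\<^sub>0", OF F r]])
  have n2: "2 \<le> n" using n3 by simp
  have "\<exists>\<delta>>0. L0 n r lam \<gamma> + m n \<delta> * Q0 n a r lam \<gamma> < 1 \<and>
    (GREATEST v. v \<in> (\<lambda>\<delta>. (1 - L0 n r lam \<gamma> - m n \<delta> * Q0 n a r lam \<gamma>) * \<delta>) ` {0<..<delta_lambda n a r lam \<gamma>})
      = (1 - L0 n r lam \<gamma> - m n \<delta> * Q0 n a r lam \<gamma>) * \<delta>"
    by (rule greatest_attained[OF n2, of "1 - L0 n r lam \<gamma>"])
      (use L0_less Q0_pos[where r=r and a=a, OF an rBC] in \<open>simp_all add: delta_lambda_def\<close>)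
  then obtain \<delta> where \<delta>: "0 < \<delta>" and q: "L0 n r lam \<gamma> + m n \<delta> * Q0 n a r lam \<gamma> < 1"
    and small': "supnorm (\<lambda>t. \<Sum>i=0..n-2. cmod (nderiv i (green n \<gamma> (Pfun n r lam)) t))
      \<le> (1 - L0 n r lam \<gamma> - m n \<delta> * Q0 n a r lam \<gamma>) * \<delta>"
    using small by auto
  have "jnorm n (J (Pfun n r lam) t) \<le>
      (1 - (L0 n r lam \<gamma> + m n \<delta> * Q0 n a r lam \<gamma>)) * \<delta>" for t
    using order_trans[OF sum_J_le_supnorm[OF Pfun_BC[where r=r, OF rBC]] small'] by (simp add: diff_diff_eq)
  then obtain h where lim: "uniform_limit UNIV (picard a lam r) h sequentially"
    using picard_converges[where r=r, OF rBC pBC \<delta> refl q] by blast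
  show ?thesis
  proof (rule that)
    show "h \<in> BC" by (rule BC_uniform_limit[OF pBC lim])
    show "h t = Phi n a lam r (J h t) t" for t by (rule picard_fixed_point[OF pBC lim])
    fix \<mu> assume \<mu>: "\<And>i. i \<le> n \<Longrightarrow> ap_part F (r i) (\<mu> i)"
    have ap: "ap_part F (picard a lam r k) (picard a lam \<mu> k)" for k
      by (rule ap_part_picard[OF F \<mu>])
    obtain g where g: "uniform_limit UNIV (picard a lam \<mu>) g sequentially" "ap_part F h g"
      using ap_part_uniform_limit[OF F ap lim] by blast
    have "picard a lam \<mu> k \<in> BC" for k
      using ap[of k] by (simp add: ap_part_def AP_BC)
    from picard_fixed_point[OF this g(1)] show "\<exists>g. ap_part F h g \<and> (\<forall>t. g t = Phi n a lam \<mu> (J g t) t)"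
      using g(2) by blast
  qed
qed

section \<open>The integral equations (T) and (S)\<close>

lemma solves_T_minus_green:
  assumes g: "g \<in> BC" "\<And>t. g t = Phi n a lam \<mu> (J g t) t" and \<theta>: "\<And>t. \<theta> t = - green n \<gamma> g t"
  shows "solves_T n a \<mu> lam \<gamma> \<theta>"
proof -
  note gd = BC_green_defined[OF g(1)]
  have eq: "(\<lambda>t. Pfun n \<mu> lam t + Lop n lam \<mu> \<theta> t + Fop n a lam \<mu> \<theta> t) = g"
    unfolding Phi_jet Phi_jet_eq_J[OF gd \<theta>] using g(2) by auto
  show ?thesis
    unfolding solves_T_def Let_def eq by (intro conjI allI nderiv_minus_green(2)[OF gd] gd \<theta>)
qed

lemma solves_S_minus_green:
  assumes h: "h \<in> BC" "\<And>t. h t = Phi n a lam r (J h t) t"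
    and g: "g \<in> BC" "\<And>t. g t = Phi n a lam \<mu> (J g t) t"
    and r: "\<And>i t. i \<le> n \<Longrightarrow> r i t = \<mu> i t + \<nu> i t"
    and \<theta>: "\<And>t. \<theta> t = - green n \<gamma> g t" and \<psi>: "\<And>t. \<psi> t = - green n \<gamma> (\<lambda>t. h t - g t) t"
  shows "solves_S n a r \<nu> lam \<gamma> \<theta> \<psi>"
proof -
  note gd = BC_green_defined[OF g(1)]
  note dd = BC_green_defined[OF BC_minus[OF h(1) g(1)]]
  have n2: "2 \<le> n" using n3 by simp
  have j: "jet \<theta> t k + jet \<psi> t k = J h t k" if "k \<in> {1..n-1}" for t k
    using jet_minus_green[OF gd \<theta> that] jet_minus_green[OF dd \<psi> that]
    by (simp add: J_def Gi_diff h(1) g(1))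
  have "Phi n a lam r (\<lambda>k. jet \<theta> t k + jet \<psi> t k) t = h t" for t
    unfolding h(2)[of t] by (rule Phi_cong) (rule j)
  moreover have "Phi n a lam \<mu> (jet \<theta> t) t = g t" for t
    unfolding Phi_jet_eq_J[OF gd \<theta>] by (rule g(2)[symmetric])
  ultimately have eq: "(\<lambda>t. Pfun n \<nu> lam t + Lop n lam \<nu> \<theta> t + Ftilde_nu n lam \<nu> \<theta> t
      + Lop n lam r \<psi> t + Ltilde_theta n a lam r \<theta> \<psi> t + Ftilde_theta n a lam r \<theta> \<psi> t) = (\<lambda>t. h t - g t)"
    using Phi_diff_eq[where r=r and \<mu>=\<mu> and \<nu>=\<nu>, OF n2 r] by simp
  show ?thesis
    unfolding solves_S_def Let_def eq
    by (intro conjI allI nderiv_minus_green(2)[OF gd \<theta>] nderiv_minus_green(2)[OF dd \<psi>] dd \<psi>)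
qed

text \<open>Conversely nothing is known a priori about the continuity of the highest derivatives of \<open>\<theta>\<close>
  and \<open>\<psi>\<close>; it follows from the integral equations.\<close>

lemma solves_T_S_imp_solves_R:
  assumes an: "a n = 1" and root: "poly (Pol n a) lam = 0"
    and roots: "\<And>j. j \<in> {1..n-1} \<Longrightarrow> poly (Pol n a) (lam + \<gamma> j) = 0"
    and r: "\<And>i t. i \<le> n \<Longrightarrow> r i t = \<mu> i t + \<nu> i t" and cont: "\<And>i. i \<le> n \<Longrightarrow> continuous_on UNIV (r i)"
    and T: "solves_T n a \<mu> lam \<gamma> \<theta>" and S: "solves_S n a r \<nu> lam \<gamma> \<theta> \<psi>"
  shows "solves_R n a r lam (\<lambda>t. \<theta> t + \<psi> t)"
proof -
  have n2: "2 \<le> n" using n3 by simp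
  define g where "g t = Phi n a lam \<mu> (jet \<theta> t) t" for t
  define h where "h t = Phi n a lam r (\<lambda>k. jet \<theta> t k + jet \<psi> t k) t" for t
  define d where "d t = h t - g t" for t
  have gd: "green_defined n \<gamma> g" and \<theta>: "\<And>t. \<theta> t = - green n \<gamma> g t"
    using T unfolding solves_T_def Let_def Phi_jet g_def[symmetric] by auto
  have eq: "(\<lambda>t. Pfun n \<nu> lam t + Lop n lam \<nu> \<theta> t + Ftilde_nu n lam \<nu> \<theta> t
      + Lop n lam r \<psi> t + Ltilde_theta n a lam r \<theta> \<psi> t + Ftilde_theta n a lam r \<theta> \<psi> t) = d"
    unfolding d_def[abs_def] h_def g_def
    by (rule ext) (rule Phi_diff_eq[where r=r and \<mu>=\<mu> and \<nu>=\<nu>, OF n2 r])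
  have dd: "green_defined n \<gamma> d" and \<psi>: "\<And>t. \<psi> t = - green n \<gamma> d t"
    using S unfolding solves_S_def Let_def eq by auto
  have hgd: "h = (\<lambda>t. g t + d t)" by (auto simp: d_def)
  have hd: "green_defined n \<gamma> h"
    using gd dd unfolding hgd green_defined_def by (simp add: distrib_left)
  have jet: "jet \<theta> t k + jet \<psi> t k = J h t k" if "k \<in> {1..n-1}" for t k
    using jet_minus_green[OF gd \<theta> that] jet_minus_green[OF dd \<psi> that]
    by (simp add: J_def hgd Gi_add[OF gd dd])
  have hJ: "h t = Phi n a lam r (J h t) t" for t
    unfolding h_def[of t] by (rule Phi_cong) (rule jet)
  \<comment> \<open>A bootstrap: Green integrals of the merely integrable \<open>h\<close> are
    continuous, and \<open>h\<close> is a polynomial in them with continuous coefficients.\<close>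
  have "continuous_on UNIV (\<lambda>t. Phi n a lam r (J h t) t)"
    using cont continuous_Gi[OF hd] unfolding continuous_on_def
    by (auto simp: J_def intro!: tendsto_Phi tendsto_minus)
  then have hc: "continuous_on UNIV h" by (subst continuous_on_cong[OF refl hJ])
  have "\<theta> t + \<psi> t = - green n \<gamma> h t" for t
    using \<theta>[of t] \<psi>[of t] Gi_add[OF gd dd, of 0 t] by (simp add: green_eq_Gi hgd)
  from solves_R_minus_green[OF an root roots hd hc this hJ] show ?thesis .
qed

end

lemma splitting_ap_part:
  assumes "splitting n (vanishing F) r \<mu> \<nu>" "\<And>t. r n t = 0" "i \<le> n"
  shows "ap_part F (r i) (\<mu> i)" and "r i t = \<mu> i t + \<nu> i t"
proof -
  have "ap_part F (r i) (\<mu> i) \<and> (\<forall>t. r i t = \<mu> i t + \<nu> i t)"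
  proof (cases "i = n")
    case True
    have "r n = (\<lambda>_. 0)" "\<mu> n = (\<lambda>_. 0)" using assms by (auto simp: splitting_def)
    then show ?thesis using assms(1) True by (simp add: splitting_def ap_part_const)
  next
    case False
    then have i: "\<mu> i \<in> AP" "\<nu> i \<in> vanishing F" "\<And>t. r i t = \<mu> i t + \<nu> i t"
      using assms by (auto simp: splitting_def)
    have "(\<lambda>t. r i t - \<mu> i t) = \<nu> i" using i(3) by auto
    then show ?thesis using i by (simp add: ap_part_def)
  qed
  then show "ap_part F (r i) (\<mu> i)" "r i t = \<mu> i t + \<nu> i t" by auto
qed

lemma sum_space_iff:
  "f \<in> {\<lambda>t. f t + g t | f g. f \<in> AP \<and> g \<in> vanishing F} \<longleftrightarrow> (\<exists>g. ap_part F f g)"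
proof
  assume "f \<in> {\<lambda>t. f t + g t | f g. f \<in> AP \<and> g \<in> vanishing F}"
  then obtain u v where "f = (\<lambda>t. u t + v t)" "u \<in> AP" "v \<in> vanishing F" by blast
  then have "ap_part F f u" by (simp add: ap_part_def)
  then show "\<exists>g. ap_part F f g" by blast
next
  assume "\<exists>g. ap_part F f g"
  then obtain g where g: "g \<in> AP" "(\<lambda>t. f t - g t) \<in> vanishing F" by (auto simp: ap_part_def)
  then show "f \<in> {\<lambda>t. f t + g t | f g. f \<in> AP \<and> g \<in> vanishing F}"
    by (intro CollectI exI[of _ g] exI[of _ "\<lambda>t. f t - g t"]) simp
qed

theorem theorem3p5:
  fixes n :: nat
    and a :: "nat \<Rightarrow> complex"
    and r :: "nat \<Rightarrow> real \<Rightarrow> complex"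
    and lam :: complex
    and lams \<gamma> :: "nat \<Rightarrow> complex"
    and V W :: "(real \<Rightarrow> complex) set"
  assumes n_ge_3: "n \<ge> 3"
    and a_n: "a n = 1"
    and spaces: "(V = AAP \<and> W = BC0) \<or> (V = AAP0 \<and> W = C00)"
    and r_in: "\<And>i. i < n \<Longrightarrow> r i \<in> V"
    and r_n: "\<And>t. r n t = 0"
    and roots: "Pol n a = [:- lam, 1:] * (\<Prod>j=1..n-1. [:- lams j, 1:])"
    and gamma: "\<And>j. j \<in> {1..n-1} \<Longrightarrow> \<gamma> j = lams j - lam"
    and gamma_distinct: "inj_on \<gamma> {1..n-1}"
    and alpha_nz: "\<And>j. j \<in> {1..n-1} \<Longrightarrow> Re (\<gamma> j) \<noteq> 0"
    and L0_less: "L0 n r lam \<gamma> < 1"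
    and small: "supnorm (\<lambda>t. \<Sum>i=0..n-2. cmod (nderiv i (green n \<gamma> (Pfun n r lam)) t))
      \<le> (GREATEST v. v \<in> (\<lambda>\<delta>. (1 - L0 n r lam \<gamma> - m n \<delta> * Q0 n a r lam \<gamma>) * \<delta>)
                            ` {0<..<delta_lambda n a r lam \<gamma>})"
  shows "(\<exists>y z. solves_E n a r y \<and>
            (\<forall>t. y t = y_formula n a r lam \<gamma> z t) \<and>
            solves_R n a r lam z \<and>
            z \<in> with_derivs (n - 2) V \<and>
            (\<forall>\<mu> \<nu>. splitting n W r \<mu> \<nu> \<longrightarrow>
               (\<exists>\<theta> \<psi>. (\<forall>t. z t = \<theta> t + \<psi> t) \<and>
                  \<theta> \<in> with_derivs (n - 2) AP \<and> \<psi> \<in> with_derivs (n - 2) W \<and>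
                  solves_T n a \<mu> lam \<gamma> \<theta> \<and> solves_S n a r \<nu> lam \<gamma> \<theta> \<psi>)))
       \<and> (\<forall>\<mu> \<nu> \<theta> \<psi>. splitting n W r \<mu> \<nu> \<longrightarrow> \<theta> \<in> AP \<longrightarrow> \<psi> \<in> W \<longrightarrow>
            solves_T n a \<mu> lam \<gamma> \<theta> \<longrightarrow> solves_S n a r \<nu> lam \<gamma> \<theta> \<psi> \<longrightarrow>
            solves_R n a r lam (\<lambda>t. \<theta> t + \<psi> t) \<and> (\<lambda>t. \<theta> t + \<psi> t) \<in> V)"
proof -
  interpret distinct_exponents n \<gamma>
    by unfold_locales (use n_ge_3 gamma_distinct alpha_nz in auto)
  have n2: "2 \<le> n" using n_ge_3 by simp
  \<comment> \<open>From here on the two versions of the theorem are the two choices of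
    \<open>F\<close>.\<close>
  obtain F where F: "F \<in> infinity_filters" and W: "W = vanishing F"
    and V': "V = {\<lambda>t. f t + g t | f g. f \<in> AP \<and> g \<in> vanishing F}"
    using spaces unfolding AAP_def AAP0_def BC0_eq_vanishing C00_eq_vanishing by blast
  have V: "f \<in> V \<longleftrightarrow> (\<exists>g. ap_part F f g)" for f unfolding V' by (rule sum_space_iff)
  have root: "poly (Pol n a) lam = 0" unfolding roots by simp
  have roots': "poly (Pol n a) (lam + \<gamma> j) = 0" if j: "j \<in> {1..n-1}" for j
  proof -
    have "poly (\<Prod>j=1..n-1. [:- lams j, 1:]) (lams j) = 0"
      unfolding poly_prod by (rule prod_zero) (use j in auto)
    then show ?thesis unfolding roots by (simp add: gamma[OF j])
  qed
  have "\<exists>\<mu>. \<forall>i. i \<le> n \<longrightarrow> ap_part F (r i) (\<mu> i)"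
  proof (rule choice, rule allI)
    fix i
    show "\<exists>g. i \<le> n \<longrightarrow> ap_part F (r i) g"
    proof (cases "i = n")
      case True
      have "r n = (\<lambda>_. 0)" using r_n by auto
      then show ?thesis using True ap_part_const by metis
    next
      case False
      then show ?thesis using r_in[of i] V by auto
    qed
  qed
  then obtain \<mu>\<^sub>0 where \<mu>0: "\<And>i. i \<le> n \<Longrightarrow> ap_part F (r i) (\<mu>\<^sub>0 i)" by blast
  obtain h where hBC: "h \<in> BC" and hfix: "\<And>t. h t = Phi n a lam r (J h t) t"
    and parts: "\<And>\<mu>. (\<And>i. i \<le> n \<Longrightarrow> ap_part F (r i) (\<mu> i)) \<Longrightarrow>
      \<exists>g. ap_part F h g \<and> (\<forall>t. g t = Phi n a lam \<mu> (J g t) t)"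
    using fixed_points_exist[where r=r, OF a_n F \<mu>0 L0_less small] by blast
  have hd: "green_defined n \<gamma> h" by (rule BC_green_defined[OF hBC])
  have hc: "continuous_on UNIV h" using hBC by (simp add: BC_iff)
  define z where "z t = - green n \<gamma> h t" for t
  have R: "solves_R n a r lam z"
    by (rule solves_R_minus_green[OF a_n root roots' hd hc z_def hfix])
  have E: "solves_E n a r (y_formula n a r lam \<gamma> z)"
    by (rule solves_E_exponential[OF n2 a_n root r_n R])
      (rule y_formula_has_vector_derivative[OF hd hc z_def hfix])
  have zV: "z \<in> with_derivs (n - 2) V"
  proof -
    \<comment> \<open>No splitting is given at this point; the family \<open>\<mu>\<^sub>0\<close>
      obtained from the coefficients takes its place.\<close>
    obtain g where g: "ap_part F h g" using parts[of "\<mu>\<^sub>0"] \<mu>0 by blast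
    show ?thesis
      unfolding with_derivs_def mem_Collect_eq V
      using nderiv_minus_green[OF hd z_def] ap_part_Gi[OF F g] by fastforce
  qed
  have split: "\<exists>\<theta> \<psi>. (\<forall>t. z t = \<theta> t + \<psi> t) \<and>
      \<theta> \<in> with_derivs (n - 2) AP \<and> \<psi> \<in> with_derivs (n - 2) W \<and>
      solves_T n a \<mu> lam \<gamma> \<theta> \<and> solves_S n a r \<nu> lam \<gamma> \<theta> \<psi>" if s: "splitting n W r \<mu> \<nu>" for \<mu> \<nu>
  proof -
    note ap = splitting_ap_part[where r=r, OF s[unfolded W] r_n]
    obtain g where g: "ap_part F h g" "\<And>t. g t = Phi n a lam \<mu> (J g t) t"
      using parts[of \<mu>] ap(1) by blast
    have gBC: "g \<in> BC" and d: "(\<lambda>t. h t - g t) \<in> vanishing F"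
      using g(1) by (auto simp: ap_part_def AP_BC)
    note gd = BC_green_defined[OF gBC] and dd = BC_green_defined[OF vanishing_BC[OF d]]
    define \<theta> where "\<theta> t = - green n \<gamma> g t" for t
    define \<psi> where "\<psi> t = - green n \<gamma> (\<lambda>t. h t - g t) t" for t
    have "z t = \<theta> t + \<psi> t" for t
      by (simp add: z_def \<theta>_def \<psi>_def green_eq_Gi Gi_diff[OF hBC gBC])
    moreover have "\<theta> \<in> with_derivs (n - 2) AP"
      using nderiv_minus_green[OF gd \<theta>_def] ap_part_Gi[OF F g(1)]
      by (simp add: with_derivs_def ap_part_def)
    moreover have "\<psi> \<in> with_derivs (n - 2) W"
      using nderiv_minus_green[OF dd \<psi>_def] vanishing_Gi[OF F d]
      by (simp add: with_derivs_def W)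
    moreover have "solves_T n a \<mu> lam \<gamma> \<theta>"
      by (rule solves_T_minus_green[OF gBC g(2) \<theta>_def])
    moreover have "solves_S n a r \<nu> lam \<gamma> \<theta> \<psi>"
      by (rule solves_S_minus_green[OF hBC hfix gBC g(2) ap(2) \<theta>_def \<psi>_def])
    ultimately show ?thesis by blast
  qed
  have conv: "solves_R n a r lam (\<lambda>t. \<theta> t + \<psi> t) \<and> (\<lambda>t. \<theta> t + \<psi> t) \<in> V"
    if s: "splitting n W r \<mu> \<nu>" and \<theta>: "\<theta> \<in> AP" and \<psi>: "\<psi> \<in> W"
      and T: "solves_T n a \<mu> lam \<gamma> \<theta>" and S: "solves_S n a r \<nu> lam \<gamma> \<theta> \<psi>" for \<mu> \<nu> \<theta> \<psi>
  proof
    note ap = splitting_ap_part[where r=r, OF s[unfolded W] r_n]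
    show "solves_R n a r lam (\<lambda>t. \<theta> t + \<psi> t)"
    proof (rule solves_T_S_imp_solves_R[where r=r and a=a and \<mu>=\<mu> and \<nu>=\<nu>, OF a_n root roots' _ _ T S])
      fix i assume i: "i \<le> n"
      show "r i t = \<mu> i t + \<nu> i t" for t by (rule ap(2)[OF i])
      show "continuous_on UNIV (r i)" using ap_part_BC[OF ap(1)[OF i]] by (simp add: BC_iff)
    qed
    show "(\<lambda>t. \<theta> t + \<psi> t) \<in> V"
      unfolding V' using \<theta> \<psi> W by blast
  qed
  show ?thesis using E R zV split conv by blast
qed

end
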